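(* Suppose $F$ is an algebraically closed field of characteristic $0$, let $d\ge1$ and let $\lambda=(e^d)$, a partition of $de$. As an $\mathcal H_{de}$-module, the sign module $S^{(1^{de})}$ has vertex $\mathfrak S_\lambda$.
   Context: Let $q\in F^\times$ and let $\mathcal H_n=\mathcal H_n(F,q)$ be the unital associative $F$-algebra with generators $T_1,\dots,T_{n-1}$ and relations $(T_i-q)(T_i+1)=0$, $T_iT_j=T_jT_i$ for $|i-j|>1$, $T_iT_{i+1}T_i=T_{i+1}T_iT_{i+1}$. It has $F$-basis $\{T_w:w\in\mathfrak S_n\}$, where $T_w=T_{i_1}\cdots T_{i_t}$ for a reduced expression $w=s_{i_1}\cdots s_{i_t}$, $s_i=(i,i+1)$. The quantum characteristic $e$ is the smallest positive integer with $1+q+\dots+q^{e-1}=0$ in $F$; assume it exists and $e>1$. For a composition $\lambda=(\lambda_1,\dots,\lambda_s)$ of $n$ (tuple of positive integers with sum $n$), $\mathfrak S_\lambda\cong\mathfrak S_{\lambda_1}\times\cdots\times\mathfrak S_{\lambda_s}$ is the standard parabolic subgroup of $\mathfrak S_n$ preserving the successive intervals of lengths $\lambda_1,\dots,\lambda_s$, and $\mathcal H_\lambda=\langle T_w:w\in\mathfrak S_\lambda\rangle_F$. $(e^d)$ is the partition with $d$ parts equal to $e$. $S^{(1^n)}$ is the one-dimensional right $\mathcal H_n$-module on which every $T_i$ acts as $-1$ (it is the Specht module of the partition $(1^n)$). A right $\mathcal H_n$-module $M$ is relatively $\mathfrak S_\lambda$-projective if it is isomorphic to a direct summand of $M\otimes_{\mathcal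 H_\lambda}\mathcal H_n$. $\mathfrak S_\lambda$ is a vertex of $M$ if $M$ is relatively $\mathfrak S_\lambda$-projective and, for every composition $\mu$ of $n$ such that $M$ is relatively $\mathfrak S_\mu$-projective, some $\mathfrak S_n$-conjugate of $\mathfrak S_\lambda$ is contained in $\mathfrak S_\mu$. *)

theory Defs
  imports
    "HOL-Algebra.Algebra"
    "HOL-Algebra.Sym_Groups"
    "HOL-Algebra.Free_Abelian_Groups"
    "HOL-Computational_Algebra.Polynomial"
begin

section \<open>Right modules over a (non-commutative) ring\<close>

text \<open>As for the library's record for modules over commutative rings, the fields
  \<^const>\<open>monoid.mult\<close> and \<^const>\<open>monoid.one\<close> inherited from \<open>ring\<close> carry no meaning for a module.\<close>

record ('h, 'm) right_mod = "'m ring" +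
  ract :: "'m \<Rightarrow> 'h \<Rightarrow> 'm"  (infixl \<open>\<triangleleft>\<index>\<close> 70)

locale right_module = H?: ring H + M?: abelian_group M
  for H :: "('h, 'a) ring_scheme" (structure) and M :: "('h, 'm, 'b) right_mod_scheme" (structure) +
  assumes ract_closed: "\<lbrakk>m \<in> carrier M; h \<in> carrier H\<rbrakk> \<Longrightarrow> m \<triangleleft>\<^bsub>M\<^esub> h \<in> carrier M"
    and ract_add_left: "\<lbrakk>m \<in> carrier M; m' \<in> carrier M; h \<in> carrier H\<rbrakk> \<Longrightarrow>
      (m \<oplus>\<^bsub>M\<^esub> m') \<triangleleft>\<^bsub>M\<^esub> h = m \<triangleleft>\<^bsub>M\<^esub> h \<oplus>\<^bsub>M\<^esub> m' \<triangleleft>\<^bsub>M\<^esub> h"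
    and ract_add_right: "\<lbrakk>m \<in> carrier M; h \<in> carrier H; h' \<in> carrier H\<rbrakk> \<Longrightarrow>
      m \<triangleleft>\<^bsub>M\<^esub> (h \<oplus>\<^bsub>H\<^esub> h') = m \<triangleleft>\<^bsub>M\<^esub> h \<oplus>\<^bsub>M\<^esub> m \<triangleleft>\<^bsub>M\<^esub> h'"
    and ract_mult: "\<lbrakk>m \<in> carrier M; h \<in> carrier H; h' \<in> carrier H\<rbrakk> \<Longrightarrow>
      m \<triangleleft>\<^bsub>M\<^esub> (h \<otimes>\<^bsub>H\<^esub> h') = (m \<triangleleft>\<^bsub>M\<^esub> h) \<triangleleft>\<^bsub>M\<^esub> h'"
    and ract_one: "m \<in> carrier M \<Longrightarrow> m \<triangleleft>\<^bsub>M\<^esub> \<one>\<^bsub>H\<^esub> = m"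

definition right_submodule ::
    "('h, 'a) ring_scheme \<Rightarrow> 'm set \<Rightarrow> ('h, 'm, 'b) right_mod_scheme \<Rightarrow> bool" where
  "right_submodule H A N \<longleftrightarrow>
     additive_subgroup A N \<and> (\<forall>a\<in>A. \<forall>h\<in>carrier H. a \<triangleleft>\<^bsub>N\<^esub> h \<in> A)"

definition direct_summand ::
    "('h, 'a) ring_scheme \<Rightarrow> 'm set \<Rightarrow> ('h, 'm, 'b) right_mod_scheme \<Rightarrow> bool" where
  "direct_summand H A N \<longleftrightarrow> right_submodule H A N \<and>
     (\<exists>B. right_submodule H B N \<and> A \<inter> B = {\<zero>\<^bsub>N\<^esub>} \<and> A <+>\<^bsub>N\<^esub> B = carrier N)"

definition right_mod_hom :: "('h, 'a) ring_scheme \<Rightarrow> ('h, 'm, 'b) right_mod_scheme \<Rightarrow>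
    ('h, 'k, 'c) right_mod_scheme \<Rightarrow> ('m \<Rightarrow> 'k) set" where
  "right_mod_hom H M N = {f \<in> carrier M \<rightarrow> carrier N.
     (\<forall>m\<in>carrier M. \<forall>m'\<in>carrier M. f (m \<oplus>\<^bsub>M\<^esub> m') = f m \<oplus>\<^bsub>N\<^esub> f m') \<and>
     (\<forall>m\<in>carrier M. \<forall>h\<in>carrier H. f (m \<triangleleft>\<^bsub>M\<^esub> h) = f m \<triangleleft>\<^bsub>N\<^esub> h)}"

definition iso_to_direct_summand :: "('h, 'a) ring_scheme \<Rightarrow> ('h, 'm, 'b) right_mod_scheme \<Rightarrow>
    ('h, 'k, 'c) right_mod_scheme \<Rightarrow> bool" where
  "iso_to_direct_summand H M N \<longleftrightarrow> (\<exists>A f. direct_summand H A N \<and>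
     f \<in> right_mod_hom H M (N\<lparr>carrier := A\<rparr>) \<and> bij_betw f (carrier M) A)"


section \<open>Tensor products\<close>

text \<open>\<open>M \<otimes>\<^sub>B H\<close>, for a subring with underlying set \<open>B\<close> of the ring \<open>H\<close>: the free abelian group
  on the pairs \<open>(m, h)\<close> modulo the biadditivity and \<open>B\<close>-balancing relations, with \<open>H\<close> acting by
  right multiplication on the second factor.\<close>

definition tensor_free ::
    "('h, 'a) ring_scheme \<Rightarrow> ('h, 'm, 'b) right_mod_scheme \<Rightarrow> ('m \<times> 'h \<Rightarrow>\<^sub>0 int) monoid" where
  "tensor_free H M = free_Abelian_group (carrier M \<times> carrier H)"

definition tensor_rels ::
    "('h, 'a) ring_scheme \<Rightarrow> 'h set \<Rightarrow> ('h, 'm, 'b) right_mod_scheme \<Rightarrow> ('m \<times> 'h \<Rightarrow>\<^sub>0 int) set" where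
  "tensor_rels H B M =
     {frag_of (m \<oplus>\<^bsub>M\<^esub> m', h) - frag_of (m, h) - frag_of (m', h) |m m' h.
        m \<in> carrier M \<and> m' \<in> carrier M \<and> h \<in> carrier H} \<union>
     {frag_of (m, h \<oplus>\<^bsub>H\<^esub> h') - frag_of (m, h) - frag_of (m, h') |m h h'.
        m \<in> carrier M \<and> h \<in> carrier H \<and> h' \<in> carrier H} \<union>
     {frag_of (m \<triangleleft>\<^bsub>M\<^esub> b, h) - frag_of (m, b \<otimes>\<^bsub>H\<^esub> h) |m b h.
        m \<in> carrier M \<and> b \<in> B \<and> h \<in> carrier H}"

definition tensor_kernel ::
    "('h, 'a) ring_scheme \<Rightarrow> 'h set \<Rightarrow> ('h, 'm, 'b) right_mod_scheme \<Rightarrow> ('m \<times> 'h \<Rightarrow>\<^sub>0 int) set" where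
  "tensor_kernel H B M = generate (tensor_free H M) (tensor_rels H B M)"

definition tensor_up ::
    "('h, 'a) ring_scheme \<Rightarrow> 'h set \<Rightarrow> ('h, 'm, 'b) right_mod_scheme \<Rightarrow>
      ('h, ('m \<times> 'h \<Rightarrow>\<^sub>0 int) set) right_mod" where
  "tensor_up H B M = (let A = tensor_free H M; K = tensor_kernel H B M in
     \<lparr>carrier = carrier (A Mod K), monoid.mult = undefined, one = undefined,
      ring.zero = \<one>\<^bsub>A Mod K\<^esub>, ring.add = monoid.mult (A Mod K),
      ract = (\<lambda>C h. \<Union>x\<in>C. K #>\<^bsub>A\<^esub> frag_extend (\<lambda>(m, k). frag_of (m, k \<otimes>\<^bsub>H\<^esub> h)) x)\<rparr>)"


section \<open>The Hecke algebra of type A\<close>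

text \<open>The free monoid on \<open>nat\<close>. With it, \<open>word \<Rightarrow>\<^sub>0 'f\<close> with the convolution product of
  \<^theory>\<open>HOL-Library.Poly_Mapping\<close> is the free associative unital \<open>'f\<close>-algebra on \<open>nat\<close>.\<close>

datatype word = Word (letters: "nat list")

instantiation word :: monoid_add
begin

definition zero_word :: word where
  "zero_word = Word []"

definition plus_word :: "word \<Rightarrow> word \<Rightarrow> word" where
  "plus_word u v = Word (letters u @ letters v)"

instance
  by standard (simp_all add: zero_word_def plus_word_def)

end

definition free_algebra :: "nat set \<Rightarrow> (word \<Rightarrow>\<^sub>0 'f::field) ring" where
  "free_algebra I = \<lparr>carrier = {p. \<forall>w\<in>Poly_Mapping.keys p. set (letters w) \<subseteq> I},
     monoid.mult = (*), one = 1, ring.zero = 0, ring.add = (+)\<rparr>"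

definition fconst :: "'f::field \<Rightarrow> (word \<Rightarrow>\<^sub>0 'f)" where
  "fconst c = Poly_Mapping.single 0 c"

definition fgen :: "nat \<Rightarrow> (word \<Rightarrow>\<^sub>0 'f::field)" where
  "fgen i = Poly_Mapping.single (Word [i]) 1"

definition hecke_rels :: "nat \<Rightarrow> 'f::field \<Rightarrow> (word \<Rightarrow>\<^sub>0 'f) set" where
  "hecke_rels n q =
     {(fgen i - fconst q) * (fgen i + 1) |i. i \<in> {1..<n}} \<union>
     {fgen i * fgen j - fgen j * fgen i |i j.
        i \<in> {1..<n} \<and> j \<in> {1..<n} \<and> \<bar>int i - int j\<bar> > 1} \<union>
     {fgen i * fgen (i+1) * fgen i - fgen (i+1) * fgen i * fgen (i+1) |i.
        i \<in> {1..<n} \<and> i + 1 \<in> {1..<n}}"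

definition hecke_ideal :: "nat \<Rightarrow> 'f::field \<Rightarrow> (word \<Rightarrow>\<^sub>0 'f) set" where
  "hecke_ideal n q = Idl\<^bsub>free_algebra {1..<n}\<^esub> (hecke_rels n q)"

definition hecke :: "nat \<Rightarrow> 'f::field \<Rightarrow> (word \<Rightarrow>\<^sub>0 'f) set ring" where
  "hecke n q = free_algebra {1..<n} Quot hecke_ideal n q"

definition hecke_class :: "nat \<Rightarrow> 'f::field \<Rightarrow> (word \<Rightarrow>\<^sub>0 'f) \<Rightarrow> (word \<Rightarrow>\<^sub>0 'f) set" where
  "hecke_class n q p = hecke_ideal n q +>\<^bsub>free_algebra {1..<n}\<^esub> p"

definition hecke_scalar :: "nat \<Rightarrow> 'f::field \<Rightarrow> 'f \<Rightarrow> (word \<Rightarrow>\<^sub>0 'f) set" where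
  "hecke_scalar n q c = hecke_class n q (fconst c)"

definition hecke_gen :: "nat \<Rightarrow> 'f::field \<Rightarrow> nat \<Rightarrow> (word \<Rightarrow>\<^sub>0 'f) set" where
  "hecke_gen n q i = hecke_class n q (fgen i)"

definition simple_refl :: "nat \<Rightarrow> nat \<Rightarrow> nat" where
  "simple_refl i = Transposition.transpose i (i + 1)"

definition word_perm :: "nat list \<Rightarrow> nat \<Rightarrow> nat" where
  "word_perm is = foldr (\<lambda>i w. simple_refl i \<circ> w) is id"

definition reduced_expr :: "nat \<Rightarrow> (nat \<Rightarrow> nat) \<Rightarrow> nat list \<Rightarrow> bool" where
  "reduced_expr n w is \<longleftrightarrow> set is \<subseteq> {1..<n} \<and> word_perm is = w \<and>
     (\<forall>js. set js \<subseteq> {1..<n} \<and> word_perm js = w \<longrightarrow> length is \<le> length js)"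

text \<open>By the braid relations (Matsumoto) the choice of reduced expression is immaterial.\<close>

definition hecke_T :: "nat \<Rightarrow> 'f::field \<Rightarrow> (nat \<Rightarrow> nat) \<Rightarrow> (word \<Rightarrow>\<^sub>0 'f) set" where
  "hecke_T n q w = foldr (\<lambda>i x. hecke_gen n q i \<otimes>\<^bsub>hecke n q\<^esub> x)
     (SOME is. reduced_expr n w is) \<one>\<^bsub>hecke n q\<^esub>"


section \<open>Parabolic subgroups and subalgebras\<close>

definition composition :: "nat \<Rightarrow> nat list \<Rightarrow> bool" where
  "composition n l \<longleftrightarrow> (\<forall>a\<in>set l. 0 < a) \<and> sum_list l = n"

text \<open>The \<open>j\<close>-th successive interval (counting from \<open>0\<close>) of length \<open>l ! j\<close> in \<open>{1..sum_list l}\<close>.\<close>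

definition block :: "nat list \<Rightarrow> nat \<Rightarrow> nat set" where
  "block l j = {sum_list (take j l)<..sum_list (take (j + 1) l)}"

definition parabolic :: "nat \<Rightarrow> nat list \<Rightarrow> (nat \<Rightarrow> nat) set" where
  "parabolic n l = {w \<in> carrier (sym_group n). \<forall>j<length l. w ` block l j = block l j}"

definition hecke_parabolic :: "nat \<Rightarrow> 'f::field \<Rightarrow> nat list \<Rightarrow> (word \<Rightarrow>\<^sub>0 'f) set set" where
  "hecke_parabolic n q l =
     {\<Oplus>\<^bsub>hecke n q\<^esub>w\<in>parabolic n l. hecke_scalar n q (c w) \<otimes>\<^bsub>hecke n q\<^esub> hecke_T n q w |c. True}"


section \<open>Vertices\<close>

definition relatively_projective :: "nat \<Rightarrow> 'f::field \<Rightarrow> nat list \<Rightarrow>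
    ((word \<Rightarrow>\<^sub>0 'f) set, 'm, 'b) right_mod_scheme \<Rightarrow> bool" where
  "relatively_projective n q l M \<longleftrightarrow> right_module (hecke n q) M \<and>
     iso_to_direct_summand (hecke n q) M (tensor_up (hecke n q) (hecke_parabolic n q l) M)"

definition has_vertex :: "nat \<Rightarrow> 'f::field \<Rightarrow>
    ((word \<Rightarrow>\<^sub>0 'f) set, 'm, 'b) right_mod_scheme \<Rightarrow> nat list \<Rightarrow> bool" where
  "has_vertex n q M l \<longleftrightarrow> composition n l \<and> relatively_projective n q l M \<and>
     (\<forall>\<mu>. composition n \<mu> \<and> relatively_projective n q \<mu> M \<longrightarrow>
        (\<exists>g\<in>carrier (sym_group n).
           g <#\<^bsub>sym_group n\<^esub> parabolic n l #>\<^bsub>sym_group n\<^esub> inv\<^bsub>sym_group n\<^esub> g \<subseteq> parabolic n \<mu>))"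


section \<open>Quantum characteristic and the sign module\<close>

definition quantum_char :: "'f::field \<Rightarrow> nat \<Rightarrow> bool" where
  "quantum_char q e \<longleftrightarrow> 0 < e \<and> (\<Sum>i<e. q ^ i) = 0 \<and>
     (\<forall>k. 0 < k \<and> k < e \<longrightarrow> (\<Sum>i<k. q ^ i) \<noteq> 0)"

text \<open>The algebra homomorphism to \<open>'f\<close> sending every generator to \<open>-1\<close>. It annihilates
  \<^const>\<open>hecke_ideal\<close>, so it takes a single value on each element (coset) of \<^const>\<open>hecke\<close>.\<close>

definition sign_eval :: "(word \<Rightarrow>\<^sub>0 'f::field) \<Rightarrow> 'f" where
  "sign_eval p = (\<Sum>w\<in>Poly_Mapping.keys p. Poly_Mapping.lookup p w * (-1) ^ length (letters w))"

text \<open>The elements of \<open>hecke n q\<close> are cosets in one and the same type for all \<open>n\<close> and \<open>q\<close>, which is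
  why these do not occur as parameters.\<close>

definition sign_module :: "((word \<Rightarrow>\<^sub>0 'f::field) set, 'f) right_mod" where
  "sign_module = \<lparr>carrier = UNIV, monoid.mult = undefined, one = undefined,
     ring.zero = 0, ring.add = (+),
     ract = (\<lambda>m C. m * the_elem (sign_eval ` C))\<rparr>"

lemma ring_free_algebra: "ring (free_algebra I :: (word \<Rightarrow>\<^sub>0 'f::field) ring)"
proof -
  have mult: "set (letters w) \<subseteq> I"
    if "w \<in> Poly_Mapping.keys (p * r)" "\<forall>w\<in>Poly_Mapping.keys p. set (letters w) \<subseteq> I"
      "\<forall>w\<in>Poly_Mapping.keys r. set (letters w) \<subseteq> I" for w and p r :: "word \<Rightarrow>\<^sub>0 'f"
    using that keys_mult[of p r] by (fastforce simp: plus_word_def)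
  have add: "set (letters w) \<subseteq> I"
    if "w \<in> Poly_Mapping.keys (p + r)" "\<forall>w\<in>Poly_Mapping.keys p. set (letters w) \<subseteq> I"
      "\<forall>w\<in>Poly_Mapping.keys r. set (letters w) \<subseteq> I" for w and p r :: "word \<Rightarrow>\<^sub>0 'f"
    using that keys_add[of p r] by blast
  show ?thesis
  proof (rule ringI)
    show "abelian_group (free_algebra I :: (word \<Rightarrow>\<^sub>0 'f) ring)"
    proof (rule abelian_groupI)
      fix p :: "word \<Rightarrow>\<^sub>0 'f" assume "p \<in> carrier (free_algebra I)"
      then show "\<exists>y\<in>carrier (free_algebra I). y \<oplus>\<^bsub>free_algebra I\<^esub> p = \<zero>\<^bsub>free_algebra I\<^esub>"
        by (intro bexI[of _ "- p"]) (auto simp: free_algebra_def)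
    qed (auto simp: free_algebra_def add.assoc add.commute dest: add)
    show "monoid (free_algebra I :: (word \<Rightarrow>\<^sub>0 'f) ring)"
      by (rule monoidI) (auto simp: free_algebra_def mult.assoc zero_word_def dest: mult)
  qed (auto simp: free_algebra_def algebra_simps)
qed

lemma hecke_rels_carrier: "hecke_rels n q \<subseteq> carrier (free_algebra {1..<n})"
proof -
  interpret ring "free_algebra {1..<n} :: (word \<Rightarrow>\<^sub>0 'a) ring" by (rule ring_free_algebra)
  let ?R = "free_algebra {1..<n} :: (word \<Rightarrow>\<^sub>0 'a) ring"
  have g: "fgen i \<in> carrier ?R" if "i \<in> {1..<n}" for i
    using that by (auto simp: free_algebra_def fgen_def)
  have c: "fconst c \<in> carrier ?R" for c
    by (auto simp: free_algebra_def fconst_def zero_word_def)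
  have m: "a * b \<in> carrier ?R" if "a \<in> carrier ?R" "b \<in> carrier ?R" for a b
    using m_closed[OF that] by (simp add: free_algebra_def)
  have p: "a + b \<in> carrier ?R" if "a \<in> carrier ?R" "b \<in> carrier ?R" for a b
    using a_closed[OF that] by (simp add: free_algebra_def)
  have u: "- a \<in> carrier ?R" if "a \<in> carrier ?R" for a
    using that by (simp add: free_algebra_def)
  have d: "a - b \<in> carrier ?R" if "a \<in> carrier ?R" "b \<in> carrier ?R" for a b
    using p[OF that(1) u[OF that(2)]] by simp
  have o: "1 \<in> carrier ?R" using one_closed by (simp add: free_algebra_def)
  show ?thesis
    unfolding hecke_rels_def by (auto simp del: One_nat_def simp: Ball_def intro!: g c m p d o)
qed

lemma ideal_hecke: "ideal (hecke_ideal n q) (free_algebra {1..<n})"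
  unfolding hecke_ideal_def
  by (rule ring.genideal_ideal[OF ring_free_algebra hecke_rels_carrier])

lemma ring_hecke: "ring (hecke n q)"
  unfolding hecke_def by (rule ideal.quotient_is_ring[OF ideal_hecke])

lemma sign_eval_superset:
  assumes "finite S" "Poly_Mapping.keys p \<subseteq> S"
  shows "sign_eval p = (\<Sum>w\<in>S. Poly_Mapping.lookup p w * (-1) ^ length (letters w))"
  unfolding sign_eval_def using assms
  by (intro sum.mono_neutral_left) (auto simp: in_keys_iff)

lemma sign_eval_add: "sign_eval (p + r) = sign_eval p + sign_eval r"
proof -
  let ?S = "Poly_Mapping.keys p \<union> Poly_Mapping.keys r"
  have "Poly_Mapping.keys (p + r) \<subseteq> ?S" by (rule keys_add)
  then show ?thesis
    by (simp add: sign_eval_superset[of ?S] lookup_add distrib_right sum.distrib)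
qed

lemma sign_eval_single: "sign_eval (Poly_Mapping.single w c) = c * (-1) ^ length (letters w)"
  by (simp add: sign_eval_superset[of "{w}"])

lemma sign_eval_0: "sign_eval 0 = 0"
  by (simp add: sign_eval_def)

lemma sign_eval_1: "sign_eval 1 = 1"
  using sign_eval_single[of 0 1] unfolding single_one by (simp add: zero_word_def)

lemma sign_eval_uminus: "sign_eval (- p) = - sign_eval p"
  using sign_eval_add[of p "- p"] by (simp add: sign_eval_0 eq_neg_iff_add_eq_0 add.commute)

lemma sign_eval_diff: "sign_eval (p - r) = sign_eval p - sign_eval r"
  using sign_eval_add[of p "- r"] by (simp add: sign_eval_uminus)

lemma sign_eval_sum: "sign_eval (sum f A) = (\<Sum>a\<in>A. sign_eval (f a))"
  by (induction A rule: infinite_finite_induct) (simp_all add: sign_eval_0 sign_eval_add)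

lemma poly_mapping_eq_sum_single:
  "p = (\<Sum>w\<in>Poly_Mapping.keys p. Poly_Mapping.single w (Poly_Mapping.lookup p w))"
  by (rule poly_mapping_eqI)
    (auto simp: lookup_sum lookup_single when_def in_keys_iff sum.delta)

lemma sign_eval_mult: "sign_eval (p * r) = sign_eval p * sign_eval r"
proof -
  have "p * r = (\<Sum>u\<in>Poly_Mapping.keys p. \<Sum>v\<in>Poly_Mapping.keys r.
      Poly_Mapping.single (u + v) (Poly_Mapping.lookup p u * Poly_Mapping.lookup r v))"
    by (subst poly_mapping_eq_sum_single[of p], subst poly_mapping_eq_sum_single[of r])
      (simp add: sum_product mult_single)
  then show ?thesis
    by (simp add: sign_eval_sum sign_eval_single plus_word_def power_add sign_eval_def[of p]
        sign_eval_def[of r] sum_product mult_ac)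
qed

lemma sign_eval_ideal:
  assumes "p \<in> hecke_ideal n q"
  shows "sign_eval p = 0"
proof -
  let ?R = "free_algebra {1..<n} :: (word \<Rightarrow>\<^sub>0 'a) ring"
  let ?I = "{p \<in> carrier ?R. sign_eval p = 0}"
  interpret ring ?R by (rule ring_free_algebra)
  have "ideal ?I ?R"
  proof (rule idealI[OF ring_axioms])
    show "subgroup ?I (add_monoid ?R)"
    proof (rule group.subgroupI[OF a_group])
      fix a assume a: "a \<in> ?I"
      then have "\<ominus>\<^bsub>?R\<^esub> a = - a"
        by (intro minus_equality) (auto simp: free_algebra_def)
      then show "inv\<^bsub>add_monoid ?R\<^esub> a \<in> ?I"
        using a a_inv_closed[of a] unfolding a_inv_def[symmetric] by (simp add: sign_eval_uminus)
    next
      have "\<zero>\<^bsub>?R\<^esub> \<in> ?I" using zero_closed by (simp add: free_algebra_def sign_eval_0)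
      then show "?I \<noteq> {}" by blast
    next
      fix a b assume "a \<in> ?I" "b \<in> ?I"
      then show "a \<otimes>\<^bsub>add_monoid ?R\<^esub> b \<in> ?I"
        using a_closed[of a b] by (simp add: free_algebra_def sign_eval_add)
    qed auto
  next
    fix a x assume "a \<in> ?I" "x \<in> carrier ?R"
    then show "x \<otimes>\<^bsub>?R\<^esub> a \<in> ?I" "a \<otimes>\<^bsub>?R\<^esub> x \<in> ?I"
      using m_closed[of a x] m_closed[of x a] by (simp_all add: free_algebra_def sign_eval_mult)
  qed
  moreover have "hecke_rels n q \<subseteq> ?I"
    using hecke_rels_carrier[of n q]
    by (auto simp: hecke_rels_def sign_eval_mult sign_eval_add sign_eval_diff sign_eval_1 fgen_def
        fconst_def sign_eval_single zero_word_def simp del: One_nat_def)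
  ultimately have "hecke_ideal n q \<subseteq> ?I"
    unfolding hecke_ideal_def by (rule genideal_minimal)
  then show ?thesis using assms by blast
qed

lemma sign_eval_hecke_class: "the_elem (sign_eval ` hecke_class n q p) = sign_eval p"
proof -
  have "sign_eval ` hecke_class n q p = {sign_eval p}"
    using additive_subgroup.zero_closed[OF ideal.axioms(1)[OF ideal_hecke[of n q]]]
    by (auto simp: hecke_class_def a_r_coset_def r_coset_def free_algebra_def sign_eval_add
        sign_eval_ideal image_iff intro!: bexI[of _ "0 :: word \<Rightarrow>\<^sub>0 'a"])
  then show ?thesis by simp
qed

lemma sign_module_gen: "m \<triangleleft>\<^bsub>sign_module\<^esub> hecke_gen n q i = - m"
  by (simp add: sign_module_def hecke_gen_def sign_eval_hecke_class fgen_def sign_eval_single)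

lemma right_module_sign: "right_module (hecke n q) sign_module"
proof -
  let ?R = "free_algebra {1..<n} :: (word \<Rightarrow>\<^sub>0 'a) ring"
  interpret I: ideal "hecke_ideal n q" ?R by (rule ideal_hecke)
  have rep: "\<exists>p\<in>carrier ?R. h = hecke_class n q p" if "h \<in> carrier (hecke n q)" for h
    using that by (auto simp: hecke_def FactRing_def A_RCOSETS_def RCOSETS_def hecke_class_def
        a_r_coset_def)
  have mult: "hecke_class n q p \<otimes>\<^bsub>hecke n q\<^esub> hecke_class n q r = hecke_class n q (p * r)"
    if "p \<in> carrier ?R" "r \<in> carrier ?R" for p r
    using I.rcoset_mult_add[OF that] by (simp add: hecke_def FactRing_def hecke_class_def free_algebra_def)
  have add: "hecke_class n q p \<oplus>\<^bsub>hecke n q\<^esub> hecke_class n q r = hecke_class n q (p + r)"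
    if "p \<in> carrier ?R" "r \<in> carrier ?R" for p r
    using I.a_rcos_sum[OF that] by (simp add: hecke_def FactRing_def hecke_class_def free_algebra_def)
  have one: "\<one>\<^bsub>hecke n q\<^esub> = hecke_class n q 1"
    by (simp add: hecke_def FactRing_def hecke_class_def free_algebra_def)
  have grp: "abelian_group (sign_module :: ((word \<Rightarrow>\<^sub>0 'a) set, 'a) right_mod)"
  proof (rule abelian_groupI)
    fix x :: 'a
    show "\<exists>y\<in>carrier sign_module. y \<oplus>\<^bsub>sign_module\<^esub> x = \<zero>\<^bsub>sign_module\<^esub>"
      by (auto simp: sign_module_def intro: exI[of _ "- x"])
  qed (auto simp: sign_module_def algebra_simps)
  show ?thesis
    unfolding right_module_def right_module_axioms_def
  proof (intro conjI allI impI ring_hecke grp)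
  qed (auto dest!: rep simp: mult add one sign_module_def sign_eval_hecke_class sign_eval_mult
      sign_eval_add sign_eval_1 algebra_simps)
qed

end

theory Submission
  imports Defs
begin

text \<open>
  The sign module is one-dimensional, and this reduces both halves of the statement to the question
  whether one number is zero.  Write \<open>\<epsilon> (m \<otimes> h) = m sgn(h)\<close> for the multiplication map from the module
  induced from a parabolic \<open>\<mu>\<close> to the sign module.  A homomorphism from the induced module is
  determined by its value on \<open>1 \<otimes> 1\<close>, so every homomorphism to the sign module is a multiple of
  \<open>\<epsilon>\<close>.  Hence the sign module is relatively projective over \<open>\<mu>\<close> exactly when the induced
  module contains a vector \<open>x\<close> on which all generators act as \<open>-1\<close> and for which
  \<open>\<epsilon> x \<noteq> 0\<close>.  In the standard basis of the induced module such an \<open>x\<close> is unique up to a scalar,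
  and \<open>\<epsilon> x\<close> is a multinomial coefficient at the parameter \<open>1/q\<close>.

  If \<open>x\<close> exists, then \<open>e\<close> divides each partial sum \<open>a\<close> of \<open>\<mu>\<close>
  (\<open>relatively_projective_sign_imp_root_of_unity\<close>).  The Hecke algebra acts on functions of 0/1
  sequences (\<open>bit_op\<close>), the indicator of the sequence \<open>1\<^sup>a0\<^sup>b\<close> spans a copy of the sign character of
  the parabolic subalgebra, and this gives coordinates on the induced module, indexed by the
  sequences with \<open>a\<close> ones, whose sum is \<open>\<epsilon>\<close>.  For the coordinates of \<open>x\<close>, a cyclic rotation of
  the sequence multiplies the coordinate by \<open>q\<^sup>a\<close>, while it only permutes the sequences; so the sum
  is zero unless \<open>q\<^sup>a = 1\<close> (\<open>sum_sign_vector_eq_0\<close>).  When all partial sums are multiples of \<open>e\<close>,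
  each block of \<open>\<mu>\<close> is a union of blocks of length \<open>e\<close>, and the containment of parabolic
  subgroups holds without conjugation (\<open>parabolic_equal_blocks_subset\<close>).

  For \<open>\<mu> = (e\<^sup>d)\<close> the vector \<open>x\<close> is constructed by merging the blocks one at a time
  (\<open>relatively_projective_sign_equal_blocks\<close>).  Merging a block of length \<open>b\<close> into an initial
  segment of length \<open>a\<close> is the sum over the minimal coset representatives, weighted by powers of
  \<open>-1/q\<close>; this is the operator \<open>shuffle\<close>, defined by recursion on the last letter.
  It turns a vector that has sign \<open>-1\<close> for all generators except the one at the boundary into a
  vector that has it for all of them (\<open>shuffle_sign\<close>), and it multiplies \<open>\<epsilon>\<close> by a Gaussian
  binomial coefficient at \<open>1/q\<close>.  For \<open>a = ke\<close> and \<open>b = e\<close> this coefficient is \<open>k + 1\<close>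
  (\<open>qbinom_root_of_unity\<close>), so in the end \<open>\<epsilon> x = d!\<close>, which is nonzero in characteristic zero.
\<close>
section \<open>Modules that are retracts\<close>

lemma (in abelian_group) minus_eq_zero_imp_eq:
  assumes "a \<in> carrier G" "b \<in> carrier G" "a \<ominus> b = \<zero>"
  shows "a = b"
  using assms minus_equality[of a "\<ominus> b"] by (simp add: a_minus_def)

lemma right_mod_homD:
  assumes "f \<in> right_mod_hom H M N"
  shows "m \<in> carrier M \<Longrightarrow> f m \<in> carrier N"
    and "m \<in> carrier M \<Longrightarrow> m' \<in> carrier M \<Longrightarrow> f (m \<oplus>\<^bsub>M\<^esub> m') = f m \<oplus>\<^bsub>N\<^esub> f m'"
    and "m \<in> carrier M \<Longrightarrow> h \<in> carrier H \<Longrightarrow> f (m \<triangleleft>\<^bsub>M\<^esub> h) = f m \<triangleleft>\<^bsub>N\<^esub> h"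
  using assms by (auto simp: right_mod_hom_def)

lemma right_mod_hom_zero:
  assumes "f \<in> right_mod_hom H M N" "right_module H M" "right_module H N"
  shows "f \<zero>\<^bsub>M\<^esub> = \<zero>\<^bsub>N\<^esub>"
proof -
  interpret M: right_module H M by (rule assms)
  interpret N: right_module H N by (rule assms)
  have "f \<zero>\<^bsub>M\<^esub> \<oplus>\<^bsub>N\<^esub> f \<zero>\<^bsub>M\<^esub> = f \<zero>\<^bsub>M\<^esub>"
    using right_mod_homD(2)[OF assms(1), of "\<zero>\<^bsub>M\<^esub>" "\<zero>\<^bsub>M\<^esub>"] by simp
  then show ?thesis
    using right_mod_homD(1)[OF assms(1), of "\<zero>\<^bsub>M\<^esub>"] N.M.add.l_cancel_one by simp
qed

lemma right_mod_hom_minus: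
  assumes "f \<in> right_mod_hom H M N" "right_module H M" "right_module H N" "m \<in> carrier M"
  shows "f (\<ominus>\<^bsub>M\<^esub> m) = \<ominus>\<^bsub>N\<^esub> f m"
proof -
  interpret M: right_module H M by (rule assms)
  interpret N: right_module H N by (rule assms)
  have "f (\<ominus>\<^bsub>M\<^esub> m) \<oplus>\<^bsub>N\<^esub> f m = \<zero>\<^bsub>N\<^esub>"
    using right_mod_homD(2)[OF assms(1), of "\<ominus>\<^bsub>M\<^esub> m" m] assms(4)
      right_mod_hom_zero[OF assms(1-3)] by (simp add: M.M.l_neg)
  then show ?thesis
    using right_mod_homD(1)[OF assms(1)] assms(4) N.M.minus_equality by simp
qed

lemma (in right_module) ract_zero: "h \<in> carrier H \<Longrightarrow> \<zero>\<^bsub>M\<^esub> \<triangleleft>\<^bsub>M\<^esub> h = \<zero>\<^bsub>M\<^esub>"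
  using ract_add_left[of "\<zero>\<^bsub>M\<^esub>" "\<zero>\<^bsub>M\<^esub>" h] ract_closed[of "\<zero>\<^bsub>M\<^esub>" h] M.add.l_cancel_one
  by simp

lemma (in right_module) ract_minus:
  assumes "m \<in> carrier M" "h \<in> carrier H"
  shows "(\<ominus>\<^bsub>M\<^esub> m) \<triangleleft>\<^bsub>M\<^esub> h = \<ominus>\<^bsub>M\<^esub> (m \<triangleleft>\<^bsub>M\<^esub> h)"
  using ract_add_left[of "\<ominus>\<^bsub>M\<^esub> m" m h] ract_zero assms
  by (intro M.minus_equality[symmetric]) (auto simp: ract_closed M.l_neg)

lemma (in right_module) ract_minus_right:
  assumes "m \<in> carrier M" "h \<in> carrier H"
  shows "m \<triangleleft>\<^bsub>M\<^esub> (\<ominus>\<^bsub>H\<^esub> h) = \<ominus>\<^bsub>M\<^esub> (m \<triangleleft>\<^bsub>M\<^esub> h)"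
proof -
  have c: "m \<triangleleft>\<^bsub>M\<^esub> \<zero>\<^bsub>H\<^esub> \<in> carrier M" using assms by (simp add: ract_closed)
  have "m \<triangleleft>\<^bsub>M\<^esub> \<zero>\<^bsub>H\<^esub> \<oplus>\<^bsub>M\<^esub> m \<triangleleft>\<^bsub>M\<^esub> \<zero>\<^bsub>H\<^esub> = m \<triangleleft>\<^bsub>M\<^esub> \<zero>\<^bsub>H\<^esub>"
    using ract_add_right[of m "\<zero>\<^bsub>H\<^esub>" "\<zero>\<^bsub>H\<^esub>"] assms by simp
  then have "m \<triangleleft>\<^bsub>M\<^esub> \<zero>\<^bsub>H\<^esub> = \<zero>\<^bsub>M\<^esub>" using c M.add.l_cancel_one by simp
  then show ?thesis
    using ract_add_right[of m "\<ominus>\<^bsub>H\<^esub> h" h] assms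
    by (intro M.minus_equality[symmetric]) (auto simp: ract_closed H.l_neg)
qed

lemma right_submoduleI:
  assumes N: "right_module H N" and A: "A \<subseteq> carrier N" "A \<noteq> {}"
    and minus: "\<And>a. a \<in> A \<Longrightarrow> \<ominus>\<^bsub>N\<^esub> a \<in> A"
    and add: "\<And>a b. a \<in> A \<Longrightarrow> b \<in> A \<Longrightarrow> a \<oplus>\<^bsub>N\<^esub> b \<in> A"
    and act: "\<And>a h. a \<in> A \<Longrightarrow> h \<in> carrier H \<Longrightarrow> a \<triangleleft>\<^bsub>N\<^esub> h \<in> A"
  shows "right_submodule H A N"
proof -
  interpret N: right_module H N by (rule N)
  have "subgroup A (add_monoid N)"
    by (rule group.subgroupI[OF N.M.a_group])
      (use A minus add in \<open>auto simp: a_inv_def\<close>)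
  then show ?thesis
    using act by (auto simp: right_submodule_def intro: additive_subgroup.intro)
qed

text \<open>The kernel of \<open>g\<close> is a complement of the image of \<open>f\<close>, because
  \<open>x = f (g x) + (x - f (g x))\<close>.\<close>

lemma iso_to_direct_summandI:
  assumes M: "right_module H M" and N: "right_module H N"
    and f: "f \<in> right_mod_hom H M N" and g: "g \<in> right_mod_hom H N M"
    and gf: "\<And>m. m \<in> carrier M \<Longrightarrow> g (f m) = m"
  shows "iso_to_direct_summand H M N"
proof -
  interpret M: right_module H M by (rule M)
  interpret N: right_module H N by (rule N)
  note fD = right_mod_homD[OF f] and gD = right_mod_homD[OF g]
  note f0 = right_mod_hom_zero[OF f M N] and g0 = right_mod_hom_zero[OF g N M]
  let ?A = "f ` carrier M" and ?B = "{x \<in> carrier N. g x = \<zero>\<^bsub>M\<^esub>}"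
  have A: "right_submodule H ?A N"
  proof (rule right_submoduleI[OF N])
    fix a b h assume a: "a \<in> ?A"
    then show "\<ominus>\<^bsub>N\<^esub> a \<in> ?A"
      using right_mod_hom_minus[OF f M N] by (auto simp flip: right_mod_hom_minus[OF f M N])
    show "a \<oplus>\<^bsub>N\<^esub> b \<in> ?A" if "b \<in> ?A"
      using a that by (auto simp flip: fD(2))
    show "a \<triangleleft>\<^bsub>N\<^esub> h \<in> ?A" if "h \<in> carrier H"
      using a that by (auto simp: M.ract_closed simp flip: fD(3))
  qed (use fD in auto)
  have B: "right_submodule H ?B N"
    by (rule right_submoduleI[OF N])
      (auto simp: right_mod_hom_minus[OF g N M] gD N.ract_closed M.ract_zero g0 intro!: exI[of _ "\<zero>\<^bsub>N\<^esub>"])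
  have "?A \<inter> ?B = {\<zero>\<^bsub>N\<^esub>}"
    using gf f0 g0 by (auto simp: image_iff) (metis M.M.zero_closed)
  moreover have "?A <+>\<^bsub>N\<^esub> ?B = carrier N"
  proof
    show "?A <+>\<^bsub>N\<^esub> ?B \<subseteq> carrier N"
      using fD by (auto simp: set_add_def set_mult_def)
    show "carrier N \<subseteq> ?A <+>\<^bsub>N\<^esub> ?B"
    proof
      fix x assume x: "x \<in> carrier N"
      let ?y = "f (g x)"
      have y: "?y \<in> carrier N" "?y \<in> ?A" using x fD gD by auto
      have "g (\<ominus>\<^bsub>N\<^esub> ?y \<oplus>\<^bsub>N\<^esub> x) = \<zero>\<^bsub>M\<^esub>"
        using x y gf gD by (simp add: right_mod_hom_minus[OF g N M] M.M.l_neg)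
      then have "\<ominus>\<^bsub>N\<^esub> ?y \<oplus>\<^bsub>N\<^esub> x \<in> ?B" using x y by simp
      moreover have "x = ?y \<oplus>\<^bsub>N\<^esub> (\<ominus>\<^bsub>N\<^esub> ?y \<oplus>\<^bsub>N\<^esub> x)"
        using x y by (simp add: N.M.r_neg2)
      ultimately have "\<exists>a\<in>?A. \<exists>b\<in>?B. x = a \<oplus>\<^bsub>N\<^esub> b"
        using y(2) by blast
      then show "x \<in> ?A <+>\<^bsub>N\<^esub> ?B"
        unfolding set_add_def set_mult_def by simp
    qed
  qed
  ultimately have "direct_summand H ?A N"
    using A B by (auto simp: direct_summand_def)
  moreover have "f \<in> right_mod_hom H M (N\<lparr>carrier := ?A\<rparr>)"
    using fD by (auto simp: right_mod_hom_def)
  moreover have "bij_betw f (carrier M) ?A"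
    using gf by (auto simp: bij_betw_def intro: inj_on_inverseI)
  ultimately show ?thesis by (auto simp: iso_to_direct_summand_def)
qed

text \<open>The retraction is the projection along the complement followed by the inverse of
  the isomorphism; it is a homomorphism because the decomposition of an element is unique.\<close>

lemma iso_to_direct_summandE:
  assumes M: "right_module H M" and N: "right_module H N" and "iso_to_direct_summand H M N"
  obtains f g where "f \<in> right_mod_hom H M N" "g \<in> right_mod_hom H N M"
    "\<And>m. m \<in> carrier M \<Longrightarrow> g (f m) = m"
proof -
  interpret M: right_module H M by (rule M)
  interpret N: right_module H N by (rule N)
  obtain A f B where A: "right_submodule H A N" and B: "right_submodule H B N"
    and disj: "A \<inter> B = {\<zero>\<^bsub>N\<^esub>}" and sum: "A <+>\<^bsub>N\<^esub> B = carrier N"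
    and f: "f \<in> right_mod_hom H M (N\<lparr>carrier := A\<rparr>)" and bij: "bij_betw f (carrier M) A"
    using assms(3) unfolding iso_to_direct_summand_def direct_summand_def by blast
  interpret A: additive_subgroup A N using A by (simp add: right_submodule_def)
  interpret B: additive_subgroup B N using B by (simp add: right_submodule_def)
  have cA: "a \<in> carrier N" if "a \<in> A" for a using A.a_subset that by blast
  have cB: "b \<in> carrier N" if "b \<in> B" for b using B.a_subset that by blast
  have actA: "a \<triangleleft>\<^bsub>N\<^esub> h \<in> A" if "a \<in> A" "h \<in> carrier H" for a h
    using A that by (auto simp: right_submodule_def)
  have actB: "b \<triangleleft>\<^bsub>N\<^esub> h \<in> B" if "b \<in> B" "h \<in> carrier H" for b h
    using B that by (auto simp: right_submodule_def)
  have f': "f \<in> right_mod_hom H M N"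
    using f cA by (auto simp: right_mod_hom_def Pi_iff)
  have fA: "f m \<in> A" if "m \<in> carrier M" for m using that bij by (auto simp: bij_betw_def)
  have uniq: "a = a'"
    if "a \<in> A" "a' \<in> A" "b \<in> B" "b' \<in> B" "a \<oplus>\<^bsub>N\<^esub> b = a' \<oplus>\<^bsub>N\<^esub> b'" for a a' b b'
  proof -
    note c = that(1,2)[THEN cA] that(3,4)[THEN cB]
    have "a \<ominus>\<^bsub>N\<^esub> a' = b' \<ominus>\<^bsub>N\<^esub> b"
    proof -
      have "a = (a' \<oplus>\<^bsub>N\<^esub> b') \<ominus>\<^bsub>N\<^esub> b"
        using c unfolding that(5)[symmetric] a_minus_def by (simp add: N.M.a_assoc N.M.r_neg)
      also have "\<dots> = a' \<oplus>\<^bsub>N\<^esub> (b' \<ominus>\<^bsub>N\<^esub> b)"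
        using c by (simp add: a_minus_def N.M.a_assoc)
      finally have "a \<ominus>\<^bsub>N\<^esub> a' = (a' \<oplus>\<^bsub>N\<^esub> (b' \<ominus>\<^bsub>N\<^esub> b)) \<ominus>\<^bsub>N\<^esub> a'" by simp
      also have "\<dots> = b' \<ominus>\<^bsub>N\<^esub> b"
      proof -
        let ?d = "b' \<ominus>\<^bsub>N\<^esub> b"
        have d: "?d \<in> carrier N" using c by simp
        show ?thesis
          using c unfolding N.M.a_comm[OF c(2) d] a_minus_def[of N _ a']
          by (simp add: N.M.a_assoc N.M.r_neg)
      qed
      finally show ?thesis .
    qed
    moreover have "a \<ominus>\<^bsub>N\<^esub> a' \<in> A" "b' \<ominus>\<^bsub>N\<^esub> b \<in> B"
      using that by (auto simp: a_minus_def)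
    ultimately have "a \<ominus>\<^bsub>N\<^esub> a' = \<zero>\<^bsub>N\<^esub>" using disj by auto
    then show ?thesis by (rule N.M.minus_eq_zero_imp_eq[OF c(1,2)])
  qed
  have ex: "\<exists>m. m \<in> carrier M \<and> (\<exists>b\<in>B. x = f m \<oplus>\<^bsub>N\<^esub> b)" if "x \<in> carrier N" for x
  proof -
    have "x \<in> A <+>\<^bsub>N\<^esub> B" using that sum by simp
    then obtain a b where "a \<in> A" "b \<in> B" "x = a \<oplus>\<^bsub>N\<^esub> b"
      by (auto simp: set_add_def set_mult_def)
    then show ?thesis using bij by (auto simp: bij_betw_def)
  qed
  define g where "g x = (SOME m. m \<in> carrier M \<and> (\<exists>b\<in>B. x = f m \<oplus>\<^bsub>N\<^esub> b))" for x
  have gI: "g x = m" if "m \<in> carrier M" "b \<in> B" "x = f m \<oplus>\<^bsub>N\<^esub> b" for x m b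
  proof -
    have "g x \<in> carrier M \<and> (\<exists>b\<in>B. x = f (g x) \<oplus>\<^bsub>N\<^esub> b)"
      unfolding g_def by (rule someI[of _ m]) (use that in blast)
    then have "f (g x) = f m" using that uniq fA by metis
    then show ?thesis using bij that(1) \<open>g x \<in> carrier M \<and> _\<close> by (auto simp: bij_betw_def inj_on_def)
  qed
  have "g \<in> right_mod_hom H N M"
    unfolding right_mod_hom_def
  proof (intro CollectI conjI ballI funcsetI)
    fix x assume x: "x \<in> carrier N"
    then obtain m b where m: "m \<in> carrier M" "b \<in> B" "x = f m \<oplus>\<^bsub>N\<^esub> b" using ex by blast
    then show "g x \<in> carrier M" using gI by simp
    fix h assume "h \<in> carrier H"
    have "g (x \<triangleleft>\<^bsub>N\<^esub> h) = m \<triangleleft>\<^bsub>M\<^esub> h"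
      by (rule gI[of _ "b \<triangleleft>\<^bsub>N\<^esub> h"])
        (use m \<open>h \<in> carrier H\<close> right_mod_homD[OF f'] in \<open>auto simp: M.ract_closed actB cB N.ract_add_left\<close>)
    then show "g (x \<triangleleft>\<^bsub>N\<^esub> h) = g x \<triangleleft>\<^bsub>M\<^esub> h" using gI m by simp
  next
    fix x y assume "x \<in> carrier N" "y \<in> carrier N"
    then obtain m b m' b' where m: "m \<in> carrier M" "b \<in> B" "x = f m \<oplus>\<^bsub>N\<^esub> b"
      "m' \<in> carrier M" "b' \<in> B" "y = f m' \<oplus>\<^bsub>N\<^esub> b'" using ex by metis
    have "g (x \<oplus>\<^bsub>N\<^esub> y) = m \<oplus>\<^bsub>M\<^esub> m'"
      by (rule gI[of _ "b \<oplus>\<^bsub>N\<^esub> b'"]) (use m right_mod_homD[OF f'] cB in \<open>auto simp: N.M.a_ac\<close>)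
    then show "g (x \<oplus>\<^bsub>N\<^esub> y) = g x \<oplus>\<^bsub>M\<^esub> g y" using gI m by metis
  qed
  moreover have "g (f m) = m" if "m \<in> carrier M" for m
    by (rule gI[of _ "\<zero>\<^bsub>N\<^esub>"]) (use that right_mod_homD[OF f'] B.zero_closed in auto)
  ultimately show ?thesis using that f' by blast
qed

section \<open>Induced modules\<close>

lemma (in group) generate_induct_closed:
  assumes "x \<in> generate G S" "S \<subseteq> carrier G" "P \<one>"
    and "\<And>s. s \<in> S \<Longrightarrow> P s" "\<And>s. s \<in> S \<Longrightarrow> P (inv s)"
    and "\<And>x y. x \<in> carrier G \<Longrightarrow> y \<in> carrier G \<Longrightarrow> P x \<Longrightarrow> P y \<Longrightarrow> P (x \<otimes> y)"
  shows "P x"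
  using assms(1)
proof induction
  case (eng h1 h2)
  then show ?case using assms(6) generate_in_carrier[OF assms(2)] by blast
qed (use assms in auto)

text \<open>The induced module is a quotient whose operations act on cosets.  Later arguments see it only
  through three facts proved here: the right action moves along the second factor
  (\<open>pure_ract\<close>), differences of pure tensors exhaust the module (\<open>N_induct\<close>), and
  balanced biadditive maps extend to additive maps (\<open>N_universal\<close>).\<close>

locale tensor = right_module H M
  for H :: "('h, 'a) ring_scheme" (structure) and M :: "('h, 'm, 'b) right_mod_scheme" (structure) +
  fixes B :: "'h set"
  assumes B_sub: "B \<subseteq> carrier H"
begin

abbreviation "A \<equiv> tensor_free H M"
abbreviation "K \<equiv> tensor_kernel H B M"
abbreviation "N \<equiv> tensor_up H B M"

definition cls :: "('m \<times> 'h \<Rightarrow>\<^sub>0 int) \<Rightarrow> ('m \<times> 'h \<Rightarrow>\<^sub>0 int) set" where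
  "cls x = K #>\<^bsub>A\<^esub> x"

definition pure :: "'m \<Rightarrow> 'h \<Rightarrow> ('m \<times> 'h \<Rightarrow>\<^sub>0 int) set" where
  "pure m h = cls (frag_of (m, h))"

definition rmul :: "'h \<Rightarrow> ('m \<times> 'h \<Rightarrow>\<^sub>0 int) \<Rightarrow> ('m \<times> 'h \<Rightarrow>\<^sub>0 int)" where
  "rmul h = frag_extend (\<lambda>(m, k). frag_of (m, k \<otimes>\<^bsub>H\<^esub> h))"

lemma comm_group_A: "comm_group A"
  unfolding tensor_free_def by (rule abelian_free_Abelian_group)

interpretation A: comm_group A by (rule comm_group_A)

lemma A_simps [simp]:
  "x \<in> carrier A \<longleftrightarrow> Poly_Mapping.keys x \<subseteq> carrier M \<times> carrier H"
  "x \<otimes>\<^bsub>A\<^esub> y = x + y" "\<one>\<^bsub>A\<^esub> = 0"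
  by (simp_all add: tensor_free_def)

lemma A_inv [simp]: "Poly_Mapping.keys x \<subseteq> carrier M \<times> carrier H \<Longrightarrow> inv\<^bsub>A\<^esub> x = - x"
  unfolding tensor_free_def by simp

lemma A_closed [intro]:
  "x \<in> carrier A \<Longrightarrow> y \<in> carrier A \<Longrightarrow> x + y \<in> carrier A"
  "x \<in> carrier A \<Longrightarrow> y \<in> carrier A \<Longrightarrow> x - y \<in> carrier A"
  "x \<in> carrier A \<Longrightarrow> - x \<in> carrier A"
  using keys_add[of x y] keys_diff[of x y] by auto

lemma rels_sub: "tensor_rels H B M \<subseteq> carrier A"
  unfolding tensor_rels_def
  using B_sub by (auto intro!: A_closed simp del: A_simps(1))
    (auto simp: ract_closed)

lemma K_subgroup: "subgroup K A"
  unfolding tensor_kernel_def by (rule A.generate_is_subgroup[OF rels_sub])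

interpretation K: normal K A
  by (rule A.subgroup_imp_normal[OF K_subgroup])

lemma K_diff:
  assumes "x \<in> K" "y \<in> K"
  shows "x - y \<in> K"
proof -
  have "inv\<^bsub>A\<^esub> y = - y" using K.mem_carrier[OF assms(2)] by simp
  then have "x + - y \<in> K" using K.m_closed[OF assms(1) K.m_inv_closed[OF assms(2)]] by simp
  then show ?thesis by simp
qed

lemma cls_add: "x \<in> carrier A \<Longrightarrow> y \<in> carrier A \<Longrightarrow> cls x <#>\<^bsub>A\<^esub> cls y = cls (x + y)"
  unfolding cls_def using K.rcos_sum by simp

lemma cls_eq_iff: "x \<in> carrier A \<Longrightarrow> y \<in> carrier A \<Longrightarrow> cls x = cls y \<longleftrightarrow> x - y \<in> K"
  unfolding cls_def
proof
  assume xy: "x \<in> carrier A" "y \<in> carrier A"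
  { assume "K #>\<^bsub>A\<^esub> x = K #>\<^bsub>A\<^esub> y"
    then have "x \<in> K #>\<^bsub>A\<^esub> y" using A.rcos_self[OF xy(1) K_subgroup] by simp
    then show "x - y \<in> K" by (auto simp: r_coset_def) }
  { assume "x - y \<in> K"
    then have "x \<in> K #>\<^bsub>A\<^esub> y" by (auto simp: r_coset_def intro: bexI[of _ "x - y"])
    then show "K #>\<^bsub>A\<^esub> x = K #>\<^bsub>A\<^esub> y"
      using A.repr_independence[OF _ xy(2) K_subgroup] by metis }
qed

lemma rel_imp_cls_eq:
  assumes "x \<in> carrier A" "y \<in> carrier A" "x - y \<in> tensor_rels H B M"
  shows "cls x = cls y"
  using assms cls_eq_iff generate.incl[of "x - y" "tensor_rels H B M" A] by (simp add: tensor_kernel_def)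

lemma N_carrier: "carrier N = cls ` carrier A"
  by (simp only: tensor_up_def Let_def cls_def[abs_def] carrier_FactGroup) simp

lemma N_add: "\<lbrakk>x \<in> carrier A; y \<in> carrier A\<rbrakk> \<Longrightarrow> cls x \<oplus>\<^bsub>N\<^esub> cls y = cls (x + y)"
  using cls_add by (simp add: tensor_up_def Let_def)

lemma cls_0: "cls 0 = K"
  unfolding cls_def using A.coset_mult_one[OF K.subset] by simp

lemma N_zero: "\<zero>\<^bsub>N\<^esub> = cls 0"
  by (simp add: cls_0) (simp add: tensor_up_def Let_def)

lemma rmul_simps [simp]:
  "rmul h (frag_of (m, k)) = frag_of (m, k \<otimes>\<^bsub>H\<^esub> h)"
  "rmul h 0 = 0" "rmul h (x + y) = rmul h x + rmul h y" "rmul h (x - y) = rmul h x - rmul h y"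
  "rmul h (- x) = - rmul h x"
  by (simp_all add: rmul_def frag_extend_add frag_extend_diff frag_extend_minus)

lemma rmul_closed: "x \<in> carrier A \<Longrightarrow> h \<in> carrier H \<Longrightarrow> rmul h x \<in> carrier A"
  using keys_frag_extend[of "\<lambda>(m, k). frag_of (m, k \<otimes>\<^bsub>H\<^esub> h)" x]
  by (fastforce simp: rmul_def split: if_splits)

lemma rels_intros:
  "\<lbrakk>m \<in> carrier M; m' \<in> carrier M; h \<in> carrier H\<rbrakk> \<Longrightarrow>
    frag_of (m \<oplus>\<^bsub>M\<^esub> m', h) - frag_of (m, h) - frag_of (m', h) \<in> tensor_rels H B M"
  "\<lbrakk>m \<in> carrier M; h \<in> carrier H; h' \<in> carrier H\<rbrakk> \<Longrightarrow>
    frag_of (m, h \<oplus>\<^bsub>H\<^esub> h') - frag_of (m, h) - frag_of (m, h') \<in> tensor_rels H B M"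
  "\<lbrakk>m \<in> carrier M; b \<in> B; h \<in> carrier H\<rbrakk> \<Longrightarrow>
    frag_of (m \<triangleleft>\<^bsub>M\<^esub> b, h) - frag_of (m, b \<otimes>\<^bsub>H\<^esub> h) \<in> tensor_rels H B M"
  unfolding tensor_rels_def by blast+

lemma rels_cases:
  assumes "x \<in> tensor_rels H B M"
  obtains (add_left) m m' h where "m \<in> carrier M" "m' \<in> carrier M" "h \<in> carrier H"
      "x = frag_of (m \<oplus>\<^bsub>M\<^esub> m', h) - frag_of (m, h) - frag_of (m', h)"
    | (add_right) m h h' where "m \<in> carrier M" "h \<in> carrier H" "h' \<in> carrier H"
      "x = frag_of (m, h \<oplus>\<^bsub>H\<^esub> h') - frag_of (m, h) - frag_of (m, h')"
    | (balanced) m b h where "m \<in> carrier M" "b \<in> B" "b \<in> carrier H" "h \<in> carrier H"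
      "x = frag_of (m \<triangleleft>\<^bsub>M\<^esub> b, h) - frag_of (m, b \<otimes>\<^bsub>H\<^esub> h)"
proof -
  have B: "b \<in> carrier H" if "b \<in> B" for b using B_sub that by blast
  show ?thesis
    using assms unfolding tensor_rels_def Un_iff mem_Collect_eq
    by (elim disjE exE conjE) ((rule that(1) that(2); assumption) | (rule that(3); (assumption | (rule B, assumption))))+
qed

text \<open>Each of the three families of relations is carried into itself, which is why the
  action on representatives descends to the quotient.\<close>

lemma rmul_rels:
  assumes "x \<in> tensor_rels H B M" "h \<in> carrier H"
  shows "rmul h x \<in> tensor_rels H B M"
  using assms(1)
proof (cases rule: rels_cases)
  case (add_left m m' k)
  then show ?thesis
    using rels_intros(1)[of m m' "k \<otimes>\<^bsub>H\<^esub> h"] assms(2) by simp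
next
  case (add_right m k k')
  then show ?thesis
    using rels_intros(2)[of m "k \<otimes>\<^bsub>H\<^esub> h" "k' \<otimes>\<^bsub>H\<^esub> h"] assms(2) by (simp add: H.l_distr)
next
  case (balanced m b k)
  then show ?thesis
    using rels_intros(3)[of m b "k \<otimes>\<^bsub>H\<^esub> h"] assms(2) by (simp add: H.m_assoc)
qed

lemma rmul_K:
  assumes "x \<in> K" "h \<in> carrier H"
  shows "rmul h x \<in> K"
proof (rule A.generate_induct_closed[OF assms(1)[unfolded tensor_kernel_def] rels_sub])
  show "rmul h \<one>\<^bsub>A\<^esub> \<in> K" using K.one_closed by simp
next
  fix s assume s: "s \<in> tensor_rels H B M"
  have rs: "rmul h s \<in> tensor_rels H B M" by (rule rmul_rels[OF s assms(2)])
  then show K: "rmul h s \<in> K" unfolding tensor_kernel_def by (rule generate.incl)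
  have "inv\<^bsub>A\<^esub> s = - s" using subsetD[OF rels_sub s] by simp
  then show "rmul h (inv\<^bsub>A\<^esub> s) \<in> K" using K_diff[OF K.one_closed K] by simp
next
  fix x y assume "rmul h x \<in> K" "rmul h y \<in> K"
  then show "rmul h (x \<otimes>\<^bsub>A\<^esub> y) \<in> K" using K.m_closed by fastforce
qed

lemma N_ract:
  assumes "x \<in> carrier A" "h \<in> carrier H"
  shows "cls x \<triangleleft>\<^bsub>N\<^esub> h = cls (rmul h x)"
proof -
  have "cls (rmul h y) = cls (rmul h x)" if "y \<in> cls x" for y
  proof -
    have y: "y \<in> carrier A" using that K.elemrcos_carrier[OF A.is_group] assms unfolding cls_def by blast
    have "y - x \<in> K" using that by (auto simp: cls_def r_coset_def)
    then have "rmul h y - rmul h x \<in> K" using rmul_K[OF _ assms(2)] by force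
    then show ?thesis using cls_eq_iff rmul_closed y assms by blast
  qed
  moreover have "x \<in> cls x" unfolding cls_def by (rule A.rcos_self[OF assms(1) K_subgroup])
  ultimately have "(\<Union>y\<in>cls x. cls (rmul h y)) = cls (rmul h x)" by blast
  then show ?thesis by (simp add: tensor_up_def Let_def cls_def rmul_def)
qed

lemma frag_of_carrier: "m \<in> carrier M \<Longrightarrow> h \<in> carrier H \<Longrightarrow> frag_of (m, h) \<in> carrier A"
  by simp

lemma pure_closed: "m \<in> carrier M \<Longrightarrow> h \<in> carrier H \<Longrightarrow> pure m h \<in> carrier N"
  unfolding pure_def N_carrier by (intro imageI frag_of_carrier)

lemma pure_ract: "\<lbrakk>m \<in> carrier M; h \<in> carrier H; k \<in> carrier H\<rbrakk> \<Longrightarrow>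
    pure m h \<triangleleft>\<^bsub>N\<^esub> k = pure m (h \<otimes>\<^bsub>H\<^esub> k)"
  unfolding pure_def by (simp only: N_ract frag_of_carrier rmul_simps)

lemma pure_add_left:
  assumes "m \<in> carrier M" "m' \<in> carrier M" "h \<in> carrier H"
  shows "pure (m \<oplus>\<^bsub>M\<^esub> m') h = pure m h \<oplus>\<^bsub>N\<^esub> pure m' h"
proof -
  have "cls (frag_of (m \<oplus>\<^bsub>M\<^esub> m', h)) = cls (frag_of (m, h) + frag_of (m', h))"
    by (rule rel_imp_cls_eq)
      (use assms in \<open>auto simp del: A_simps(1) intro!: A_closed frag_of_carrier simp: tensor_rels_def diff_diff_eq[symmetric]\<close>)
  then show ?thesis unfolding pure_def using assms by (simp only: N_add frag_of_carrier)
qed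

lemma pure_add_right:
  assumes "m \<in> carrier M" "h \<in> carrier H" "h' \<in> carrier H"
  shows "pure m (h \<oplus>\<^bsub>H\<^esub> h') = pure m h \<oplus>\<^bsub>N\<^esub> pure m h'"
proof -
  have "cls (frag_of (m, h \<oplus>\<^bsub>H\<^esub> h')) = cls (frag_of (m, h) + frag_of (m, h'))"
    by (rule rel_imp_cls_eq)
      (use assms in \<open>auto simp del: A_simps(1) intro!: A_closed frag_of_carrier simp: tensor_rels_def diff_diff_eq[symmetric]\<close>)
  then show ?thesis unfolding pure_def using assms by (simp only: N_add frag_of_carrier)
qed

lemma pure_balanced:
  assumes "m \<in> carrier M" "b \<in> B" "h \<in> carrier H"
  shows "pure (m \<triangleleft>\<^bsub>M\<^esub> b) h = pure m (b \<otimes>\<^bsub>H\<^esub> h)"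
  unfolding pure_def
proof (rule rel_imp_cls_eq)
  have "b \<in> carrier H" using assms B_sub by blast
  then show "frag_of (m \<triangleleft>\<^bsub>M\<^esub> b, h) \<in> carrier A" "frag_of (m, b \<otimes>\<^bsub>H\<^esub> h) \<in> carrier A"
    using assms by (simp_all add: ract_closed)
  show "frag_of (m \<triangleleft>\<^bsub>M\<^esub> b, h) - frag_of (m, b \<otimes>\<^bsub>H\<^esub> h) \<in> tensor_rels H B M"
    using assms unfolding tensor_rels_def by blast
qed

lemma N_abelian_group: "abelian_group N"
proof (rule abelian_groupI)
  fix x assume "x \<in> carrier N"
  then obtain a where a: "a \<in> carrier A" "x = cls a" by (auto simp: N_carrier)
  have "cls (- a) \<oplus>\<^bsub>N\<^esub> x = \<zero>\<^bsub>N\<^esub>"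
    using N_add[OF A_closed(3)[OF a(1)] a(1)] by (simp add: a N_zero)
  then show "\<exists>y\<in>carrier N. y \<oplus>\<^bsub>N\<^esub> x = \<zero>\<^bsub>N\<^esub>"
    using A_closed(3)[OF a(1)] unfolding N_carrier by blast
qed (auto simp del: A_simps(1) simp: N_carrier N_add N_zero A_closed add_ac simp: A_simps(1)[of 0])

lemma A_induct:
  assumes "x \<in> carrier A" "P 0" "\<And>m h. m \<in> carrier M \<Longrightarrow> h \<in> carrier H \<Longrightarrow> P (frag_of (m, h))"
    "\<And>x y. x \<in> carrier A \<Longrightarrow> y \<in> carrier A \<Longrightarrow> P x \<Longrightarrow> P y \<Longrightarrow> P (x - y)"
  shows "P x"
  using assms by (intro free_Abelian_group_induct[of x "carrier M \<times> carrier H" P]) auto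

lemma rmul_mult:
  assumes "a \<in> carrier A" "h \<in> carrier H" "h' \<in> carrier H"
  shows "rmul (h \<otimes>\<^bsub>H\<^esub> h') a = rmul h' (rmul h a)"
  by (rule A_induct[OF assms(1)]) (use assms in \<open>auto simp: H.m_assoc\<close>)

lemma rmul_one: "a \<in> carrier A \<Longrightarrow> rmul \<one>\<^bsub>H\<^esub> a = a"
  by (rule A_induct[of a]) auto

text \<open>Compatibility with the addition of the ring fails for representatives and holds only
  modulo the second family of relations.\<close>

lemma cls_rmul_add:
  assumes a: "a \<in> carrier A" and h: "h \<in> carrier H" and h': "h' \<in> carrier H"
  shows "cls (rmul (h \<oplus>\<^bsub>H\<^esub> h') a) = cls (rmul h a + rmul h' a)"
proof (rule A_induct[OF a])
  fix m k assume "m \<in> carrier M" "k \<in> carrier H"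
  then show "cls (rmul (h \<oplus>\<^bsub>H\<^esub> h') (frag_of (m, k))) = cls (rmul h (frag_of (m, k)) + rmul h' (frag_of (m, k)))"
    using h h' pure_add_right[of m "k \<otimes>\<^bsub>H\<^esub> h" "k \<otimes>\<^bsub>H\<^esub> h'"]
    by (simp del: A_simps(1) add: H.r_distr pure_def N_add frag_of_carrier)
next
  fix x y assume x: "x \<in> carrier A" and y: "y \<in> carrier A"
    and IH: "cls (rmul (h \<oplus>\<^bsub>H\<^esub> h') x) = cls (rmul h x + rmul h' x)"
      "cls (rmul (h \<oplus>\<^bsub>H\<^esub> h') y) = cls (rmul h y + rmul h' y)"
  have hh: "h \<oplus>\<^bsub>H\<^esub> h' \<in> carrier H" using h h' by simp
  have c: "rmul (h \<oplus>\<^bsub>H\<^esub> h') z \<in> carrier A" "rmul h z + rmul h' z \<in> carrier A"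
    "rmul h z \<in> carrier A" "rmul h' z \<in> carrier A" if "z \<in> carrier A" for z
    using that h h' hh by (auto simp del: A_simps(1) intro: A_closed rmul_closed)
  have "rmul (h \<oplus>\<^bsub>H\<^esub> h') x - (rmul h x + rmul h' x) \<in> K"
    "rmul (h \<oplus>\<^bsub>H\<^esub> h') y - (rmul h y + rmul h' y) \<in> K"
    using IH c[OF x] c[OF y] cls_eq_iff by blast+
  then have "(rmul (h \<oplus>\<^bsub>H\<^esub> h') x - (rmul h x + rmul h' x))
      - (rmul (h \<oplus>\<^bsub>H\<^esub> h') y - (rmul h y + rmul h' y)) \<in> K"
    by (rule K_diff)
  then have "rmul (h \<oplus>\<^bsub>H\<^esub> h') (x - y) - (rmul h (x - y) + rmul h' (x - y)) \<in> K"
    by (simp add: algebra_simps)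
  then show "cls (rmul (h \<oplus>\<^bsub>H\<^esub> h') (x - y)) = cls (rmul h (x - y) + rmul h' (x - y))"
    using c[OF A_closed(2)[OF x y]] cls_eq_iff by blast
qed simp

lemma right_module_N: "right_module H N"
proof -
  have "x \<triangleleft>\<^bsub>N\<^esub> h \<in> carrier N" if "x \<in> carrier N" "h \<in> carrier H" for x h
    using that by (auto simp del: A_simps(1) simp: N_carrier N_ract rmul_closed)
  moreover have "(x \<oplus>\<^bsub>N\<^esub> y) \<triangleleft>\<^bsub>N\<^esub> h = x \<triangleleft>\<^bsub>N\<^esub> h \<oplus>\<^bsub>N\<^esub> y \<triangleleft>\<^bsub>N\<^esub> h"
    if "x \<in> carrier N" "y \<in> carrier N" "h \<in> carrier H" for x y h
    using that by (auto simp del: A_simps(1) simp: N_carrier N_add N_ract A_closed rmul_closed)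
  moreover have "x \<triangleleft>\<^bsub>N\<^esub> (h \<oplus>\<^bsub>H\<^esub> h') = x \<triangleleft>\<^bsub>N\<^esub> h \<oplus>\<^bsub>N\<^esub> x \<triangleleft>\<^bsub>N\<^esub> h'"
    if "x \<in> carrier N" "h \<in> carrier H" "h' \<in> carrier H" for x h h'
    using that by (auto simp del: A_simps(1) simp: N_carrier N_add N_ract rmul_closed cls_rmul_add)
  moreover have "x \<triangleleft>\<^bsub>N\<^esub> (h \<otimes>\<^bsub>H\<^esub> h') = (x \<triangleleft>\<^bsub>N\<^esub> h) \<triangleleft>\<^bsub>N\<^esub> h'"
    if "x \<in> carrier N" "h \<in> carrier H" "h' \<in> carrier H" for x h h'
    using that by (auto simp del: A_simps(1) simp: N_carrier N_ract rmul_closed rmul_mult)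
  moreover have "x \<triangleleft>\<^bsub>N\<^esub> \<one>\<^bsub>H\<^esub> = x" if "x \<in> carrier N" for x
    using that by (auto simp del: A_simps(1) simp: N_carrier N_ract rmul_one)
  ultimately show ?thesis
    unfolding right_module_def right_module_axioms_def
    using H.ring_axioms N_abelian_group by blast
qed

sublocale N: right_module H N by (rule right_module_N)

lemma N_induct [consumes 1, case_names pure diff]:
  assumes "x \<in> carrier N"
    and pure: "\<And>m h. m \<in> carrier M \<Longrightarrow> h \<in> carrier H \<Longrightarrow> P (pure m h)"
    and diff: "\<And>x y. x \<in> carrier N \<Longrightarrow> y \<in> carrier N \<Longrightarrow> P x \<Longrightarrow> P y \<Longrightarrow> P (x \<ominus>\<^bsub>N\<^esub> y)"
  shows "P x"
proof -
  have minus: "cls (a - b) = cls a \<ominus>\<^bsub>N\<^esub> cls b" if "a \<in> carrier A" "b \<in> carrier A" for a b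
  proof -
    have "cls (a - b) \<oplus>\<^bsub>N\<^esub> cls b = cls a"
      using that by (simp del: A_simps(1) add: N_add A_closed)
    moreover have c: "cls (a - b) \<in> carrier N" "cls b \<in> carrier N"
      using that A_closed(2)[OF that] unfolding N_carrier by blast+
    ultimately show ?thesis
      using N.M.a_assoc[OF c N.M.a_inv_closed[OF c(2)]] by (simp add: a_minus_def N.M.r_neg)
  qed
  obtain a where a: "x = cls a" "a \<in> carrier A" using assms(1) by (auto simp: N_carrier)
  have "P (cls a)"
  proof (rule free_Abelian_group_induct[of a "carrier M \<times> carrier H"])
    show "Poly_Mapping.keys a \<subseteq> carrier M \<times> carrier H" using a by simp
    have "P (pure \<zero>\<^bsub>M\<^esub> \<one>\<^bsub>H\<^esub>)" by (rule pure) auto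
    then have "P (pure \<zero>\<^bsub>M\<^esub> \<one>\<^bsub>H\<^esub> \<ominus>\<^bsub>N\<^esub> pure \<zero>\<^bsub>M\<^esub> \<one>\<^bsub>H\<^esub>)" by (intro diff pure_closed) auto
    then show "P (cls 0)" by (simp add: N_zero[symmetric] pure_closed N.M.r_neg a_minus_def)
  next
    fix a b assume "Poly_Mapping.keys a \<subseteq> carrier M \<times> carrier H" "P (cls a)"
      "Poly_Mapping.keys b \<subseteq> carrier M \<times> carrier H" "P (cls b)"
    then show "P (cls (a - b))" using minus[of a b] diff[of "cls a" "cls b"] by (simp add: N_carrier)
  next
    fix p assume "p \<in> carrier M \<times> carrier H"
    then show "P (cls (frag_of p))" using pure by (auto simp: pure_def)
  qed
  then show ?thesis using a by simp
qed

lemma N_universal: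
  fixes \<phi> :: "'m \<Rightarrow> 'h \<Rightarrow> 'v" and V :: "('v, 'c) ring_scheme"
  assumes V: "abelian_group V"
    and closed: "\<And>m h. m \<in> carrier M \<Longrightarrow> h \<in> carrier H \<Longrightarrow> \<phi> m h \<in> carrier V"
    and addl: "\<And>m m' h. \<lbrakk>m \<in> carrier M; m' \<in> carrier M; h \<in> carrier H\<rbrakk> \<Longrightarrow>
      \<phi> (m \<oplus>\<^bsub>M\<^esub> m') h = \<phi> m h \<oplus>\<^bsub>V\<^esub> \<phi> m' h"
    and addr: "\<And>m h h'. \<lbrakk>m \<in> carrier M; h \<in> carrier H; h' \<in> carrier H\<rbrakk> \<Longrightarrow>
      \<phi> m (h \<oplus>\<^bsub>H\<^esub> h') = \<phi> m h \<oplus>\<^bsub>V\<^esub> \<phi> m h'"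
    and bal: "\<And>m b h. \<lbrakk>m \<in> carrier M; b \<in> B; h \<in> carrier H\<rbrakk> \<Longrightarrow>
      \<phi> (m \<triangleleft>\<^bsub>M\<^esub> b) h = \<phi> m (b \<otimes>\<^bsub>H\<^esub> h)"
  obtains F where "\<And>x. x \<in> carrier N \<Longrightarrow> F x \<in> carrier V"
    "\<And>x y. x \<in> carrier N \<Longrightarrow> y \<in> carrier N \<Longrightarrow> F (x \<oplus>\<^bsub>N\<^esub> y) = F x \<oplus>\<^bsub>V\<^esub> F y"
    "\<And>m h. m \<in> carrier M \<Longrightarrow> h \<in> carrier H \<Longrightarrow> F (pure m h) = \<phi> m h"
proof -
  interpret V: abelian_group V by (rule V)
  have V': "comm_group (add_monoid V)" by (rule V.a_comm_group)
  have img: "(\<lambda>(m, h). \<phi> m h) ` (carrier M \<times> carrier H) \<subseteq> carrier (add_monoid V)"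
    using closed by auto
  obtain f where f': "f \<in> hom (free_Abelian_group (carrier M \<times> carrier H)) (add_monoid V)"
    and f_pure: "\<And>p. p \<in> carrier M \<times> carrier H \<Longrightarrow> f (frag_of p) = (\<lambda>(m, h). \<phi> m h) p"
    by (rule comm_group.free_Abelian_group_universal[OF V' img]) blast
  have f: "f \<in> hom A (add_monoid V)" using f' by (simp add: tensor_free_def)
  interpret f: group_hom A "add_monoid V" f
    using f by (intro group_hom.intro group_hom_axioms.intro A.is_group V.a_group)
  have f_diff: "f (x - y) = f x \<ominus>\<^bsub>V\<^esub> f y" if "x \<in> carrier A" "y \<in> carrier A" for x y
  proof -
    have "f (- y) = \<ominus>\<^bsub>V\<^esub> f y" using f.hom_inv[OF that(2)] that(2) by (simp add: a_inv_def)
    then show ?thesis using f.hom_mult[OF that(1) A_closed(3)[OF that(2)]] by (simp add: a_minus_def)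
  qed
  have fc: "f x \<in> carrier V" if "x \<in> carrier A" for x using f.hom_closed[OF that] by simp
  have f_pure': "f (frag_of (m, h)) = \<phi> m h" if "m \<in> carrier M" "h \<in> carrier H" for m h
    using f_pure that by simp
  have cancel: "x \<oplus>\<^bsub>V\<^esub> y \<ominus>\<^bsub>V\<^esub> x \<ominus>\<^bsub>V\<^esub> y = \<zero>\<^bsub>V\<^esub>" if "x \<in> carrier V" "y \<in> carrier V" for x y
    using that unfolding V.a_comm[OF that] by (simp add: a_minus_def V.a_assoc V.r_neg)
  have zero: "f x = \<zero>\<^bsub>V\<^esub>" if "x \<in> tensor_rels H B M" for x
    using that
  proof (cases rule: rels_cases)
    case (add_left m m' h)
    then show ?thesis
      using closed by (simp del: A_simps(1) add: f_diff f_pure' frag_of_carrier addl A_closed cancel)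
  next
    case (add_right m h h')
    then show ?thesis
      using closed by (simp del: A_simps(1) add: f_diff f_pure' frag_of_carrier addr A_closed cancel)
  next
    case (balanced m b h)
    then show ?thesis
      using closed
      by (simp del: A_simps(1) add: f_diff f_pure' frag_of_carrier bal ract_closed a_minus_def V.r_neg)
  qed
  have K0: "f x = \<zero>\<^bsub>V\<^esub>" if "x \<in> K" for x
  proof (rule A.generate_induct_closed[OF that[unfolded tensor_kernel_def] rels_sub])
    fix s assume s: "s \<in> tensor_rels H B M"
    show "f s = \<zero>\<^bsub>V\<^esub>" by (rule zero[OF s])
    show "f (inv\<^bsub>A\<^esub> s) = \<zero>\<^bsub>V\<^esub>"
      using f_diff[of 0 s] f.hom_one zero[OF s] subsetD[OF rels_sub s] by (simp add: a_minus_def)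
  next
    fix x y assume "x \<in> carrier A" "y \<in> carrier A" "f x = \<zero>\<^bsub>V\<^esub>" "f y = \<zero>\<^bsub>V\<^esub>"
    then show "f (x \<otimes>\<^bsub>A\<^esub> y) = \<zero>\<^bsub>V\<^esub>" using f.hom_mult[of x y] by simp
  qed (use f.hom_one in simp)
  have eq: "f x = f y" if "x \<in> carrier A" "y \<in> carrier A" "cls x = cls y" for x y
    using K0[of "x - y"] that f_diff[of x y] cls_eq_iff[of x y] V.minus_eq_zero_imp_eq[OF fc fc] by metis
  define F where "F C = f (SOME x. x \<in> carrier A \<and> cls x = C)" for C
  have F: "F (cls x) = f x" if "x \<in> carrier A" for x
  proof -
    have "(SOME y. y \<in> carrier A \<and> cls y = cls x) \<in> carrier A \<and> cls (SOME y. y \<in> carrier A \<and> cls y = cls x) = cls x"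
      by (rule someI[of _ x]) (use that in blast)
    then show ?thesis unfolding F_def using eq that by blast
  qed
  show ?thesis
  proof (rule that[of F])
    show "F x \<in> carrier V" if "x \<in> carrier N" for x
      using that F fc by (auto simp del: A_simps(1) simp: N_carrier)
    show "F (x \<oplus>\<^bsub>N\<^esub> y) = F x \<oplus>\<^bsub>V\<^esub> F y" if "x \<in> carrier N" "y \<in> carrier N" for x y
      using that f.hom_mult by (auto simp del: A_simps(1) simp: N_carrier F N_add A_closed)
    show "F (pure m h) = \<phi> m h" if "m \<in> carrier M" "h \<in> carrier H" for m h
      using that F[OF frag_of_carrier] f_pure' by (simp add: pure_def)
  qed
qed

end

section \<open>Inversions and reduced expressions\<close>

definition inversions :: "(nat \<Rightarrow> nat) \<Rightarrow> (nat \<times> nat) set" where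
  "inversions w = {(x, y). x < y \<and> w y < w x}"

lemma inversions_id [simp]: "inversions id = {}"
  by (auto simp: inversions_def)

lemma simple_refl_simps [simp]:
  "simple_refl i i = Suc i" "simple_refl i (Suc i) = i"
  "j \<noteq> i \<Longrightarrow> j \<noteq> Suc i \<Longrightarrow> simple_refl i j = j"
  by (auto simp: simple_refl_def)

lemma simple_refl_invol [simp]: "simple_refl i (simple_refl i j) = j"
  by (simp add: simple_refl_def)

lemma simple_refl_comp_invol [simp]: "simple_refl i \<circ> simple_refl i = id"
  by (simp add: simple_refl_def)

lemma simple_refl_permutes: "1 \<le> i \<Longrightarrow> i < n \<Longrightarrow> simple_refl i permutes {1..n}"
  unfolding simple_refl_def by (rule permutes_swap_id) auto

lemma word_perm_append [simp]: "word_perm (is @ js) = word_perm is \<circ> word_perm js"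
  by (induction "is") (auto simp: word_perm_def)

lemma word_perm_simps [simp]: "word_perm [] = id" "word_perm [i] = simple_refl i"
  by (auto simp: word_perm_def)

lemma word_perm_permutes: "set is \<subseteq> {1..<n} \<Longrightarrow> word_perm is permutes {1..n}"
proof (induction "is" rule: rev_induct)
  case (snoc i "is")
  then show ?case
    using permutes_compose[OF simple_refl_permutes[of i n], of "word_perm is"]
    by (simp add: o_def del: One_nat_def)
qed (simp add: permutes_id)

lemma finite_inversions:
  assumes "w permutes {1..n}"
  shows "finite (inversions w)"
proof (rule finite_subset)
  show "inversions w \<subseteq> {1..n} \<times> {1..n}"
  proof clarify
    fix x y assume "(x, y) \<in> inversions w"
    then have xy: "x < y" "w y < w x" by (auto simp: inversions_def)
    have im: "w z \<in> {1..n} \<longleftrightarrow> z \<in> {1..n}" for z by (rule permutes_in_image[OF assms])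
    have out: "w z = z" if "z \<notin> {1..n}" for z by (rule permutes_not_in[OF assms that])
    show "x \<in> {1..n} \<and> y \<in> {1..n}"
      using xy im[of x] im[of y] out[of x] out[of y]
      by (cases "x \<in> {1..n}"; cases "y \<in> {1..n}") auto
  qed
qed auto

text \<open>Exchanging the values of an ascent creates the single inversion \<open>(i, i+1)\<close> and
  moves the positions of all others.\<close>

lemma inversions_comp_simple_refl:
  assumes "inj w" "w i < w (Suc i)"
  shows "inversions (w \<circ> simple_refl i)
    = insert (i, Suc i) ((\<lambda>(x, y). (simple_refl i x, simple_refl i y)) ` inversions w)"
    (is "?L = insert _ (?f ` _)")
proof -
  have less: "simple_refl i x < simple_refl i y" if "x < y" "(x, y) \<noteq> (i, Suc i)" for x y
    using that by (auto simp: simple_refl_def Transposition.transpose_def)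
  have "(x, y) \<in> insert (i, Suc i) (?f ` inversions w)" if xy: "(x, y) \<in> ?L" for x y
  proof (cases "(x, y) = (i, Suc i)")
    case False
    then have "(simple_refl i x, simple_refl i y) \<in> inversions w"
      using xy less[of x y] by (auto simp: inversions_def)
    then have "?f (simple_refl i x, simple_refl i y) \<in> ?f ` inversions w" by (rule imageI)
    then show ?thesis by simp
  qed simp
  moreover have "(i, Suc i) \<in> ?L" using assms by (simp add: inversions_def)
  moreover have "?f (x, y) \<in> ?L" if xy: "(x, y) \<in> inversions w" for x y
  proof -
    have "(x, y) \<noteq> (i, Suc i)" using xy assms(2) by (auto simp: inversions_def)
    then show ?thesis using xy less[of x y] by (auto simp: inversions_def)
  qed
  ultimately show ?thesis by auto
qed

lemma card_inversions_ascent: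
  assumes "w permutes {1..n}" "w i < w (Suc i)"
  shows "card (inversions (w \<circ> simple_refl i)) = Suc (card (inversions w))"
proof -
  let ?f = "\<lambda>(x, y). (simple_refl i x, simple_refl i y)"
  have "(i, Suc i) \<notin> ?f ` inversions w"
    by (auto simp: inversions_def simple_refl_def Transposition.transpose_def split: if_splits)
  moreover have "inj_on ?f (inversions w)"
    by (rule inj_onI) (auto dest: arg_cong[of _ _ "simple_refl i"])
  ultimately show ?thesis
    using inversions_comp_simple_refl[OF permutes_inj[OF assms(1)] assms(2)]
      finite_inversions[OF assms(1)] by (simp add: card_image)
qed

lemma card_inversions_descent:
  assumes "w permutes {1..n}" "1 \<le> i" "i < n" "w (Suc i) < w i"
  shows "card (inversions w) = Suc (card (inversions (w \<circ> simple_refl i)))"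
proof -
  have "card (inversions ((w \<circ> simple_refl i) \<circ> simple_refl i))
      = Suc (card (inversions (w \<circ> simple_refl i)))"
    by (rule card_inversions_ascent[of _ n])
      (use assms permutes_compose[OF simple_refl_permutes] in auto)
  then show ?thesis by (simp add: comp_assoc)
qed

lemma permutes_no_descent_imp_id:
  assumes w: "w permutes {1..n}" and asc: "\<And>i. 1 \<le> i \<Longrightarrow> i < n \<Longrightarrow> w i < w (Suc i)"
  shows "w = id"
proof -
  \<comment> \<open>\<open>w\<close> never lowers a point and preserves the sum of all points, so it fixes each of them\<close>
  have ge: "1 \<le> i \<Longrightarrow> i \<le> n \<Longrightarrow> i \<le> w i" for i
  proof (induction i)
    case (Suc i)
    show ?case
    proof (cases "i = 0")
      case True
      then show ?thesis using permutes_in_image[OF w, of "Suc i"] Suc.prems by auto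
    next
      case False
      then show ?thesis using Suc asc[of i] by force
    qed
  qed simp
  have "(\<Sum>i\<in>{1..n}. i) = (\<Sum>i\<in>{1..n}. w i)"
    using sum.permute[OF w, of id] by simp
  then have "i = w i" if "i \<in> {1..n}" for i
    using that ge by (intro sum_mono_inv[of "\<lambda>i. i" "{1..n}" w]) auto
  then have "w i = i" for i using permutes_not_in[OF w, of i] by (cases "i \<in> {1..n}") metis+
  then show ?thesis by (simp add: fun_eq_iff)
qed

text \<open>Bubble sort: as long as there is a descent, removing it lowers the number of inversions
  by one.\<close>

lemma exists_word_of_length_inversions:
  assumes "w permutes {1..n}"
  shows "\<exists>is. set is \<subseteq> {1..<n} \<and> word_perm is = w \<and> length is = card (inversions w)"
  using assms
proof (induction "card (inversions w)" arbitrary: w rule: less_induct)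
  case less
  show ?case
  proof (cases "\<exists>i. 1 \<le> i \<and> i < n \<and> w (Suc i) < w i")
    case True
    then obtain i where i: "1 \<le> i" "i < n" "w (Suc i) < w i" by blast
    let ?u = "w \<circ> simple_refl i"
    have card: "card (inversions w) = Suc (card (inversions ?u))"
      by (rule card_inversions_descent[OF less.prems i])
    have "?u permutes {1..n}"
      by (rule permutes_compose[OF simple_refl_permutes[OF i(1,2)] less.prems])
    then obtain js where "set js \<subseteq> {1..<n}" "word_perm js = ?u"
        "length js = card (inversions ?u)"
      using less.hyps[of ?u] card by auto
    then show ?thesis using i card by (intro exI[of _ "js @ [i]"]) (auto simp: comp_assoc)
  next
    case False
    have "w = id"
    proof (rule permutes_no_descent_imp_id[OF less.prems])
      fix i assume "1 \<le> i" "i < n"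
      moreover have "w i \<noteq> w (Suc i)"
        using inj_eq[OF permutes_inj[OF less.prems], of i "Suc i"] by simp
      ultimately show "w i < w (Suc i)" using False by force
    qed
    then show ?thesis by (intro exI[of _ "[]"]) simp
  qed
qed

lemma card_inversions_word_perm:
  "set is \<subseteq> {1..<n} \<Longrightarrow> card (inversions (word_perm is)) \<le> length is"
proof (induction "is" rule: rev_induct)
  case (snoc i "is")
  let ?u = "word_perm is"
  have u: "?u permutes {1..n}" using word_perm_permutes[of "is" n] snoc.prems by simp
  have "?u i \<noteq> ?u (Suc i)"
    using inj_eq[OF permutes_inj[OF u], of i "Suc i"] by simp
  then show ?case
    using snoc card_inversions_ascent[OF u, of i] card_inversions_descent[OF u, of i]
    by (cases "?u i < ?u (Suc i)") (auto simp: o_def)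
qed simp

lemma reduced_expr_length:
  assumes "reduced_expr n w is"
  shows "length is = card (inversions w)"
proof -
  have "is": "set is \<subseteq> {1..<n}" "word_perm is = w"
    and min: "\<And>js. set js \<subseteq> {1..<n} \<Longrightarrow> word_perm js = w \<Longrightarrow> length is \<le> length js"
    using assms by (auto simp: reduced_expr_def)
  have "w permutes {1..n}" using word_perm_permutes "is" by blast
  then show ?thesis
    using exists_word_of_length_inversions[of w n] min card_inversions_word_perm[of "is" n] "is"
    by fastforce
qed

lemma exists_reduced_expr:
  assumes "w permutes {1..n}"
  shows "\<exists>is. reduced_expr n w is"
proof -
  obtain "is" where "set is \<subseteq> {1..<n}" "word_perm is = w" "length is = card (inversions w)"
    using exists_word_of_length_inversions[OF assms] by blast
  then have "reduced_expr n w is"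
    using card_inversions_word_perm[of _ n] unfolding reduced_expr_def by metis
  then show ?thesis ..
qed

text \<open>The last letter of a reduced expression is a descent of the permutation.  A permutation that
  preserves \<open>{1..a}\<close> has no descent at \<open>a\<close>, and multiplying it by any other simple reflection
  keeps this property, so the letters can be stripped off one after another.  This is what makes
  \<open>T_w\<close>, for \<open>w\<close> in a parabolic subgroup, a product of generators of that subgroup,
  whichever reduced expression is chosen.\<close>

lemma reduced_expr_avoids_boundary:
  assumes "reduced_expr n w is" "w ` {1..a} = {1..a}"
  shows "a \<notin> set is"
proof -
  have "a \<notin> set is"
    if "set is \<subseteq> {1..<n}" "length is = card (inversions (word_perm is))"
      "word_perm is ` {1..a} = {1..a}" for "is"
    using that
  proof (induction "is" rule: rev_induct)
    case (snoc i "is")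
    let ?u = "word_perm is"
    have u: "?u permutes {1..n}" using word_perm_permutes[of "is" n] snoc.prems by simp
    have le: "card (inversions ?u) \<le> length is"
      using card_inversions_word_perm[of "is" n] snoc.prems by simp
    have l: "Suc (length is) = card (inversions (?u \<circ> simple_refl i))"
      using snoc.prems(2) by (simp add: o_def)
    have i: "1 \<le> i" "i < n" using snoc.prems(1) by auto
    have neq: "?u i \<noteq> ?u (Suc i)"
      using inj_eq[OF permutes_inj[OF u], of i "Suc i"] by simp
    have asc: "?u i < ?u (Suc i)"
    proof (rule ccontr)
      assume "\<not> ?u i < ?u (Suc i)"
      then have "?u (Suc i) < ?u i" using neq by linarith
      from card_inversions_descent[OF u i this] le l show False by linarith
    qed
    have len: "length is = card (inversions ?u)"
      using card_inversions_ascent[OF u asc] l by linarith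
    have "i \<noteq> a"
    proof
      assume "i = a"
      let ?w = "word_perm (is @ [i])"
      have "1 \<le> a" using snoc.prems(1) \<open>i = a\<close> by simp
      have "?w a \<in> ?w ` {1..a}" using \<open>1 \<le> a\<close> by simp
      then have "?u (Suc a) \<le> a" unfolding snoc.prems(3) using \<open>i = a\<close> by simp
      have "?w (Suc a) \<notin> ?w ` {1..a}"
        using inj_image_mem_iff[OF permutes_inj[OF word_perm_permutes[OF snoc.prems(1)]], of "Suc a" "{1..a}"]
        by (simp del: word_perm_append)
      then have "?u a \<notin> {1..a}" unfolding snoc.prems(3) using \<open>i = a\<close> by simp
      moreover have "?u a \<in> {1..n}"
        using permutes_in_image[OF u, of a] snoc.prems(1) \<open>i = a\<close> by simp
      ultimately show False using asc \<open>?u (Suc a) \<le> a\<close> \<open>i = a\<close> by simp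
    qed
    have "simple_refl i ` {1..a} = {1..a}"
    proof -
      have "simple_refl i ` {1..a} \<subseteq> {1..a}"
        using \<open>i \<noteq> a\<close> snoc.prems(1)
        by (auto simp: simple_refl_def Transposition.transpose_def)
      then show ?thesis
        using image_mono[of "simple_refl i ` {1..a}" "{1..a}" "simple_refl i"]
        by (simp add: image_image)
    qed
    then have "?u ` {1..a} = {1..a}"
      using snoc.prems(3) unfolding word_perm_append word_perm_simps image_comp[symmetric] by simp
    then have "a \<notin> set is" using snoc.IH snoc.prems(1) len by simp
    then show ?case using \<open>i \<noteq> a\<close> by simp
  qed simp
  moreover have "set is \<subseteq> {1..<n}" "word_perm is = w"
    using assms(1) by (simp_all add: reduced_expr_def)
  ultimately show ?thesis
    using assms(2) reduced_expr_length[OF assms(1)] by simp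
qed

section \<open>The Hecke algebra and its parabolic subalgebras\<close>

text \<open>The index set \<open>{1..<n}\<close> is part of the name of the free algebra, so rewriting \<open>1\<close> there would
  detach the facts below from their goals.\<close>

declare One_nat_def [simp del]

abbreviation free_alg :: "nat \<Rightarrow> (word \<Rightarrow>\<^sub>0 'f::field) ring" where
  "free_alg n \<equiv> free_algebra {1..<n}"

lemma free_alg_carrier_single: "set (letters w) \<subseteq> {1..<n} \<Longrightarrow> Poly_Mapping.single w c \<in> carrier (free_alg n)"
  by (auto simp: free_algebra_def)

lemma free_alg_closed:
  fixes p r :: "word \<Rightarrow>\<^sub>0 'f::field"
  assumes "p \<in> carrier (free_alg n)" "r \<in> carrier (free_alg n)"
  shows "p + r \<in> carrier (free_alg n)" "p * r \<in> carrier (free_alg n)"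
  using ring.ring_simprules(1,5)[OF ring_free_algebra assms] by (simp_all add: free_algebra_def)

lemma fgen_carrier: "i \<in> {1..<n} \<Longrightarrow> fgen i \<in> carrier (free_alg n)"
  unfolding fgen_def by (rule free_alg_carrier_single) simp

lemma fconst_carrier: "fconst c \<in> carrier (free_alg n)"
  unfolding fconst_def by (rule free_alg_carrier_single) (simp add: zero_word_def)

lemma hecke_class_rep:
  assumes "h \<in> carrier (hecke n q)"
  obtains p where "p \<in> carrier (free_alg n)" "h = hecke_class n q p"
  using assms by (auto simp: hecke_def FactRing_def A_RCOSETS_def RCOSETS_def hecke_class_def a_r_coset_def)

lemma hecke_class_closed: "p \<in> carrier (free_alg n) \<Longrightarrow> hecke_class n q p \<in> carrier (hecke n q)"
  by (auto simp: hecke_def FactRing_def A_RCOSETS_def RCOSETS_def hecke_class_def a_r_coset_def)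

lemma hecke_class_mult:
  assumes "p \<in> carrier (free_alg n)" "r \<in> carrier (free_alg n)"
  shows "hecke_class n q p \<otimes>\<^bsub>hecke n q\<^esub> hecke_class n q r = hecke_class n q (p * r)"
  using ideal.rcoset_mult_add[OF ideal_hecke assms]
  by (simp add: hecke_def FactRing_def hecke_class_def free_algebra_def)

lemma hecke_class_add:
  assumes "p \<in> carrier (free_alg n)" "r \<in> carrier (free_alg n)"
  shows "hecke_class n q p \<oplus>\<^bsub>hecke n q\<^esub> hecke_class n q r = hecke_class n q (p + r)"
proof -
  interpret I: ideal "hecke_ideal n q" "free_alg n" by (rule ideal_hecke)
  show ?thesis
    using I.a_rcos_sum[OF assms] by (simp add: hecke_def FactRing_def hecke_class_def free_algebra_def)
qed

lemma hecke_class_one: "\<one>\<^bsub>hecke n q\<^esub> = hecke_class n q 1"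
  by (simp add: hecke_def FactRing_def hecke_class_def free_algebra_def)

lemma hecke_class_iff: "p' \<in> hecke_class n q p \<longleftrightarrow> p' - p \<in> hecke_ideal n q"
  by (auto simp: hecke_class_def a_r_coset_def r_coset_def free_algebra_def
      intro!: exI[of _ "p' - p"] bexI[of _ "p' - p"])

lemma hecke_class_eqI:
  fixes p p' :: "word \<Rightarrow>\<^sub>0 'f::field"
  assumes "p - p' \<in> hecke_ideal n q"
  shows "hecke_class n q p = hecke_class n q p'"
proof -
  interpret I: ideal "hecke_ideal n q" "free_alg n :: (word \<Rightarrow>\<^sub>0 'f) ring" by (rule ideal_hecke)
  have add: "a + b \<in> hecke_ideal n q" if "a \<in> hecke_ideal n q" "b \<in> hecke_ideal n q" for a b
    using additive_subgroup.a_closed[OF I.additive_subgroup_axioms that] by (simp add: free_algebra_def)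
  have neg: "- a \<in> hecke_ideal n q" if a: "a \<in> hecke_ideal n q" for a
  proof -
    have "\<ominus>\<^bsub>free_alg n\<^esub> a = - a"
      using I.a_subset a by (intro I.minus_equality) (auto simp: free_algebra_def)
    then show ?thesis using additive_subgroup.a_inv_closed[OF I.additive_subgroup_axioms a] by simp
  qed
  have "p'' - p \<in> hecke_ideal n q \<longleftrightarrow> p'' - p' \<in> hecke_ideal n q" for p''
  proof
    assume "p'' - p \<in> hecke_ideal n q"
    then show "p'' - p' \<in> hecke_ideal n q" using add[OF _ assms] by fastforce
  next
    assume "p'' - p' \<in> hecke_ideal n q"
    then show "p'' - p \<in> hecke_ideal n q" using add[OF _ neg[OF assms]] by fastforce
  qed
  then show ?thesis by (auto simp: hecke_class_iff)
qed

lemma hecke_rels_imp_ideal: "p \<in> hecke_rels n q \<Longrightarrow> p \<in> hecke_ideal n q"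
  unfolding hecke_ideal_def using ring.genideal_self[OF ring_free_algebra hecke_rels_carrier] by blast

lemma hecke_scalar_closed [simp]: "hecke_scalar n q c \<in> carrier (hecke n q)"
  unfolding hecke_scalar_def by (intro hecke_class_closed fconst_carrier)

lemma hecke_gen_closed: "i \<in> {1..<n} \<Longrightarrow> hecke_gen n q i \<in> carrier (hecke n q)"
  unfolding hecke_gen_def by (intro hecke_class_closed fgen_carrier)

lemma hecke_scalar_add: "hecke_scalar n q a \<oplus>\<^bsub>hecke n q\<^esub> hecke_scalar n q b = hecke_scalar n q (a + b)"
  unfolding hecke_scalar_def hecke_class_add[OF fconst_carrier fconst_carrier]
  by (simp add: fconst_def single_add)

lemma hecke_scalar_mult: "hecke_scalar n q a \<otimes>\<^bsub>hecke n q\<^esub> hecke_scalar n q b = hecke_scalar n q (a * b)"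
  unfolding hecke_scalar_def hecke_class_mult[OF fconst_carrier fconst_carrier]
  by (simp add: fconst_def mult_single)

lemma hecke_scalar_1: "hecke_scalar n q 1 = \<one>\<^bsub>hecke n q\<^esub>"
  by (simp add: hecke_scalar_def fconst_def hecke_class_one single_one)

lemma hecke_scalar_0: "hecke_scalar n q 0 = \<zero>\<^bsub>hecke n q\<^esub>"
proof -
  interpret ring "hecke n q" by (rule ring_hecke)
  have "hecke_scalar n q 0 \<oplus>\<^bsub>hecke n q\<^esub> hecke_scalar n q 0 = hecke_scalar n q 0"
    by (simp add: hecke_scalar_add)
  then show ?thesis using add.l_cancel_one by simp
qed

lemma hecke_scalar_gen_commute:
  assumes "i \<in> {1..<n}"
  shows "hecke_scalar n q a \<otimes>\<^bsub>hecke n q\<^esub> hecke_gen n q i = hecke_gen n q i \<otimes>\<^bsub>hecke n q\<^esub> hecke_scalar n q a"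
  unfolding hecke_scalar_def hecke_gen_def
  using assms by (simp add: hecke_class_mult fconst_carrier fgen_carrier) (simp add: fconst_def fgen_def mult_single)

lemma hecke_gen_quadratic:
  assumes "i \<in> {1..<n}"
  shows "hecke_gen n q i \<otimes>\<^bsub>hecke n q\<^esub> hecke_gen n q i
    = hecke_scalar n q (q - 1) \<otimes>\<^bsub>hecke n q\<^esub> hecke_gen n q i \<oplus>\<^bsub>hecke n q\<^esub> hecke_scalar n q q"
proof -
  have c: "fconst (q - 1) = fconst q - 1"
    by (simp add: fconst_def single_diff single_one)
  have "fgen i * fgen i - (fconst (q - 1) * fgen i + fconst q) = (fgen i - fconst q) * (fgen i + 1)"
    unfolding c by (simp add: algebra_simps)
  also have "\<dots> \<in> hecke_ideal n q"
    by (rule hecke_rels_imp_ideal) (use assms in \<open>auto simp: hecke_rels_def\<close>)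
  finally show ?thesis
    unfolding hecke_scalar_def hecke_gen_def using assms
    by (simp add: hecke_class_mult hecke_class_add fconst_carrier fgen_carrier free_alg_closed hecke_class_eqI
        del: atLeastLessThan_iff)
qed

lemma hecke_gen_commute:
  assumes "i \<in> {1..<n}" "j \<in> {1..<n}" "\<bar>int i - int j\<bar> > 1"
  shows "hecke_gen n q i \<otimes>\<^bsub>hecke n q\<^esub> hecke_gen n q j = hecke_gen n q j \<otimes>\<^bsub>hecke n q\<^esub> hecke_gen n q i"
proof -
  have "fgen i * fgen j - fgen j * fgen i \<in> hecke_ideal n q"
    by (rule hecke_rels_imp_ideal) (use assms in \<open>auto simp: hecke_rels_def\<close>)
  then show ?thesis
    unfolding hecke_gen_def using assms
    by (simp add: hecke_class_mult fgen_carrier hecke_class_eqI del: atLeastLessThan_iff)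
qed

lemma hecke_gen_braid:
  assumes "i \<in> {1..<n}" "Suc i \<in> {1..<n}"
  shows "hecke_gen n q i \<otimes>\<^bsub>hecke n q\<^esub> hecke_gen n q (Suc i) \<otimes>\<^bsub>hecke n q\<^esub> hecke_gen n q i
    = hecke_gen n q (Suc i) \<otimes>\<^bsub>hecke n q\<^esub> hecke_gen n q i \<otimes>\<^bsub>hecke n q\<^esub> hecke_gen n q (Suc i)"
proof -
  have "fgen i * fgen (Suc i) * fgen i - fgen (Suc i) * fgen i * fgen (Suc i) \<in> hecke_ideal n q"
    by (rule hecke_rels_imp_ideal) (use assms in \<open>unfold hecke_rels_def Suc_eq_plus1, blast\<close>)
  then show ?thesis
    unfolding hecke_gen_def using assms
    by (simp add: hecke_class_mult fgen_carrier free_alg_closed hecke_class_eqI del: atLeastLessThan_iff)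
qed

text \<open>A monomial of the free algebra is a scalar multiplied by generators.\<close>

lemma hecke_induct [consumes 1, case_names scalar gen add mult]:
  assumes h: "h \<in> carrier (hecke n q)"
    and scalar: "\<And>c. P (hecke_scalar n q c)"
    and gen: "\<And>i. i \<in> {1..<n} \<Longrightarrow> P (hecke_gen n q i)"
    and add: "\<And>h k. \<lbrakk>h \<in> carrier (hecke n q); k \<in> carrier (hecke n q); P h; P k\<rbrakk> \<Longrightarrow> P (h \<oplus>\<^bsub>hecke n q\<^esub> k)"
    and mult: "\<And>h k. \<lbrakk>h \<in> carrier (hecke n q); k \<in> carrier (hecke n q); P h; P k\<rbrakk> \<Longrightarrow> P (h \<otimes>\<^bsub>hecke n q\<^esub> k)"
  shows "P h"
proof -
  have single: "P (hecke_class n q (Poly_Mapping.single (Word is) c))" if "set is \<subseteq> {1..<n}" for "is" c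
    using that
  proof (induction "is")
    case Nil
    then show ?case using scalar[of c] by (simp add: hecke_scalar_def fconst_def zero_word_def)
  next
    case (Cons i "is")
    have car: "fgen i \<in> carrier (free_alg n)" "Poly_Mapping.single (Word is) c \<in> carrier (free_alg n)"
      using Cons.prems fgen_carrier[of i n] free_alg_carrier_single[of "Word is" n c] by simp_all
    have "Poly_Mapping.single (Word (i # is)) c = fgen i * Poly_Mapping.single (Word is) c"
      by (simp add: fgen_def mult_single plus_word_def)
    then have "hecke_class n q (Poly_Mapping.single (Word (i # is)) c)
        = hecke_gen n q i \<otimes>\<^bsub>hecke n q\<^esub> hecke_class n q (Poly_Mapping.single (Word is) c)"
      unfolding hecke_gen_def by (simp add: hecke_class_mult[OF car])
    then show ?case
      using mult[OF hecke_gen_closed hecke_class_closed[OF car(2)] gen] Cons by simp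
  qed
  obtain p where p: "p \<in> carrier (free_alg n)" "h = hecke_class n q p"
    by (rule hecke_class_rep[OF h])
  let ?s = "\<lambda>S. \<Sum>w\<in>S. Poly_Mapping.single w (Poly_Mapping.lookup p w)"
  have "?s S \<in> carrier (free_alg n) \<and> P (hecke_class n q (?s S))" if "S \<subseteq> Poly_Mapping.keys p" for S
    using finite_subset[OF that finite_keys] that
  proof (induction S rule: finite_induct)
    case empty
    have zero: "(0 :: word \<Rightarrow>\<^sub>0 'a) = fconst 0" by (simp add: fconst_def)
    show ?case
      unfolding sum.empty zero using scalar[of 0] fconst_carrier by (simp add: hecke_scalar_def)
  next
    case (insert w S)
    let ?t = "Poly_Mapping.single w (Poly_Mapping.lookup p w)"
    have w: "set (letters w) \<subseteq> {1..<n}" using insert.prems p by (auto simp: free_algebra_def)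
    then have t: "?t \<in> carrier (free_alg n)" by (rule free_alg_carrier_single)
    have "P (hecke_class n q ?t)" using single[OF w, of "Poly_Mapping.lookup p w"] by simp
    moreover have IH: "?s S \<in> carrier (free_alg n)" "P (hecke_class n q (?s S))" using insert by auto
    ultimately have "P (hecke_class n q (?t + ?s S))"
      using add[OF hecke_class_closed[OF t] hecke_class_closed[OF IH(1)]] hecke_class_add[OF t IH(1)] by simp
    then show ?case using insert.hyps free_alg_closed(1)[OF t IH(1)] by simp
  qed
  from this[of "Poly_Mapping.keys p"] show ?thesis
    using p poly_mapping_eq_sum_single[of p] by simp
qed

text \<open>Membership is proved from what all reduced expressions of \<open>w\<close> have in common, so that the
  choice made in the definition of \<open>T_w\<close> does not matter.\<close>

lemma hecke_T_mem:
  assumes w: "w permutes {1..n}"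
    and one: "\<one>\<^bsub>hecke n q\<^esub> \<in> S"
    and step: "\<And>i x is. reduced_expr n w is \<Longrightarrow> i \<in> set is \<Longrightarrow> x \<in> S \<Longrightarrow> hecke_gen n q i \<otimes>\<^bsub>hecke n q\<^esub> x \<in> S"
  shows "hecke_T n q w \<in> S"
proof -
  let ?is = "SOME is. reduced_expr n w is"
  have red: "reduced_expr n w ?is" using exists_reduced_expr[OF w] by (rule someI_ex)
  have "foldr (\<lambda>i x. hecke_gen n q i \<otimes>\<^bsub>hecke n q\<^esub> x) js \<one>\<^bsub>hecke n q\<^esub> \<in> S" if "set js \<subseteq> set ?is" for js
    using that by (induction js) (auto intro: one step[OF red])
  then show ?thesis by (simp add: hecke_T_def)
qed

lemma hecke_T_closed:
  assumes "w permutes {1..n}"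
  shows "hecke_T n q w \<in> carrier (hecke n q)"
proof (rule hecke_T_mem[OF assms])
  show "\<one>\<^bsub>hecke n q\<^esub> \<in> carrier (hecke n q)" by (rule ring.ring_simprules(6)[OF ring_hecke])
  show "hecke_gen n q i \<otimes>\<^bsub>hecke n q\<^esub> x \<in> carrier (hecke n q)"
    if "reduced_expr n w is" "i \<in> set is" "x \<in> carrier (hecke n q)" for i x "is"
    using that hecke_gen_closed[of i n q]
    by (intro ring.ring_simprules(5)[OF ring_hecke]) (auto simp: reduced_expr_def)
qed

lemma hecke_T_id: "hecke_T n q id = \<one>\<^bsub>hecke n q\<^esub>"
proof -
  have "reduced_expr n id is \<longleftrightarrow> is = []" for "is"
    using reduced_expr_length[of n id "is"] by (auto simp: reduced_expr_def)
  then show ?thesis by (simp add: hecke_T_def)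
qed

lemma hecke_T_simple_refl:
  assumes i: "i \<in> {1..<n}"
  shows "hecke_T n q (simple_refl i) = hecke_gen n q i"
proof -
  have len: "card (inversions (simple_refl i)) = 1"
    using card_inversions_ascent[OF permutes_id, of i] by simp
  have inj: "j = i" if eq: "simple_refl j = simple_refl i" for j
  proof -
    have "simple_refl j i = Suc i" unfolding eq by simp
    then show ?thesis by (cases "i = j"; cases "i = Suc j") auto
  qed
  have red: "reduced_expr n (simple_refl i) is \<longleftrightarrow> is = [i]" for "is"
  proof
    assume r: "reduced_expr n (simple_refl i) is"
    have "length is = 1" using reduced_expr_length[OF r] len by simp
    then obtain j where j: "is = [j]" by (cases "is") (auto simp: One_nat_def)
    then have "simple_refl j = simple_refl i" using r by (simp add: reduced_expr_def)
    then show "is = [i]" using inj j by simp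
  next
    assume "is": "is = [i]"
    have "length is \<le> length js" if "set js \<subseteq> {1..<n}" "word_perm js = simple_refl i" for js
      using card_inversions_word_perm[OF that(1)] len by (simp add: that(2) "is" One_nat_def)
    then show "reduced_expr n (simple_refl i) is"
      unfolding reduced_expr_def using i "is" by simp
  qed
  then show ?thesis
    using hecke_gen_closed[OF i, of q]
    by (simp add: hecke_T_def red monoid.r_one ring.is_monoid[OF ring_hecke])
qed

lemma finite_parabolic: "finite (parabolic n l)"
  by (rule finite_subset[OF _ finite_permutations[of "{1..n}"]]) (auto simp: parabolic_def sym_group_carrier)

lemma parabolic_permutes: "w \<in> parabolic n l \<Longrightarrow> w permutes {1..n}"
  by (simp add: parabolic_def sym_group_carrier)

lemma hecke_parabolic_subset_carrier: "hecke_parabolic n q l \<subseteq> carrier (hecke n q)"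
proof -
  interpret ring "hecke n q" by (rule ring_hecke)
  show ?thesis
    unfolding hecke_parabolic_def
    using hecke_T_closed[OF parabolic_permutes, of _ n l q] by (auto intro!: finsum_closed)
qed

lemma scalar_T_in_hecke_parabolic:
  assumes "w \<in> parabolic n l"
  shows "hecke_scalar n q a \<otimes>\<^bsub>hecke n q\<^esub> hecke_T n q w \<in> hecke_parabolic n q l"
proof -
  interpret ring "hecke n q" by (rule ring_hecke)
  have T: "hecke_T n q v \<in> carrier (hecke n q)" if "v \<in> parabolic n l" for v
    by (rule hecke_T_closed[OF parabolic_permutes[OF that]])
  let ?c = "\<lambda>v. if v = w then a else 0"
  have "(\<Oplus>\<^bsub>hecke n q\<^esub>v\<in>parabolic n l. hecke_scalar n q (?c v) \<otimes>\<^bsub>hecke n q\<^esub> hecke_T n q v)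
      = (\<Oplus>\<^bsub>hecke n q\<^esub>v\<in>parabolic n l. if w = v then hecke_scalar n q a \<otimes>\<^bsub>hecke n q\<^esub> hecke_T n q v else \<zero>\<^bsub>hecke n q\<^esub>)"
    by (rule finsum_cong') (use T in \<open>auto simp: hecke_scalar_0\<close>)
  also have "\<dots> = hecke_scalar n q a \<otimes>\<^bsub>hecke n q\<^esub> hecke_T n q w"
    by (rule finsum_singleton[OF assms finite_parabolic]) (use T in auto)
  finally show ?thesis unfolding hecke_parabolic_def by (auto intro!: exI[of _ ?c])
qed

lemma hecke_scalar_in_parabolic: "hecke_scalar n q a \<in> hecke_parabolic n q l"
proof -
  interpret ring "hecke n q" by (rule ring_hecke)
  have "id \<in> parabolic n l" by (simp add: parabolic_def sym_group_carrier permutes_id)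
  from scalar_T_in_hecke_parabolic[OF this, of q a] show ?thesis by (simp add: hecke_T_id)
qed

lemma hecke_gen_in_parabolic:
  assumes "i \<in> {1..<n}" "simple_refl i \<in> parabolic n l"
  shows "hecke_gen n q i \<in> hecke_parabolic n q l"
proof -
  interpret ring "hecke n q" by (rule ring_hecke)
  from scalar_T_in_hecke_parabolic[OF assms(2), of q 1] show ?thesis
    using hecke_gen_closed[OF assms(1), of q] by (simp add: hecke_T_simple_refl[OF assms(1)] hecke_scalar_1)
qed

lemma parabolic_preserves_initial:
  assumes "w \<in> parabolic n l" "k \<le> length l"
  shows "w ` {1..sum_list (take k l)} = {1..sum_list (take k l)}"
  using assms(2)
proof (induction k)
  case (Suc k)
  have "{1..sum_list (take (Suc k) l)} = {1..sum_list (take k l)} \<union> block l k"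
    using Suc.prems by (auto simp: block_def take_Suc_conv_app_nth One_nat_def)
  moreover have "w ` block l k = block l k" using assms Suc.prems by (auto simp: parabolic_def)
  ultimately show ?case using Suc by (simp add: image_Un)
qed simp

text \<open>It is enough to exclude the generator at one boundary between blocks, since the
  partial sums of a composition will be tested one at a time.\<close>

lemma hecke_parabolic_minimal:
  assumes b: "b \<in> hecke_parabolic n q l" and k: "k \<le> length l"
    and scalar: "\<And>c. hecke_scalar n q c \<in> S"
    and gen: "\<And>i. i \<in> {1..<n} \<Longrightarrow> i \<noteq> sum_list (take k l) \<Longrightarrow> hecke_gen n q i \<in> S"
    and add: "\<And>h k. h \<in> S \<Longrightarrow> k \<in> S \<Longrightarrow> h \<oplus>\<^bsub>hecke n q\<^esub> k \<in> S"
    and mult: "\<And>h k. h \<in> S \<Longrightarrow> k \<in> S \<Longrightarrow> h \<otimes>\<^bsub>hecke n q\<^esub> k \<in> S"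
    and S: "S \<subseteq> carrier (hecke n q)"
  shows "b \<in> S"
proof -
  interpret ring "hecke n q" by (rule ring_hecke)
  obtain c where b: "b = (\<Oplus>\<^bsub>hecke n q\<^esub>w\<in>parabolic n l. hecke_scalar n q (c w) \<otimes>\<^bsub>hecke n q\<^esub> hecke_T n q w)"
    using b by (auto simp: hecke_parabolic_def)
  have T: "hecke_T n q w \<in> S" if w: "w \<in> parabolic n l" for w
  proof (rule hecke_T_mem[OF parabolic_permutes[OF w]])
    show "\<one>\<^bsub>hecke n q\<^esub> \<in> S" using scalar[of 1] by (simp add: hecke_scalar_1)
    fix i x "is" assume red: "reduced_expr n w is" and "i \<in> set is" "x \<in> S"
    moreover from red have "sum_list (take k l) \<notin> set is"
      by (rule reduced_expr_avoids_boundary[OF _ parabolic_preserves_initial[OF w k]])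
    ultimately show "hecke_gen n q i \<otimes>\<^bsub>hecke n q\<^esub> x \<in> S"
      by (intro mult gen) (auto simp: reduced_expr_def)
  qed
  have "(\<Oplus>\<^bsub>hecke n q\<^esub>w\<in>A. hecke_scalar n q (c w) \<otimes>\<^bsub>hecke n q\<^esub> hecke_T n q w) \<in> S"
    if "A \<subseteq> parabolic n l" for A
    using finite_subset[OF that finite_parabolic] that
  proof (induction A rule: finite_induct)
    case empty
    then show ?case using scalar[of 0] by (simp add: hecke_scalar_0)
  next
    case (insert w A)
    have "hecke_T n q v \<in> carrier (hecke n q)" if "v \<in> insert w A" for v
      using T S insert.prems that by blast
    then show ?case using insert add mult scalar T by (subst finsum_insert) auto
  qed
  then show ?thesis unfolding b by simp
qed

declare One_nat_def [simp]

section \<open>The sign character\<close>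

definition sign_char :: "(word \<Rightarrow>\<^sub>0 'f::field) set \<Rightarrow> 'f" where
  "sign_char h = the_elem (sign_eval ` h)"

lemma sign_module_simps [simp]:
  "carrier sign_module = UNIV" "\<zero>\<^bsub>sign_module\<^esub> = 0" "x \<oplus>\<^bsub>sign_module\<^esub> y = x + y"
  "m \<triangleleft>\<^bsub>sign_module\<^esub> h = m * sign_char h"
  by (auto simp: sign_module_def sign_char_def)

lemma sign_module_minus [simp]: "\<ominus>\<^bsub>sign_module\<^esub> (x :: 'f::field) = - x"
proof -
  interpret right_module "hecke 0 (1 :: 'f)" "sign_module :: ((word \<Rightarrow>\<^sub>0 'f) set, 'f) right_mod"
    by (rule right_module_sign)
  show ?thesis by (rule M.minus_equality) auto
qed

lemma sign_char_add:
  assumes "h \<in> carrier (hecke n q)" "k \<in> carrier (hecke n q)"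
  shows "sign_char (h \<oplus>\<^bsub>hecke n q\<^esub> k) = sign_char h + sign_char k"
proof -
  interpret right_module "hecke n q" sign_module by (rule right_module_sign)
  show ?thesis using ract_add_right[of 1 h k] assms by simp
qed

lemma sign_char_mult:
  assumes "h \<in> carrier (hecke n q)" "k \<in> carrier (hecke n q)"
  shows "sign_char (h \<otimes>\<^bsub>hecke n q\<^esub> k) = sign_char h * sign_char k"
proof -
  interpret right_module "hecke n q" sign_module by (rule right_module_sign)
  show ?thesis using ract_mult[of 1 h k] assms by simp
qed

lemma sign_char_scalar: "sign_char (hecke_scalar n q c) = c"
  by (simp add: sign_char_def hecke_scalar_def sign_eval_hecke_class fconst_def sign_eval_single zero_word_def)

lemma sign_char_gen: "sign_char (hecke_gen n q i) = - 1"
  using sign_module_gen[of 1 n q i] by simp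

lemma sign_char_one: "sign_char \<one>\<^bsub>hecke n q\<^esub> = 1"
  using sign_char_scalar[of n q 1] by (simp add: hecke_scalar_1)

section \<open>A representation on functions of 0/1 sequences\<close>

text \<open>A sequence of letters 0 and 1, given by its set of positions with letter 1.\<close>

type_synonym bits = "nat \<Rightarrow> bool"

definition swap_bits :: "nat \<Rightarrow> bits \<Rightarrow> bits" where
  "swap_bits i c = c(i := c (Suc i), Suc i := c i)"

text \<open>The two-letter part of the action on quantum tensor space, written for the coefficients of a
  vector: \<open>T_i\<close> acts on positions \<open>i\<close> and \<open>i + 1\<close>.  The basis vectors carry the sign of
  their sequence; with this normalization the sum of all coefficients transforms by the sign
  character (\<open>sum_bit_op\<close>), and no signs appear in the eigenvectors.\<close>

definition bit_op :: "'f::field \<Rightarrow> nat \<Rightarrow> (bits \<Rightarrow> 'f) \<Rightarrow> bits \<Rightarrow> 'f" where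
  "bit_op q i Y c =
     (if c i = c (Suc i) then - Y c
      else if c i then - q * Y (swap_bits i c)
      else (q - 1) * Y c - Y (swap_bits i c))"

lemma swap_bits_simps [simp]:
  "swap_bits i c i = c (Suc i)" "swap_bits i c (Suc i) = c i"
  "j \<noteq> i \<Longrightarrow> j \<noteq> Suc i \<Longrightarrow> swap_bits i c j = c j"
  by (auto simp: swap_bits_def)

lemma swap_bits_invol [simp]: "swap_bits i (swap_bits i c) = c"
  by (auto simp: swap_bits_def)

lemma bit_op_linear:
  "bit_op q i (\<lambda>c. Y c + Z c) c = bit_op q i Y c + bit_op q i Z c"
  "bit_op q i (\<lambda>c. a * Y c) c = a * bit_op q i Y c"
  by (auto simp: bit_op_def algebra_simps)

lemma bit_op_quadratic:
  "bit_op q i (bit_op q i Y) c = (q - 1) * bit_op q i Y c + q * Y c"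
  by (auto simp: bit_op_def algebra_simps)

lemma bit_op_commute:
  assumes "\<bar>int i - int j\<bar> > 1"
  shows "bit_op q i (bit_op q j Y) c = bit_op q j (bit_op q i Y) c"
proof -
  have ne: "i \<noteq> j" "i \<noteq> Suc j" "Suc i \<noteq> j" "Suc i \<noteq> Suc j"
    using assms by auto
  have comm: "swap_bits i (swap_bits j c) = swap_bits j (swap_bits i c)"
    using ne by (auto simp: swap_bits_def fun_eq_iff)
  have vals: "swap_bits i c j = c j" "swap_bits i c (Suc j) = c (Suc j)"
    "swap_bits j c i = c i" "swap_bits j c (Suc i) = c (Suc i)"
    using ne by (auto simp: swap_bits_def)
  show ?thesis
    unfolding bit_op_def vals comm
    by (cases "c i"; cases "c (Suc i)"; cases "c j"; cases "c (Suc j)") (simp_all add: algebra_simps)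
qed

lemma bit_op_braid:
  "bit_op q i (bit_op q (Suc i) (bit_op q i Y)) c
    = bit_op q (Suc i) (bit_op q i (bit_op q (Suc i) Y)) c"
proof -
  \<comment> \<open>only the three bits in positions \<open>i\<close>, \<open>i+1\<close>, \<open>i+2\<close> are touched\<close>
  define tri where "tri = (\<lambda>x y z. c(i := x, Suc i := y, Suc (Suc i) := z))"
  have c: "c = tri (c i) (c (Suc i)) (c (Suc (Suc i)))"
    by (auto simp: tri_def fun_eq_iff)
  have vals: "tri x y z i = x" "tri x y z (Suc i) = y" "tri x y z (Suc (Suc i)) = z" for x y z
    by (auto simp: tri_def)
  have swaps: "swap_bits i (tri x y z) = tri y x z" "swap_bits (Suc i) (tri x y z) = tri x z y" for x y z
    by (auto simp: tri_def swap_bits_def fun_eq_iff)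
  have b1: "bit_op q i Z (tri x y z) = (if x = y then - Z (tri x y z)
      else if x then - q * Z (tri y x z) else (q - 1) * Z (tri x y z) - Z (tri y x z))" for Z x y z
    by (simp add: bit_op_def vals swaps)
  have b2: "bit_op q (Suc i) Z (tri x y z) = (if y = z then - Z (tri x y z)
      else if y then - q * Z (tri x z y) else (q - 1) * Z (tri x y z) - Z (tri x z y))" for Z x y z
    by (simp add: bit_op_def vals swaps)
  have "bit_op q i (bit_op q (Suc i) (bit_op q i Y)) (tri x y z)
    = bit_op q (Suc i) (bit_op q i (bit_op q (Suc i) Y)) (tri x y z)" for x y z
    unfolding b1 b2 by (cases x; cases y; cases z) (simp_all add: algebra_simps)
  then show ?thesis using c by metis
qed

definition bits_of_weight :: "nat \<Rightarrow> nat \<Rightarrow> bits set" where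
  "bits_of_weight n a = {c. {j. c j} \<subseteq> {1..n} \<and> card {j. c j} = a}"

lemma finite_bits_of_weight: "finite (bits_of_weight n a)"
proof -
  have "bits_of_weight n a \<subseteq> (\<lambda>A j. j \<in> A) ` Pow {1..n}"
    by (auto simp: bits_of_weight_def intro!: image_eqI[where x = "{j. _ j}"])
  then show ?thesis by (rule finite_subset) simp
qed

lemma bits_of_weight_comp:
  assumes "w permutes {1..n}" "c \<in> bits_of_weight n a"
  shows "c \<circ> w \<in> bits_of_weight n a"
proof -
  have eq: "{j. (c \<circ> w) j} = w -` {j. c j}" by auto
  have "w -` {j. c j} \<subseteq> {1..n}"
    using assms permutes_in_image[OF assms(1)] by (auto simp: bits_of_weight_def)
  moreover have "card (w -` {j. c j}) = card {j. c j}"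
    using permutes_inj[OF assms(1)] permutes_surj[OF assms(1)] by (intro card_vimage_inj) auto
  ultimately show ?thesis
    using assms(2) unfolding bits_of_weight_def mem_Collect_eq eq by simp
qed

lemma sum_bits_of_weight_comp:
  assumes "w permutes {1..n}"
  shows "(\<Sum>c\<in>bits_of_weight n a. Y (c \<circ> w)) = (\<Sum>c\<in>bits_of_weight n a. Y c)"
proof (rule sum.reindex_bij_witness[where j = "\<lambda>c. c \<circ> w" and i = "\<lambda>c. c \<circ> inv' w"])
  have inv: "w \<circ> inv' w = id" "inv' w \<circ> w = id"
    using permutes_inv_o[OF assms] by auto
  show "c \<circ> w \<circ> inv' w = c" "c \<circ> inv' w \<circ> w = c" for c :: bits
    by (simp_all add: comp_assoc inv)
  show "c \<circ> w \<in> bits_of_weight n a" if "c \<in> bits_of_weight n a" for c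
    by (rule bits_of_weight_comp[OF assms that])
  show "c \<circ> inv' w \<in> bits_of_weight n a" if "c \<in> bits_of_weight n a" for c
    by (rule bits_of_weight_comp[OF permutes_inv[OF assms] that])
qed simp

lemma swap_bits_eq_comp: "swap_bits i c = c \<circ> simple_refl i"
  by (auto simp: fun_eq_iff swap_bits_def simple_refl_def Transposition.transpose_def)

text \<open>The function \<open>T_i Y + Y\<close> changes sign when the letters in positions \<open>i\<close> and
  \<open>i + 1\<close> are exchanged, so its values cancel in pairs.\<close>

lemma sum_bit_op:
  fixes q :: "'f::field_char_0"
  assumes "1 \<le> i" "i < n"
  shows "(\<Sum>c\<in>bits_of_weight n a. bit_op q i Y c) = - (\<Sum>c\<in>bits_of_weight n a. Y c)"
proof -
  define R where "R c = bit_op q i Y c + Y c" for c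
  have "R (swap_bits i c) = - R c" for c
    by (auto simp: R_def bit_op_def algebra_simps)
  then have "(\<Sum>c\<in>bits_of_weight n a. R (swap_bits i c)) = - (\<Sum>c\<in>bits_of_weight n a. R c)"
    by (simp add: sum_negf)
  moreover have "simple_refl i permutes {1..n}"
    unfolding simple_refl_def by (rule permutes_swap_id) (use assms in auto)
  then have "(\<Sum>c\<in>bits_of_weight n a. R (swap_bits i c)) = (\<Sum>c\<in>bits_of_weight n a. R c)"
    unfolding swap_bits_eq_comp by (rule sum_bits_of_weight_comp)
  ultimately have "(\<Sum>c\<in>bits_of_weight n a. R c) = 0" by (simp add: eq_neg_iff_add_eq_0)
  then show ?thesis by (simp add: R_def sum.distrib eq_neg_iff_add_eq_0)
qed

text \<open>The product of the first \<open>k\<close> simple reflections; composing a sequence with it moves the first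
  letter to position \<open>k + 1\<close>.\<close>

definition rotation :: "nat \<Rightarrow> nat \<Rightarrow> nat" where
  "rotation k j = (if j = Suc k then 1 else if 1 \<le> j \<and> j \<le> k then Suc j else j)"

lemma rotation_Suc: "rotation (Suc k) = rotation k \<circ> simple_refl (Suc k)"
  by (auto simp: fun_eq_iff rotation_def simple_refl_def Transposition.transpose_def)

lemma rotation_0: "rotation 0 = id"
  by (auto simp: fun_eq_iff rotation_def)

lemma rotation_permutes: "k < n \<Longrightarrow> rotation k permutes {1..n}"
proof (induction k)
  case (Suc k)
  then show ?case
    unfolding rotation_Suc simple_refl_def
    by (intro permutes_compose permutes_swap_id) auto
qed (simp add: rotation_0 permutes_id)

text \<open>For an eigenvector to the eigenvalue \<open>-1\<close>, moving a letter 1 to the right across a letter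
  0 costs a factor \<open>1/q\<close>, and moving a letter 0 across a letter 1 costs a factor \<open>q\<close>.  The
  exponents count the letters that the first letter crosses.\<close>

lemma sign_vector_rotation:
  fixes q :: "'f::field"
  assumes q: "q \<noteq> 0" and Y: "\<And>i c. 1 \<le> i \<Longrightarrow> i < n \<Longrightarrow> bit_op q i Y c = - Y c" and "k < n"
  shows "Y (c \<circ> rotation k) = (if c 1 then inverse q ^ card {j. 2 \<le> j \<and> j \<le> Suc k \<and> \<not> c j} * Y c
      else q ^ card {j. 2 \<le> j \<and> j \<le> Suc k \<and> c j} * Y c)"
  using \<open>k < n\<close>
proof (induction k)
  case 0
  have none: "{j. 2 \<le> j \<and> j \<le> Suc 0 \<and> P j} = {}" for P by auto
  show ?case unfolding none by (simp add: rotation_0)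
next
  case (Suc k)
  let ?b = "c \<circ> rotation k"
  have bits: "?b (Suc k) = c 1" "?b (Suc (Suc k)) = c (Suc (Suc k))"
    by (auto simp: rotation_def)
  have step: "Y (swap_bits (Suc k) ?b) = (if c 1 = c (Suc (Suc k)) then Y ?b
      else if c 1 then inverse q * Y ?b else q * Y ?b)"
  proof -
    have "swap_bits (Suc k) ?b = ?b" if "c 1 = c (Suc (Suc k))"
      using that bits by (auto simp: swap_bits_def fun_eq_iff)
    then show ?thesis
      using Y[of "Suc k" ?b] Suc.prems bits q by (auto simp: bit_op_def field_simps split: if_splits)
  qed
  have ins: "{j. 2 \<le> j \<and> j \<le> Suc (Suc k) \<and> P j} = (if P (Suc (Suc k))
      then insert (Suc (Suc k)) {j. 2 \<le> j \<and> j \<le> Suc k \<and> P j} else {j. 2 \<le> j \<and> j \<le> Suc k \<and> P j})" for P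
    by (auto simp: le_Suc_eq)
  have fin: "finite {j. 2 \<le> j \<and> j \<le> Suc k \<and> P j}" for P
    by (rule finite_subset[of _ "{..Suc k}"]) auto
  have rot: "c \<circ> rotation (Suc k) = swap_bits (Suc k) ?b"
    by (simp add: rotation_Suc swap_bits_eq_comp comp_assoc)
  have IH: "Y ?b = (if c 1 then inverse q ^ card {j. 2 \<le> j \<and> j \<le> Suc k \<and> \<not> c j} * Y c
      else q ^ card {j. 2 \<le> j \<and> j \<le> Suc k \<and> c j} * Y c)"
    by (rule Suc.IH) (use Suc.prems in simp)
  show ?case
    unfolding rot step IH using fin by (simp add: ins)
qed

text \<open>In a full rotation a first letter 1 crosses \<open>n - a\<close> letters 0, and a first letter 0 crosses
  \<open>a\<close> letters 1.  As \<open>q\<^sup>n = 1\<close>, the factor is \<open>q\<^sup>a\<close> in both cases.  The rotation permutes the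
  sequences, so the sum is \<open>q\<^sup>a\<close> times itself.\<close>

lemma sum_sign_vector_eq_0:
  fixes q :: "'f::field"
  assumes q: "q ^ n = 1" "q ^ a \<noteq> 1"
    and Y: "\<And>i c. 1 \<le> i \<Longrightarrow> i < n \<Longrightarrow> bit_op q i Y c = - Y c"
  shows "(\<Sum>c\<in>bits_of_weight n a. Y c) = 0"
proof -
  have "n \<noteq> 0 \<or> a = 0 \<or> bits_of_weight n a = {}"
  proof (cases "n = 0")
    case True
    have "card {j. c j} = 0" if "{j. c j} \<subseteq> {1..n}" for c :: bits
      using that True by (simp add: subset_eq)
    then show ?thesis by (auto simp: bits_of_weight_def)
  qed simp
  then consider "bits_of_weight n a = {}" | "n > 0" using q by auto
  then show ?thesis
  proof cases
    case 2
    then have q0: "q \<noteq> 0" using q by (auto simp: power_0_left)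
    let ?r = "rotation (n - 1)"
    have rot: "Y (c \<circ> ?r) = q ^ a * Y c" if c: "c \<in> bits_of_weight n a" for c
    proof -
      have sub: "{j. c j} \<subseteq> {1..n}" and card: "card {j. c j} = a"
        using c by (auto simp: bits_of_weight_def)
      have fin: "finite {j. c j}" by (rule finite_subset[OF sub]) simp
      have r: "Y (c \<circ> ?r) = (if c 1 then inverse q ^ card {j. 2 \<le> j \<and> j \<le> n \<and> \<not> c j} * Y c
          else q ^ card {j. 2 \<le> j \<and> j \<le> n \<and> c j} * Y c)"
        using sign_vector_rotation[OF q0 Y, of n "n - 1" c] 2 by simp
      show ?thesis
      proof (cases "c 1")
        case True
        have "{j. 2 \<le> j \<and> j \<le> n \<and> \<not> c j} = {1..n} - {j. c j}"
        proof -
          have "j \<noteq> 1" if "\<not> c j" for j using that True by metis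
          then show ?thesis by fastforce
        qed
        then have "card {j. 2 \<le> j \<and> j \<le> n \<and> \<not> c j} = n - a"
          using card_Diff_subset[OF fin sub] card by simp
        moreover have "a \<le> n" using card_mono[OF _ sub] card by simp
        then have "inverse q ^ (n - a) = q ^ a"
          using q power_add[of q "n - a" a]
          unfolding power_inverse by (intro inverse_unique) simp
        ultimately show ?thesis using r True by simp
      next
        case False
        have "{j. 2 \<le> j \<and> j \<le> n \<and> c j} = {j. c j}"
        proof -
          have "2 \<le> j \<and> j \<le> n" if "c j" for j
          proof -
            have "j \<noteq> 1" using that False by metis
            then show ?thesis using that sub by auto
          qed
          then show ?thesis by auto
        qed
        then show ?thesis using r False card by simp
      qed
    qed
    have "(\<Sum>c\<in>bits_of_weight n a. Y c) = (\<Sum>c\<in>bits_of_weight n a. Y (c \<circ> ?r))"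
      by (rule sum_bits_of_weight_comp[symmetric], rule rotation_permutes) (use 2 in simp)
    also have "\<dots> = (\<Sum>c\<in>bits_of_weight n a. q ^ a * Y c)"
      by (rule sum.cong[OF refl rot])
    also have "\<dots> = q ^ a * (\<Sum>c\<in>bits_of_weight n a. Y c)"
      by (rule sum_distrib_left[symmetric])
    finally show ?thesis using q by simp
  qed simp
qed

definition initial_bits :: "nat \<Rightarrow> bits" where
  "initial_bits a j \<longleftrightarrow> 1 \<le> j \<and> j \<le> a"

text \<open>The indicator of the sequence with its \<open>a\<close> ones in front.  It is the image of \<open>1 \<otimes> 1\<close>
  under the coordinate map, and it has eigenvalue \<open>-1\<close> for all generators except the one at
  position \<open>a\<close>.\<close>

definition initial_vector :: "nat \<Rightarrow> bits \<Rightarrow> 'f::field" where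
  "initial_vector a c = (if c = initial_bits a then 1 else 0)"

lemma initial_bits_weight: "a \<le> n \<Longrightarrow> initial_bits a \<in> bits_of_weight n a"
proof -
  have "{j. initial_bits a j} = {1..a}" by (auto simp: initial_bits_def)
  then show "a \<le> n \<Longrightarrow> ?thesis" by (simp add: bits_of_weight_def)
qed

lemma bit_op_initial_vector:
  assumes "1 \<le> i" "i \<noteq> a"
  shows "bit_op q i (initial_vector a) = (\<lambda>c. - initial_vector a c)"
proof
  fix c
  have eq: "initial_bits a i = initial_bits a (Suc i)" using assms by (auto simp: initial_bits_def)
  have "c \<noteq> initial_bits a \<and> swap_bits i c \<noteq> initial_bits a" if "c i \<noteq> c (Suc i)"
    using that eq swap_bits_simps(1,2)[of i c] by metis
  then show "bit_op q i (initial_vector a) c = - initial_vector a c"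
    by (auto simp: bit_op_def initial_vector_def)
qed

definition word_act :: "'f::field \<Rightarrow> nat list \<Rightarrow> (bits \<Rightarrow> 'f) \<Rightarrow> bits \<Rightarrow> 'f" where
  "word_act q is Y = fold (bit_op q) is Y"

definition free_act :: "'f::field \<Rightarrow> (word \<Rightarrow>\<^sub>0 'f) \<Rightarrow> (bits \<Rightarrow> 'f) \<Rightarrow> bits \<Rightarrow> 'f" where
  "free_act q p Y c = (\<Sum>w\<in>Poly_Mapping.keys p. Poly_Mapping.lookup p w * word_act q (letters w) Y c)"

lemma word_act_linear:
  "word_act q is (\<lambda>c. \<Sum>x\<in>S. a x * Y x c) c = (\<Sum>x\<in>S. a x * word_act q is (Y x) c)"
proof (induction "is" arbitrary: Y)
  case (Cons i "is")
  have "bit_op q i (\<lambda>c. \<Sum>x\<in>S. a x * Y x c) = (\<lambda>c. \<Sum>x\<in>S. a x * bit_op q i (Y x) c)"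
  proof (induction S rule: infinite_finite_induct)
    case (insert x S)
    then show ?case by (simp add: fun_eq_iff bit_op_linear)
  qed (auto simp: fun_eq_iff bit_op_def)
  then show ?case using Cons[of "\<lambda>x. bit_op q i (Y x)"] by (simp add: word_act_def)
qed (simp add: word_act_def)

lemma free_act_superset:
  assumes "finite S" "Poly_Mapping.keys p \<subseteq> S"
  shows "free_act q p Y c = (\<Sum>w\<in>S. Poly_Mapping.lookup p w * word_act q (letters w) Y c)"
  unfolding free_act_def using assms
  by (intro sum.mono_neutral_left) (auto simp: in_keys_iff)

lemma free_act_add: "free_act q (p + r) Y c = free_act q p Y c + free_act q r Y c"
proof -
  let ?S = "Poly_Mapping.keys p \<union> Poly_Mapping.keys r"
  have "Poly_Mapping.keys (p + r) \<subseteq> ?S" by (rule keys_add)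
  then show ?thesis
    by (simp add: free_act_superset[of ?S] lookup_add distrib_right sum.distrib)
qed

lemma free_act_single: "free_act q (Poly_Mapping.single w a) Y c = a * word_act q (letters w) Y c"
  by (simp add: free_act_superset[of "{w}"])

lemma free_act_0: "free_act q 0 Y c = 0"
  by (simp add: free_act_def)

lemma free_act_uminus: "free_act q (- p) Y c = - free_act q p Y c"
  using free_act_add[of q p "- p"] by (simp add: free_act_0 eq_neg_iff_add_eq_0 add.commute)

lemma free_act_diff: "free_act q (p - r) Y c = free_act q p Y c - free_act q r Y c"
  using free_act_add[of q p "- r"] by (simp add: free_act_uminus)

lemma free_act_sum: "free_act q (sum f A) Y c = (\<Sum>a\<in>A. free_act q (f a) Y c)"
  by (induction A rule: infinite_finite_induct) (simp_all add: free_act_0 free_act_add)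

text \<open>The left factor acts first: this is a right action.\<close>

lemma free_act_mult: "free_act q (p * r) Y c = free_act q r (free_act q p Y) c"
proof -
  have "p * r = (\<Sum>u\<in>Poly_Mapping.keys p. \<Sum>v\<in>Poly_Mapping.keys r.
      Poly_Mapping.single (u + v) (Poly_Mapping.lookup p u * Poly_Mapping.lookup r v))"
    by (subst poly_mapping_eq_sum_single[of p], subst poly_mapping_eq_sum_single[of r])
      (simp add: sum_product mult_single)
  then have "free_act q (p * r) Y c = (\<Sum>u\<in>Poly_Mapping.keys p. \<Sum>v\<in>Poly_Mapping.keys r.
      Poly_Mapping.lookup p u * Poly_Mapping.lookup r v * word_act q (letters v) (word_act q (letters u) Y) c)"
    by (simp add: free_act_sum free_act_single plus_word_def word_act_def)
  also have "\<dots> = (\<Sum>v\<in>Poly_Mapping.keys r. \<Sum>u\<in>Poly_Mapping.keys p.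
      Poly_Mapping.lookup p u * Poly_Mapping.lookup r v * word_act q (letters v) (word_act q (letters u) Y) c)"
    by (rule sum.swap)
  also have "\<dots> = (\<Sum>v\<in>Poly_Mapping.keys r. Poly_Mapping.lookup r v * word_act q (letters v) (free_act q p Y) c)"
    unfolding free_act_def[of q p, abs_def] word_act_linear
    by (simp add: sum_distrib_left mult_ac)
  finally show ?thesis by (simp add: free_act_def[of q r])
qed

lemma free_act_zero_right: "free_act q p (\<lambda>_. 0) c = 0"
proof -
  have "word_act q is (\<lambda>_. 0) c = 0" for "is"
    using word_act_linear[where S = "{}"] by fastforce
  then show ?thesis by (simp add: free_act_def)
qed

lemma free_act_gen: "free_act q (fgen i) Y = bit_op q i Y"
  by (simp add: fun_eq_iff fgen_def free_act_single word_act_def)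

lemma free_act_const: "free_act q (fconst a) Y = (\<lambda>c. a * Y c)"
  by (simp add: fun_eq_iff fconst_def free_act_single word_act_def zero_word_def)

lemma free_act_rels:
  assumes "p \<in> hecke_rels n q"
  shows "free_act q p Y c = 0"
proof -
  have mult: "free_act q (p * r) Y = free_act q r (free_act q p Y)" for p r Y
    by (rule ext) (rule free_act_mult)
  from assms consider
    (quad) i where "p = (fgen i - fconst q) * (fgen i + 1)"
    | (comm) i j where "p = fgen i * fgen j - fgen j * fgen i" "\<bar>int i - int j\<bar> > 1"
    | (braid) i where "p = fgen i * fgen (i+1) * fgen i - fgen (i+1) * fgen i * fgen (i+1)"
    unfolding hecke_rels_def by blast
  then show ?thesis
  proof cases
    case quad
    have p: "p = fgen i * fgen i - (fconst q * fgen i + fconst q - fgen i)"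
      unfolding quad by (simp add: algebra_simps)
    show ?thesis
      unfolding p by (simp add: bit_op_linear free_act_diff free_act_add mult free_act_gen free_act_const bit_op_quadratic algebra_simps)
  next
    case comm
    then show ?thesis
      using bit_op_commute[OF comm(2), of q Y c] by (simp add: free_act_diff mult free_act_gen)
  next
    case braid
    then show ?thesis
      using bit_op_braid[of q i Y c] by (simp add: free_act_diff mult free_act_gen)
  qed
qed

lemma free_act_ideal:
  assumes "p \<in> hecke_ideal n q"
  shows "free_act q p Y c = 0"
proof -
  let ?R = "free_algebra {1..<n} :: (word \<Rightarrow>\<^sub>0 'a) ring"
  let ?I = "{p \<in> carrier ?R. \<forall>Y c. free_act q p Y c = 0}"
  interpret ring ?R by (rule ring_free_algebra)
  have "ideal ?I ?R"
  proof (rule idealI[OF ring_axioms])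
    show "subgroup ?I (add_monoid ?R)"
    proof (rule group.subgroupI[OF a_group])
      fix a assume a: "a \<in> ?I"
      then have "\<ominus>\<^bsub>?R\<^esub> a = - a"
        by (intro minus_equality) (auto simp: free_algebra_def)
      then show "inv\<^bsub>add_monoid ?R\<^esub> a \<in> ?I"
        using a a_inv_closed[of a] unfolding a_inv_def[symmetric] by (simp add: free_act_uminus)
    next
      have "\<zero>\<^bsub>?R\<^esub> \<in> ?I" using zero_closed by (simp add: free_algebra_def free_act_0)
      then show "?I \<noteq> {}" by blast
    next
      fix a b assume "a \<in> ?I" "b \<in> ?I"
      then show "a \<otimes>\<^bsub>add_monoid ?R\<^esub> b \<in> ?I"
        using a_closed[of a b] by (simp add: free_algebra_def free_act_add)
    qed auto
  next
    fix a x assume a: "a \<in> ?I" and x: "x \<in> carrier ?R"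
    then have "free_act q a Y = (\<lambda>_. 0)" for Y by auto
    then show "x \<otimes>\<^bsub>?R\<^esub> a \<in> ?I" "a \<otimes>\<^bsub>?R\<^esub> x \<in> ?I"
      using a x m_closed[of a x] m_closed[of x a]
      by (simp_all add: free_algebra_def free_act_mult free_act_zero_right)
  qed
  moreover have "hecke_rels n q \<subseteq> ?I"
    using hecke_rels_carrier[of n q] free_act_rels by blast
  ultimately have "hecke_ideal n q \<subseteq> ?I"
    unfolding hecke_ideal_def by (rule genideal_minimal)
  then show ?thesis using assms by blast
qed

text \<open>A class acts through a representative; \<open>free_act_ideal\<close> shows that all representatives
  act in the same way.\<close>

definition hecke_act :: "'f::field \<Rightarrow> (word \<Rightarrow>\<^sub>0 'f) set \<Rightarrow> (bits \<Rightarrow> 'f) \<Rightarrow> bits \<Rightarrow> 'f" where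
  "hecke_act q C = free_act q (SOME p. p \<in> C)"

lemma hecke_act_class: "hecke_act q (hecke_class n q p) Y = free_act q p Y"
proof -
  have coset: "hecke_class n q p = {r + p | r. r \<in> hecke_ideal n q}"
    by (auto simp: hecke_class_def a_r_coset_def r_coset_def free_algebra_def)
  have "p \<in> hecke_class n q p"
    using additive_subgroup.zero_closed[OF ideal.axioms(1)[OF ideal_hecke[of n q]]]
    unfolding coset by (auto simp: free_algebra_def intro!: exI[of _ "0 :: word \<Rightarrow>\<^sub>0 'a"])
  then have "(SOME p'. p' \<in> hecke_class n q p) \<in> hecke_class n q p" by (rule someI)
  then show ?thesis
    unfolding hecke_act_def coset by (auto simp: fun_eq_iff free_act_add free_act_ideal)
qed

lemma hecke_act_add:
  assumes "h \<in> carrier (hecke n q)" "k \<in> carrier (hecke n q)"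
  shows "hecke_act q (h \<oplus>\<^bsub>hecke n q\<^esub> k) Y c = hecke_act q h Y c + hecke_act q k Y c"
proof -
  obtain p where p: "p \<in> carrier (free_alg n)" "h = hecke_class n q p" by (rule hecke_class_rep[OF assms(1)])
  obtain r where r: "r \<in> carrier (free_alg n)" "k = hecke_class n q r" by (rule hecke_class_rep[OF assms(2)])
  show ?thesis unfolding p(2) r(2) hecke_class_add[OF p(1) r(1)] hecke_act_class by (rule free_act_add)
qed

lemma hecke_act_mult:
  assumes "h \<in> carrier (hecke n q)" "k \<in> carrier (hecke n q)"
  shows "hecke_act q (h \<otimes>\<^bsub>hecke n q\<^esub> k) Y = hecke_act q k (hecke_act q h Y)"
proof -
  obtain p where p: "p \<in> carrier (free_alg n)" "h = hecke_class n q p" by (rule hecke_class_rep[OF assms(1)])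
  obtain r where r: "r \<in> carrier (free_alg n)" "k = hecke_class n q r" by (rule hecke_class_rep[OF assms(2)])
  show ?thesis
    unfolding p(2) r(2) hecke_class_mult[OF p(1) r(1)] hecke_act_class by (rule ext) (rule free_act_mult)
qed

lemma hecke_act_scalar: "hecke_act q (hecke_scalar n q a) Y = (\<lambda>c. a * Y c)"
  by (simp add: hecke_scalar_def hecke_act_class free_act_const)

lemma hecke_act_gen: "hecke_act q (hecke_gen n q i) Y = bit_op q i Y"
  by (simp add: hecke_gen_def hecke_act_class free_act_gen)

lemma hecke_act_smult:
  assumes "h \<in> carrier (hecke n q)"
  shows "hecke_act q h (\<lambda>c. a * Y c) = (\<lambda>c. a * hecke_act q h Y c)"
  using assms
proof (induction arbitrary: Y rule: hecke_induct)
  case (gen i)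
  show ?case by (simp add: fun_eq_iff hecke_act_gen bit_op_linear)
next
  case (add h k)
  then show ?case by (simp add: fun_eq_iff hecke_act_add distrib_left)
qed (simp_all add: hecke_act_scalar hecke_act_mult mult.left_commute)

text \<open>Through this identity the sum of the coordinates computes \<open>\<epsilon>\<close> on the induced module.\<close>

lemma sum_hecke_act:
  fixes q :: "'f::field_char_0"
  assumes "h \<in> carrier (hecke n q)"
  shows "(\<Sum>c\<in>bits_of_weight n a. hecke_act q h Y c) = sign_char h * (\<Sum>c\<in>bits_of_weight n a. Y c)"
  using assms
proof (induction arbitrary: Y rule: hecke_induct)
  case (scalar b)
  show ?case by (simp add: hecke_act_scalar sign_char_scalar sum_distrib_left)
next
  case (gen i)
  then show ?case by (simp add: hecke_act_gen sign_char_gen sum_bit_op)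
qed (simp_all add: hecke_act_add hecke_act_mult sign_char_add sign_char_mult sum.distrib algebra_simps)

lemma hecke_parabolic_initial_vector:
  assumes b: "b \<in> hecke_parabolic n q l" and k: "k \<le> length l"
  shows "hecke_act q b (initial_vector (sum_list (take k l)))
    = (\<lambda>c. sign_char b * initial_vector (sum_list (take k l)) c)"
proof -
  let ?v = "initial_vector (sum_list (take k l)) :: bits \<Rightarrow> 'a"
  let ?S = "{h \<in> carrier (hecke n q). hecke_act q h ?v = (\<lambda>c. sign_char h * ?v c)}"
  interpret ring "hecke n q" by (rule ring_hecke)
  have "b \<in> ?S"
  proof (rule hecke_parabolic_minimal[OF b k])
    show "hecke_scalar n q a \<in> ?S" for a by (simp add: hecke_act_scalar sign_char_scalar)
    show "hecke_gen n q i \<in> ?S" if "i \<in> {1..<n}" "i \<noteq> sum_list (take k l)" for i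
      using that hecke_gen_closed[OF that(1), of q]
      by (simp add: hecke_act_gen sign_char_gen bit_op_initial_vector)
    fix h k assume hk: "h \<in> ?S" "k \<in> ?S"
    then show "h \<oplus>\<^bsub>hecke n q\<^esub> k \<in> ?S"
      by (auto simp: fun_eq_iff hecke_act_add sign_char_add algebra_simps)
    from hk show "h \<otimes>\<^bsub>hecke n q\<^esub> k \<in> ?S"
      by (auto simp: hecke_act_mult hecke_act_smult sign_char_mult mult.assoc)
  qed auto
  then show ?thesis by simp
qed

section \<open>Compositions over which the sign module is relatively projective\<close>

lemma tensor_sign: "tensor (hecke n q) sign_module (hecke_parabolic n q l)"
  by (intro tensor.intro right_module_sign tensor_axioms.intro hecke_parabolic_subset_carrier)

text \<open>The coordinates \<open>\<Phi> c\<close> on the induced module come from the indicator vector, on which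
  the parabolic subalgebra acts by the sign character.  A retraction \<open>g\<close> onto the sign module
  is a multiple of the sum of the coordinates.  The image \<open>x\<close> of \<open>1\<close> under a section is an
  eigenvector with eigenvalue \<open>-1\<close>, so for \<open>q\<^sup>a \<noteq> 1\<close> its coordinates have sum zero,
  contrary to \<open>g x = 1\<close>.\<close>

lemma relatively_projective_sign_imp_root_of_unity:
  fixes q :: "'f::field_char_0"
  assumes qn: "q ^ n = 1" and comp: "composition n \<mu>" and k: "k \<le> length \<mu>"
    and proj: "relatively_projective n q \<mu> (sign_module :: ((word \<Rightarrow>\<^sub>0 'f) set, 'f) right_mod)"
  shows "q ^ sum_list (take k \<mu>) = 1"
proof (rule ccontr)
  define a where "a = sum_list (take k \<mu>)"
  assume "q ^ sum_list (take k \<mu>) \<noteq> 1"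
  then have qa: "q ^ a \<noteq> 1" by (simp add: a_def)
  have "sum_list (take k \<mu>) + sum_list (drop k \<mu>) = n"
    using comp by (simp add: composition_def flip: sum_list_append)
  then have "a \<le> n" by (simp add: a_def)
  let ?S = "sign_module :: ((word \<Rightarrow>\<^sub>0 'f) set, 'f) right_mod"
  let ?H = "hecke n q"
  let ?v = "initial_vector a :: bits \<Rightarrow> 'f"
  interpret S: right_module ?H ?S by (rule right_module_sign)
  interpret T: tensor ?H ?S "hecke_parabolic n q \<mu>" by (rule tensor_sign)
  have "\<exists>F. (\<forall>x\<in>carrier T.N. \<forall>y\<in>carrier T.N. F (x \<oplus>\<^bsub>T.N\<^esub> y) = F x + F y) \<and>
      (\<forall>m. \<forall>h\<in>carrier ?H. F (T.pure m h) = m * hecke_act q h ?v c)" for c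
  proof -
    obtain F where "\<And>x. x \<in> carrier T.N \<Longrightarrow> F x \<in> carrier ?S"
      "\<And>x y. x \<in> carrier T.N \<Longrightarrow> y \<in> carrier T.N \<Longrightarrow> F (x \<oplus>\<^bsub>T.N\<^esub> y) = F x \<oplus>\<^bsub>?S\<^esub> F y"
      "\<And>m h. m \<in> carrier ?S \<Longrightarrow> h \<in> carrier ?H \<Longrightarrow> F (T.pure m h) = m * hecke_act q h ?v c"
    proof (rule T.N_universal[of ?S "\<lambda>m h. m * hecke_act q h ?v c"])
      show "abelian_group ?S" by (rule S.M.abelian_group_axioms)
      fix m :: 'f and b h assume b: "b \<in> hecke_parabolic n q \<mu>" and h: "h \<in> carrier ?H"
      have "b \<in> carrier ?H" using b hecke_parabolic_subset_carrier by blast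
      then show "m \<triangleleft>\<^bsub>?S\<^esub> b * hecke_act q h ?v c = m * hecke_act q (b \<otimes>\<^bsub>?H\<^esub> h) ?v c"
        using h hecke_parabolic_initial_vector[OF b k]
        by (simp add: hecke_act_mult hecke_act_smult a_def mult.assoc)
    qed (auto simp: hecke_act_add algebra_simps)
    then show ?thesis by (intro exI[of _ F]) auto
  qed
  then obtain \<Phi> where \<Phi>_add: "\<And>c x y. x \<in> carrier T.N \<Longrightarrow> y \<in> carrier T.N \<Longrightarrow> \<Phi> c (x \<oplus>\<^bsub>T.N\<^esub> y) = \<Phi> c x + \<Phi> c y"
    and \<Phi>_pure: "\<And>c m h. h \<in> carrier ?H \<Longrightarrow> \<Phi> c (T.pure m h) = m * hecke_act q h ?v c"
    by metis
  have \<Phi>_zero: "\<Phi> c \<zero>\<^bsub>T.N\<^esub> = 0" for c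
    using \<Phi>_add[of "\<zero>\<^bsub>T.N\<^esub>" "\<zero>\<^bsub>T.N\<^esub>" c] by simp
  have \<Phi>_minus: "\<Phi> c (\<ominus>\<^bsub>T.N\<^esub> x) = - \<Phi> c x" if "x \<in> carrier T.N" for c x
    using \<Phi>_add[of "\<ominus>\<^bsub>T.N\<^esub> x" x c] that by (simp add: T.N.M.l_neg \<Phi>_zero eq_neg_iff_add_eq_0)
  have \<Phi>_diff: "\<Phi> c (x \<ominus>\<^bsub>T.N\<^esub> y) = \<Phi> c x - \<Phi> c y" if "x \<in> carrier T.N" "y \<in> carrier T.N" for c x y
    using that by (simp add: a_minus_def \<Phi>_add \<Phi>_minus)
  have \<Phi>_act: "\<Phi> c (x \<triangleleft>\<^bsub>T.N\<^esub> hecke_gen n q i) = bit_op q i (\<lambda>c. \<Phi> c x) c"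
    if x: "x \<in> carrier T.N" and i: "i \<in> {1..<n}" for c x i
    using x
  proof (induction arbitrary: c rule: T.N_induct)
    case (pure m h)
    then show ?case
      using hecke_gen_closed[OF i, of q]
      by (simp add: T.pure_ract \<Phi>_pure hecke_act_mult hecke_act_gen bit_op_linear)
  next
    case (diff x y)
    have "(x \<ominus>\<^bsub>T.N\<^esub> y) \<triangleleft>\<^bsub>T.N\<^esub> hecke_gen n q i = x \<triangleleft>\<^bsub>T.N\<^esub> hecke_gen n q i \<ominus>\<^bsub>T.N\<^esub> y \<triangleleft>\<^bsub>T.N\<^esub> hecke_gen n q i"
      using diff hecke_gen_closed[OF i, of q] by (simp add: a_minus_def T.N.ract_add_left T.N.ract_minus)
    moreover have "(\<lambda>c. \<Phi> c (x \<ominus>\<^bsub>T.N\<^esub> y)) = (\<lambda>c. \<Phi> c x + (- 1) * \<Phi> c y)"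
      using diff by (simp add: \<Phi>_diff fun_eq_iff)
    ultimately show ?case
      using diff hecke_gen_closed[OF i, of q]
      by (simp only: \<Phi>_diff T.N.ract_closed bit_op_linear) simp
  qed
  obtain f g where f: "f \<in> right_mod_hom ?H ?S T.N" and g: "g \<in> right_mod_hom ?H T.N ?S"
    and gf: "\<And>m. m \<in> carrier ?S \<Longrightarrow> g (f m) = m"
    using proj iso_to_direct_summandE[OF right_module_sign T.right_module_N]
    unfolding relatively_projective_def by metis
  let ?x = "f 1"
  have x: "?x \<in> carrier T.N" using right_mod_homD(1)[OF f, of 1] by simp
  have sign: "bit_op q i (\<lambda>c. \<Phi> c ?x) c = - \<Phi> c ?x" if "1 \<le> i" "i < n" for i c
  proof -
    have "?x \<triangleleft>\<^bsub>T.N\<^esub> hecke_gen n q i = f (1 \<triangleleft>\<^bsub>?S\<^esub> hecke_gen n q i)"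
      using right_mod_homD(3)[OF f, of 1 "hecke_gen n q i"] hecke_gen_closed[of i n q] that by simp
    also have "\<dots> = \<ominus>\<^bsub>T.N\<^esub> ?x"
      using right_mod_hom_minus[OF f right_module_sign T.right_module_N, of 1] by (simp add: sign_char_gen)
    finally show ?thesis using \<Phi>_act[OF x, of i c] \<Phi>_minus[OF x, of c] that by simp
  qed
  \<comment> \<open>scalars lie in the parabolic subalgebra, so \<open>m \<otimes> h\<close> is \<open>1 \<otimes> 1\<close> times a ring element\<close>
  have g_eq: "g y = g (T.pure 1 \<one>\<^bsub>?H\<^esub>) * (\<Sum>c\<in>bits_of_weight n a. \<Phi> c y)" if "y \<in> carrier T.N" for y
    using that
  proof (induction rule: T.N_induct)
    case (pure m h)
    let ?s = "hecke_scalar n q m"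
    have "T.pure m h = T.pure (1 \<triangleleft>\<^bsub>?S\<^esub> ?s) h" by (simp add: sign_char_scalar)
    also have "\<dots> = T.pure 1 (?s \<otimes>\<^bsub>?H\<^esub> h)"
      using pure hecke_scalar_in_parabolic[of n q m \<mu>] by (intro T.pure_balanced) auto
    also have "\<dots> = T.pure 1 \<one>\<^bsub>?H\<^esub> \<triangleleft>\<^bsub>T.N\<^esub> (?s \<otimes>\<^bsub>?H\<^esub> h)"
      using pure by (simp add: T.pure_ract)
    finally have "g (T.pure m h) = g (T.pure 1 \<one>\<^bsub>?H\<^esub>) * (m * sign_char h)"
      using pure right_mod_homD(3)[OF g, of "T.pure 1 \<one>\<^bsub>?H\<^esub>" "?s \<otimes>\<^bsub>?H\<^esub> h"]
      by (simp add: T.pure_closed sign_char_mult[of ?s n q h] sign_char_scalar)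
    moreover have "(\<Sum>c\<in>bits_of_weight n a. ?v c) = 1"
      using initial_bits_weight[OF \<open>a \<le> n\<close>] finite_bits_of_weight[of n a]
      by (simp add: initial_vector_def)
    ultimately show ?case
      using pure sum_hecke_act[of h n q ?v a] by (simp add: \<Phi>_pure flip: sum_distrib_left)
  next
    case (diff x y)
    have "g (x \<ominus>\<^bsub>T.N\<^esub> y) = g x - g y"
      using diff right_mod_homD(2)[OF g, of x "\<ominus>\<^bsub>T.N\<^esub> y"]
        right_mod_hom_minus[OF g T.right_module_N right_module_sign, of y] by (simp add: a_minus_def)
    then show ?case using diff by (simp add: \<Phi>_diff sum_subtractf algebra_simps)
  qed
  have "(\<Sum>c\<in>bits_of_weight n a. \<Phi> c ?x) = 0"
    by (rule sum_sign_vector_eq_0[OF qn qa]) (use sign in blast)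
  then show False using g_eq[OF x] gf[of 1] by simp
qed

text \<open>A block of \<open>\<mu>\<close> is a difference of two initial segments whose lengths are multiples of \<open>e\<close>,
  and those are preserved.\<close>

lemma parabolic_equal_blocks_subset:
  assumes comp: "composition (d * e) \<mu>" and dvd: "\<And>k. k \<le> length \<mu> \<Longrightarrow> e dvd sum_list (take k \<mu>)"
    and "0 < e"
  shows "parabolic (d * e) (replicate d e) \<subseteq> parabolic (d * e) \<mu>"
proof
  fix w assume w: "w \<in> parabolic (d * e) (replicate d e)"
  have pre: "w ` {1..j * e} = {1..j * e}" if "j \<le> d" for j
    using parabolic_preserves_initial[OF w, of j] that by (simp add: sum_list_replicate min_def)
  have "inj w" using parabolic_permutes[OF w] by (rule permutes_inj)
  have "w ` block \<mu> k = block \<mu> k" if k: "k < length \<mu>" for k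
  proof -
    have le: "sum_list (take j \<mu>) \<le> d * e" for j
    proof -
      have "sum_list (take j \<mu>) + sum_list (drop j \<mu>) = d * e"
        using comp by (simp add: composition_def flip: sum_list_append)
      then show ?thesis by simp
    qed
    have init: "w ` {1..sum_list (take j \<mu>)} = {1..sum_list (take j \<mu>)}" if j: "j \<le> length \<mu>" for j
    proof -
      obtain u where u: "sum_list (take j \<mu>) = u * e" using dvd[OF j] by (metis dvd_def mult.commute)
      then have "u \<le> d" using le[of j] \<open>0 < e\<close> by simp
      then show ?thesis using pre u by simp
    qed
    have b: "block \<mu> k = {1..sum_list (take (k + 1) \<mu>)} - {1..sum_list (take k \<mu>)}"
      by (auto simp: block_def)
    show ?thesis
      unfolding b image_set_diff[OF \<open>inj w\<close>] using init[of k] init[of "k + 1"] k by simp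
  qed
  then show "w \<in> parabolic (d * e) \<mu>" using w by (auto simp: parabolic_def)
qed

section \<open>Gaussian binomial coefficients at a root of unity\<close>

text \<open>In characteristic zero the sum \<open>1 + q + \<dots> + q^{e-1}\<close> does not vanish at \<open>q = 1\<close>, so \<open>q\<close> is a
  primitive root of unity of order \<open>e\<close>.\<close>

lemma quantum_char_power_eq_1_iff:
  fixes q :: "'f::field_char_0"
  assumes "quantum_char q e"
  shows "q ^ k = 1 \<longleftrightarrow> e dvd k"
proof -
  have e: "0 < e" "(\<Sum>i<e. q ^ i) = 0"
    and min: "\<And>k. 0 < k \<Longrightarrow> k < e \<Longrightarrow> (\<Sum>i<k. q ^ i) \<noteq> 0"
    using assms by (auto simp: quantum_char_def)
  have q1: "q \<noteq> 1" using e by auto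
  have geom: "(q - 1) * (\<Sum>i<k. q ^ i) = q ^ k - 1" for k
    by (simp add: power_diff_1_eq)
  have qe: "q ^ e = 1" using geom[of e] e by simp
  have "q ^ k = q ^ (k mod e)"
    using qe by (metis mult.left_neutral div_mult_mod_eq mult.commute power_add power_mult power_one)
  moreover have "q ^ (k mod e) = 1 \<longleftrightarrow> k mod e = 0"
    using geom[of "k mod e"] min[of "k mod e"] e q1 mod_less_divisor[of e k]
    by (cases "k mod e = 0") (auto simp del: mod_less_divisor)
  ultimately show ?thesis by (metis dvd_eq_mod_eq_0)
qed

text \<open>The Gaussian binomial coefficient \<open>[a + b choose a]\<close> in the variable \<open>p\<close>.  The recursion is
  the one of \<open>shuffle\<close> below, which splits by the last letter.\<close>

fun qbinom :: "'f::field \<Rightarrow> nat \<Rightarrow> nat \<Rightarrow> 'f" where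
  "qbinom p 0 b = 1"
| "qbinom p a 0 = 1"
| "qbinom p (Suc a) (Suc b) = qbinom p (Suc a) b + p ^ Suc b * qbinom p a (Suc b)"

lemma qbinom_0_right [simp]: "qbinom p a 0 = 1"
  by (cases a) auto

text \<open>The identities \<open>[b + 1] [a + b + 1 choose b + 1] = [a + b + 1] [a + b choose b]\<close> and their mirror
  image, multiplied by \<open>1 - p\<close>.  They are proved together because the step of each one uses the
  other.\<close>

lemma qbinom_absorption:
  "(1 - p ^ Suc b) * qbinom p a (Suc b) = (1 - p ^ Suc (a + b)) * qbinom p a b"
  "(1 - p ^ Suc a) * qbinom p (Suc a) b = (1 - p ^ Suc (a + b)) * qbinom p a b"
proof (induction "a + b" arbitrary: a b rule: less_induct)
  case less
  {
    case 1
    show ?case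
    proof (cases a)
      case (Suc a')
      have "(1 - p ^ Suc b) * qbinom p a' (Suc b) = (1 - p ^ Suc (a' + b)) * qbinom p a' b"
        "(1 - p ^ Suc a') * qbinom p (Suc a') b = (1 - p ^ Suc (a' + b)) * qbinom p a' b"
        using less[of a' b] Suc by auto
      then have *: "(1 - p ^ Suc b) * qbinom p a' (Suc b) = (1 - p ^ Suc a') * qbinom p a b"
        using Suc by simp
      have "(1 - p ^ Suc b) * qbinom p a (Suc b)
          = (1 - p ^ Suc b) * qbinom p a b + p ^ Suc b * ((1 - p ^ Suc b) * qbinom p a' (Suc b))"
        by (simp add: Suc algebra_simps)
      also have "\<dots> = (1 - p ^ Suc (a + b)) * qbinom p a b"
        unfolding * by (simp add: Suc algebra_simps power_add)
      finally show ?thesis .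
    qed simp
  next
    case 2
    show ?case
    proof (cases b)
      case (Suc b')
      have "(1 - p ^ Suc b') * qbinom p a (Suc b') = (1 - p ^ Suc (a + b')) * qbinom p a b'"
        "(1 - p ^ Suc a) * qbinom p (Suc a) b' = (1 - p ^ Suc (a + b')) * qbinom p a b'"
        using less[of a b'] Suc by auto
      then have *: "(1 - p ^ Suc a) * qbinom p (Suc a) b' = (1 - p ^ Suc b') * qbinom p a b"
        using Suc by simp
      have "(1 - p ^ Suc a) * qbinom p (Suc a) b
          = (1 - p ^ Suc a) * qbinom p (Suc a) b' + p ^ b * ((1 - p ^ Suc a) * qbinom p a b)"
        by (simp add: Suc algebra_simps)
      also have "\<dots> = (1 - p ^ Suc (a + b)) * qbinom p a b"
        unfolding * by (simp add: Suc algebra_simps power_add)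
      finally show ?thesis .
    qed simp
  }
qed

text \<open>Because \<open>p\<^sup>e = 1\<close>, the recursion for \<open>b = e\<close> reads
  \<open>[a + e choose e] = [a + e - 1 choose e - 1] + [a - 1 + e choose e]\<close>.  By the absorption identity
  the first summand is \<open>1\<close> if \<open>e\<close> divides \<open>a\<close>, and \<open>0\<close> otherwise.  So the value counts the
  multiples of \<open>e\<close> up to \<open>a\<close>, zero included.\<close>

lemma qbinom_root_of_unity:
  fixes p :: "'f::field"
  assumes root: "\<And>k. p ^ k = 1 \<longleftrightarrow> e dvd k" and "0 < e"
  shows "qbinom p (k * e) e = of_nat (Suc k)"
proof -
  have small: "qbinom p (k * e) b = 1" if "b < e" for b k
    using that
  proof (induction b)
    case (Suc b)
    have "p ^ Suc b \<noteq> 1" using root[of "Suc b"] Suc.prems by (auto dest: dvd_imp_le)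
    moreover have "p ^ Suc (k * e + b) = p ^ Suc b"
    proof -
      have "p ^ (k * e) = 1" using root by simp
      then show ?thesis by (simp add: power_add)
    qed
    ultimately show ?case
      using qbinom_absorption(1)[of p b "k * e"] Suc by (auto simp del: power_Suc)
  qed simp
  obtain e' where e: "e = Suc e'" using \<open>0 < e\<close> by (cases e) auto
  have pe: "p ^ e = 1" using root by simp
  \<comment> \<open>the induction runs through all \<open>a = k * e + j\<close>; the value changes only when \<open>j = 0\<close>\<close>
  have "qbinom p (k * e + j) e = of_nat (Suc k)" if "j < e" for j k
    using that
  proof (induction "k * e + j" arbitrary: k j rule: less_induct)
    case less
    show ?case
    proof (cases "k * e + j")
      case 0
      then show ?thesis using \<open>0 < e\<close> less.prems by simp
    next
      case (Suc a)
      have rec: "qbinom p (k * e + j) e = qbinom p (k * e + j) e' + qbinom p a e"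
        using qbinom.simps(3)[of p a e', folded e Suc] pe by simp
      show ?thesis
      proof (cases j)
        case 0
        then obtain k' where k: "k = Suc k'" using Suc by (cases k) auto
        have a: "a = k' * e + e'" using Suc 0 k e by simp
        have "qbinom p a e = of_nat (Suc k')"
          unfolding a by (rule less.hyps) (use Suc a e in auto)
        then show ?thesis using rec small[of e' k] k e 0 by simp
      next
        case (Suc j')
        have a: "a = k * e + j'" using Suc \<open>k * e + j = Suc a\<close> by simp
        have z: "qbinom p (k * e + j) e' = 0"
        proof -
          have "(1 - p ^ Suc e') * qbinom p (Suc a) (Suc e') = (1 - p ^ Suc (Suc a + e')) * qbinom p (Suc a) e'"
            by (rule qbinom_absorption(1))
          moreover have "p ^ Suc (Suc a + e') \<noteq> 1"
          proof -
            have "Suc (Suc a + e') = k * e + e + j" using \<open>k * e + j = Suc a\<close> e by simp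
            moreover have "p ^ (k * e) = 1" using root by simp
            ultimately have "p ^ Suc (Suc a + e') = p ^ j"
              using pe by (simp only: power_add mult_1)
            then show ?thesis using root[of j] less.prems Suc by (auto dest: dvd_imp_le)
          qed
          ultimately show ?thesis using pe e \<open>k * e + j = Suc a\<close> by simp
        qed
        have "qbinom p a e = of_nat (Suc k)"
          unfolding a by (rule less.hyps) (use Suc less.prems in auto)
        then show ?thesis using rec z by simp
      qed
    qed
  qed
  from this[of 0 k] show ?thesis using \<open>0 < e\<close> by simp
qed

section \<open>Shuffle operators\<close>

text \<open>The operators \<open>t i\<close> satisfy the braid relations, and \<open>s\<close> plays the role of
  multiplication by the scalar \<open>-1/q\<close>.  The last assumption is the quadratic relation in the form in
  which it is used: \<open>(1 - T/q) T = - (1 - T/q)\<close>.\<close>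

locale hecke_operators = abelian_group N for N (structure) +
  fixes n :: nat and t :: "nat \<Rightarrow> 'a \<Rightarrow> 'a" and s :: "'a \<Rightarrow> 'a"
  assumes t_closed: "\<lbrakk>1 \<le> i; i < n; x \<in> carrier N\<rbrakk> \<Longrightarrow> t i x \<in> carrier N"
    and t_add: "\<lbrakk>1 \<le> i; i < n; x \<in> carrier N; y \<in> carrier N\<rbrakk> \<Longrightarrow> t i (x \<oplus> y) = t i x \<oplus> t i y"
    and s_closed: "x \<in> carrier N \<Longrightarrow> s x \<in> carrier N"
    and s_add: "\<lbrakk>x \<in> carrier N; y \<in> carrier N\<rbrakk> \<Longrightarrow> s (x \<oplus> y) = s x \<oplus> s y"
    and t_s: "\<lbrakk>1 \<le> i; i < n; x \<in> carrier N\<rbrakk> \<Longrightarrow> t i (s x) = s (t i x)"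
    and t_comm: "\<lbrakk>1 \<le> i; Suc i < j; j < n; x \<in> carrier N\<rbrakk> \<Longrightarrow> t i (t j x) = t j (t i x)"
    and t_braid: "\<lbrakk>1 \<le> i; Suc i < n; x \<in> carrier N\<rbrakk> \<Longrightarrow>
      t i (t (Suc i) (t i x)) = t (Suc i) (t i (t (Suc i) x))"
    and t_quadratic: "\<lbrakk>1 \<le> i; i < n; x \<in> carrier N\<rbrakk> \<Longrightarrow>
      t i (x \<oplus> s (t i x)) = \<ominus> (x \<oplus> s (t i x))"
begin

definition additive_op :: "('a \<Rightarrow> 'a) \<Rightarrow> bool" where
  "additive_op u \<longleftrightarrow> (\<forall>x\<in>carrier N. u x \<in> carrier N) \<and>
     (\<forall>x\<in>carrier N. \<forall>y\<in>carrier N. u (x \<oplus> y) = u x \<oplus> u y)"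

lemma additive_opD:
  assumes "additive_op u"
  shows "x \<in> carrier N \<Longrightarrow> u x \<in> carrier N"
    "x \<in> carrier N \<Longrightarrow> y \<in> carrier N \<Longrightarrow> u (x \<oplus> y) = u x \<oplus> u y"
  using assms by (auto simp: additive_op_def)

lemma additive_op_zero:
  assumes "additive_op u"
  shows "u \<zero> = \<zero>"
  using additive_opD(1)[OF assms, of \<zero>] additive_opD(2)[OF assms, of \<zero> \<zero>] add.l_cancel_one by simp

lemma additive_op_minus:
  assumes "additive_op u" "x \<in> carrier N"
  shows "u (\<ominus> x) = \<ominus> u x"
  using additive_opD[OF assms(1)] additive_op_zero[OF assms(1)] assms(2)
    additive_opD(2)[OF assms(1), of "\<ominus> x" x]
  by (intro minus_equality[symmetric]) (auto simp: l_neg)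

lemma additive_op_t: "1 \<le> i \<Longrightarrow> i < n \<Longrightarrow> additive_op (t i)"
  by (simp add: additive_op_def t_closed t_add)

lemma additive_op_s: "additive_op s"
  by (simp add: additive_op_def s_closed s_add)

lemma additive_op_power: "additive_op u \<Longrightarrow> additive_op (u ^^ k)"
  by (induction k) (auto simp: additive_op_def)

text \<open>The right action of \<open>T_a T_{a+1} \<dots> T_{a+b-1}\<close>.\<close>

fun chain :: "nat \<Rightarrow> nat \<Rightarrow> 'a \<Rightarrow> 'a" where
  "chain a 0 y = y"
| "chain a (Suc b) y = t (a + b) (chain a b y)"

lemma chain_Suc_left: "chain a (Suc b) y = chain (Suc a) b (t a y)"
  by (induction b) auto

lemma additive_op_chain: "1 \<le> a \<Longrightarrow> a + b \<le> n \<Longrightarrow> additive_op (chain a b)"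
proof (induction b)
  case (Suc b)
  then show ?case using additive_op_t[of "a + b"] by (auto simp: additive_op_def)
qed (simp add: additive_op_def)

lemmas chain_closed = additive_opD(1)[OF additive_op_chain]

lemma chain_commute:
  assumes "\<And>i x. a \<le> i \<Longrightarrow> i < a + b \<Longrightarrow> x \<in> carrier N \<Longrightarrow> u (t i x) = t i (u x)"
    and "1 \<le> a" "a + b \<le> n" "y \<in> carrier N"
  shows "u (chain a b y) = chain a b (u y)"
  using assms
proof (induction b)
  case (Suc b)
  have "u (t (a + b) (chain a b y)) = t (a + b) (u (chain a b y))"
    using Suc.prems by (intro Suc.prems(1)) (auto intro: chain_closed)
  then show ?case using Suc by simp
qed simp

text \<open>The relation \<open>(T_a \<dots> T_{a+b-1}) T_i = T_{i+1} (T_a \<dots> T_{a+b-1})\<close>, written for right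
  actions.\<close>

lemma t_chain_shift:
  assumes "1 \<le> a" "a \<le> i" "Suc i < a + b" "a + b \<le> n" "y \<in> carrier N"
  shows "t i (chain a b y) = chain a b (t (Suc i) y)"
  using assms
proof (induction b)
  case (Suc b)
  show ?case
  proof (cases "Suc i < a + b")
    case True
    have "t i (t (a + b) (chain a b y)) = t (a + b) (t i (chain a b y))"
      using Suc.prems True by (intro t_comm) (auto intro: chain_closed)
    then show ?thesis using Suc True by simp
  next
    case False
    then have i: "Suc i = a + b" using Suc.prems by simp
    then obtain b' where b: "b = Suc b'" "i = a + b'" using Suc.prems by (cases b) auto
    have c: "chain a b' y \<in> carrier N" using Suc.prems b by (intro chain_closed) auto
    have "t (Suc i) (chain a b' y) = chain a b' (t (Suc i) y)"
      using Suc.prems b by (intro chain_commute) (auto intro!: t_comm[symmetric])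
    then show ?thesis
      using t_braid[of i "chain a b' y"] Suc.prems b c by simp
  qed
qed simp

text \<open>The sum of \<open>(-1/q)^{l(w)} T_w\<close> over the minimal right coset representatives \<open>w\<close> of
  \<open>S_a \<times> S_b\<close> in \<open>S_{a+b}\<close>.  These correspond to the arrangements of \<open>a\<close> letters 1 and \<open>b\<close>
  letters 2.  The first summand collects those that end in 2.  In the second one the last letter 1 is
  first moved across all letters 2, which is a chain of length \<open>b\<close>.\<close>

fun shuffle :: "nat \<Rightarrow> nat \<Rightarrow> 'a \<Rightarrow> 'a" where
  "shuffle 0 b y = y"
| "shuffle (Suc a) 0 y = y"
| "shuffle (Suc a) (Suc b) y =
     shuffle (Suc a) b y \<oplus> shuffle a (Suc b) ((s ^^ Suc b) (chain (Suc a) (Suc b) y))"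

lemma shuffle_0_right [simp]: "shuffle a 0 y = y"
  by (cases a) auto

lemma additive_op_shuffle: "a + b \<le> n \<Longrightarrow> additive_op (shuffle a b)"
proof (induction a arbitrary: b)
  case (Suc a)
  show ?case
    using Suc.prems
  proof (induction b)
    case (Suc b)
    have 1: "additive_op (shuffle (Suc a) b)" "additive_op (shuffle a (Suc b))"
      using Suc.prems by (auto intro: Suc.IH \<open>\<And>b. a + b \<le> n \<Longrightarrow> additive_op (shuffle a b)\<close>)
    have 2: "additive_op (s ^^ Suc b)" by (rule additive_op_power[OF additive_op_s])
    have 3: "additive_op (chain (Suc a) (Suc b))" using Suc.prems by (intro additive_op_chain) auto
    note D = 1[THEN additive_opD(1)] 2[THEN additive_opD(1)] 3[THEN additive_opD(1)]
      1[THEN additive_opD(2)] 2[THEN additive_opD(2)] 3[THEN additive_opD(2)]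
    show ?case
      unfolding additive_op_def shuffle.simps
      by (simp add: D a_ac del: chain.simps shuffle.simps funpow.simps)
  qed (simp add: additive_op_def)
qed (simp add: additive_op_def)

lemmas shuffle_closed = additive_opD(1)[OF additive_op_shuffle]

lemma power_commute:
  assumes "\<And>x. x \<in> carrier N \<Longrightarrow> u (s x) = s (u x)" "y \<in> carrier N"
  shows "u ((s ^^ k) y) = (s ^^ k) (u y)"
proof (induction k)
  case (Suc k)
  then show ?case using assms additive_opD(1)[OF additive_op_power[OF additive_op_s]] by simp
qed simp

text \<open>Only the generators with index below \<open>a + b\<close> and the scalar occur in \<open>shuffle a b\<close>.\<close>

lemma shuffle_commute:
  assumes u: "additive_op u" "\<And>x. x \<in> carrier N \<Longrightarrow> u (s x) = s (u x)"
    and "\<And>i x. 1 \<le> i \<Longrightarrow> i < a + b \<Longrightarrow> x \<in> carrier N \<Longrightarrow> u (t i x) = t i (u x)"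
    and "a + b \<le> n" "y \<in> carrier N"
  shows "u (shuffle a b y) = shuffle a b (u y)"
  using assms(3-)
proof (induction a b y rule: shuffle.induct)
  case (3 a b y)
  have c: "chain (Suc a) (Suc b) y \<in> carrier N"
    using "3.prems" by (intro chain_closed) auto
  let ?y = "(s ^^ Suc b) (chain (Suc a) (Suc b) y)"
  have y: "?y \<in> carrier N" using c by (rule additive_opD(1)[OF additive_op_power[OF additive_op_s]])
  have "u ?y = (s ^^ Suc b) (chain (Suc a) (Suc b) (u y))"
    using "3.prems" by (subst power_commute[where u = u, OF u(2) c]) (auto simp del: chain.simps funpow.simps intro!: arg_cong[of _ _ "s ^^ Suc b"] chain_commute)
  moreover have "u (shuffle (Suc a) b y) = shuffle (Suc a) b (u y)"
    using "3.prems" by (intro "3.IH"(1)) auto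
  moreover have "u (shuffle a (Suc b) ?y) = shuffle a (Suc b) (u ?y)"
    using "3.prems" y by (intro "3.IH"(2)) (auto simp del: chain.simps funpow.simps)
  moreover have "shuffle (Suc a) b y \<in> carrier N" "shuffle a (Suc b) ?y \<in> carrier N"
    using "3.prems" y by (auto intro!: shuffle_closed simp del: chain.simps funpow.simps)
  ultimately show ?case
    by (simp add: additive_opD(2)[OF u(1)] del: chain.simps funpow.simps)
qed auto

lemma t_shuffle_commute:
  assumes "a + b < i" "i < n" "y \<in> carrier N"
  shows "t i (shuffle a b y) = shuffle a b (t i y)"
  using assms by (intro shuffle_commute additive_op_t t_s) (auto intro: t_comm[symmetric])

lemma s_power_closed: "x \<in> carrier N \<Longrightarrow> (s ^^ k) x \<in> carrier N"
  by (rule additive_opD(1)[OF additive_op_power[OF additive_op_s]])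

lemma s_power_minus: "x \<in> carrier N \<Longrightarrow> (s ^^ k) (\<ominus> x) = \<ominus> (s ^^ k) x"
  by (rule additive_op_minus[OF additive_op_power[OF additive_op_s]])

lemma t_s_power: "1 \<le> i \<Longrightarrow> i < n \<Longrightarrow> x \<in> carrier N \<Longrightarrow> t i ((s ^^ k) x) = (s ^^ k) (t i x)"
  by (rule power_commute) (auto intro: t_s)

lemma chain_minus: "1 \<le> a \<Longrightarrow> a + b \<le> n \<Longrightarrow> x \<in> carrier N \<Longrightarrow> chain a b (\<ominus> x) = \<ominus> chain a b x"
  by (rule additive_op_minus[OF additive_op_chain])

lemma shuffle_minus: "a + b \<le> n \<Longrightarrow> x \<in> carrier N \<Longrightarrow> shuffle a b (\<ominus> x) = \<ominus> shuffle a b x"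
  by (rule additive_op_minus[OF additive_op_shuffle])

lemma chain_s_power:
  assumes "1 \<le> a" "a + b \<le> n" "x \<in> carrier N"
  shows "chain a b ((s ^^ k) x) = (s ^^ k) (chain a b x)"
proof -
  have "(s ^^ k) (chain a b x) = chain a b ((s ^^ k) x)"
    using assms by (intro chain_commute) (auto intro!: t_s_power[symmetric])
  then show ?thesis by simp
qed

text \<open>The relation \<open>(T_a \<dots> T_{a+b}) (T_a \<dots> T_{a+c-1}) = (T_{a+1} \<dots> T_{a+c}) (T_a \<dots> T_{a+b})\<close>.\<close>

lemma chain_chain_shift:
  assumes "1 \<le> a" "c \<le> b" "a + Suc b \<le> n" "y \<in> carrier N"
  shows "chain a c (chain a (Suc b) y) = chain a (Suc b) (chain (Suc a) c y)"
  using assms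
proof (induction c)
  case (Suc c)
  have "t (a + c) (chain a (Suc b) (chain (Suc a) c y)) = chain a (Suc b) (t (Suc (a + c)) (chain (Suc a) c y))"
    using Suc.prems by (intro t_chain_shift) (auto intro!: chain_closed)
  then show ?case using Suc by (simp del: chain.simps(2) add: chain.simps(2)[of _ c])
qed simp

text \<open>The generators with index below \<open>a + b - 1\<close> act by \<open>-1\<close> on both summands of the recursion, by
  induction.  For the last generator the recursion is unfolded once more, which groups the arrangements
  by their last two letters.  The parts with equal last letters are eigenvectors because the generator
  can be moved to the front, where it hits an eigenvector.  The parts ending in 12 and 21 combine to
  \<open>w (1 - T/q)\<close>, an eigenvector by the quadratic relation.\<close>

lemma shuffle_sign:
  assumes "a + b \<le> n" "y \<in> carrier N"
    and "\<And>i. 1 \<le> i \<Longrightarrow> i < a + b \<Longrightarrow> i \<noteq> a \<Longrightarrow> t i y = \<ominus> y"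
    and "1 \<le> i" "i < a + b"
  shows "t i (shuffle a b y) = \<ominus> shuffle a b y"
  using assms
proof (induction a b y arbitrary: i rule: shuffle.induct)
  case (3 a b y)
  note n = "3.prems"(1) and y = "3.prems"(2) and sgn = "3.prems"(3)
  define m where "m = Suc (a + b)"
  have m: "1 \<le> m" "m < n" using n by (auto simp: m_def)
  let ?u = "(s ^^ b) (chain (Suc a) b y)"
  let ?y' = "(s ^^ Suc b) (chain (Suc a) (Suc b) y)"
  have cl: "chain (Suc a) b y \<in> carrier N" "chain (Suc a) (Suc b) y \<in> carrier N"
    using n y by (auto intro!: chain_closed simp del: chain.simps)
  have y'_closed: "?y' \<in> carrier N" and u_closed: "?u \<in> carrier N"
    using cl by (auto intro!: s_power_closed simp del: chain.simps funpow.simps)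
  have shc: "shuffle (Suc a) b y \<in> carrier N" "shuffle a (Suc b) ?y' \<in> carrier N"
    using n y y'_closed by (auto intro!: shuffle_closed simp del: chain.simps funpow.simps)
  have y'_sgn: "t j ?y' = \<ominus> ?y'" if "1 \<le> j" "j < m" "j \<noteq> a" for j
  proof -
    have "t j (chain (Suc a) (Suc b) y) = \<ominus> chain (Suc a) (Suc b) y"
    proof (cases "j < a")
      case True
      have "t j (chain (Suc a) (Suc b) y) = chain (Suc a) (Suc b) (t j y)"
        using that n y True m by (intro chain_commute t_comm) (auto simp: m_def)
      also have "\<dots> = \<ominus> chain (Suc a) (Suc b) y"
        using that n y True m sgn[of j] by (simp add: chain_minus m_def del: chain.simps)
      finally show ?thesis .
    next
      case False
      have "t j (chain (Suc a) (Suc b) y) = chain (Suc a) (Suc b) (t (Suc j) y)"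
        using that n y False by (intro t_chain_shift) (auto simp: m_def)
      also have "\<dots> = \<ominus> chain (Suc a) (Suc b) y"
        using that n y False sgn[of "Suc j"] by (simp add: chain_minus m_def del: chain.simps)
      finally show ?thesis .
    qed
    then show ?thesis
      using that m cl by (simp add: t_s_power s_power_minus del: chain.simps funpow.simps)
  qed
  show ?case
  proof (cases "i < m")
    case True
    have "t i (shuffle (Suc a) b y) = \<ominus> shuffle (Suc a) b y"
      using "3.prems" True by (intro "3.IH"(1)) (auto simp: m_def)
    moreover have "t i (shuffle a (Suc b) ?y') = \<ominus> shuffle a (Suc b) ?y'"
      using "3.prems" True y'_closed y'_sgn
      by (intro "3.IH"(2)) (auto simp: m_def simp del: chain.simps funpow.simps)
    ultimately show ?thesis
      using shc True m "3.prems"(4) by (simp add: t_add minus_add del: chain.simps funpow.simps)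
  next
    case False
    then have i: "i = m" using "3.prems" by (simp add: m_def)
    \<comment> \<open>\<open>U\<close> is the part of the sum whose last two letters are 22; it is empty for \<open>b = 0\<close>\<close>
    obtain U where U: "U \<in> carrier N" "t m U = \<ominus> U" "shuffle (Suc a) b y = U \<oplus> shuffle a b ?u"
    proof (cases b)
      case 0
      have "t m \<zero> = \<zero>" by (rule additive_op_zero[OF additive_op_t[OF m]])
      moreover have "\<ominus> \<zero> = \<zero>" by (rule minus_equality) auto
      ultimately show ?thesis by (intro that[of \<zero>]) (simp_all only: l_zero y 0 shuffle_0_right zero_closed chain.simps funpow_0)
    next
      case (Suc b')
      have "t m (shuffle (Suc a) b' y) = shuffle (Suc a) b' (t m y)"
        using m y by (intro t_shuffle_commute) (auto simp: m_def Suc)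
      also have "\<dots> = \<ominus> shuffle (Suc a) b' y"
        using sgn[of m] n y by (simp add: m_def Suc shuffle_minus)
      finally show ?thesis
        using that[of "shuffle (Suc a) b' y"] n y by (simp add: Suc shuffle_closed)
    qed
    \<comment> \<open>\<open>V\<close> is the part whose last two letters are 11: two chains, across which the last generator
       turns into the generator at \<open>a\<close>\<close>
    obtain V where V: "V \<in> carrier N" "t m V = \<ominus> V" "shuffle a (Suc b) ?y' = shuffle a b ?y' \<oplus> V"
    proof (cases a)
      case 0
      have "t m \<zero> = \<zero>" by (rule additive_op_zero[OF additive_op_t[OF m]])
      moreover have "\<ominus> \<zero> = \<zero>" by (rule minus_equality) auto
      ultimately show ?thesis
        using y'_closed by (intro that[of \<zero>]) (simp_all only: r_zero 0 shuffle.simps(1) zero_closed)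
    next
      case (Suc a')
      let ?z = "(s ^^ Suc b) (chain a (Suc b) ?y')"
      have z: "?z \<in> carrier N"
        using y'_closed n Suc by (auto intro!: s_power_closed chain_closed simp del: chain.simps funpow.simps)
      have a: "t a y = \<ominus> y" using sgn[of a] Suc by simp
      have "t m (chain a (Suc b) (chain (Suc a) (Suc b) y)) = chain a (Suc (Suc b)) (chain (Suc a) (Suc b) y)"
        by (simp add: m_def)
      also have "\<dots> = chain a (Suc b) (chain a (Suc (Suc b)) y)"
        using n y Suc by (intro chain_chain_shift[symmetric]) auto
      also have "\<dots> = chain a (Suc b) (chain (Suc a) (Suc b) (\<ominus> y))"
        by (simp only: chain_Suc_left[of a "Suc b" y] a)
      also have "\<dots> = \<ominus> chain a (Suc b) (chain (Suc a) (Suc b) y)"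
        using n y Suc cl by (simp add: chain_minus del: chain.simps)
      finally have tm: "t m (chain a (Suc b) (chain (Suc a) (Suc b) y))
          = \<ominus> chain a (Suc b) (chain (Suc a) (Suc b) y)" .
      have cc: "chain a (Suc b) (chain (Suc a) (Suc b) y) \<in> carrier N"
        using n y Suc by (intro chain_closed) auto
      have z_eq: "?z = (s ^^ Suc b) ((s ^^ Suc b) (chain a (Suc b) (chain (Suc a) (Suc b) y)))"
        using n cl Suc by (simp add: chain_s_power del: chain.simps funpow.simps)
      have tz: "t m ?z = \<ominus> ?z"
        unfolding z_eq using m cc tm
        by (simp add: t_s_power s_power_minus s_power_closed del: chain.simps funpow.simps)
      have "t m (shuffle a' (Suc b) ?z) = shuffle a' (Suc b) (t m ?z)"
        using m z by (intro t_shuffle_commute) (auto simp: m_def Suc)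
      also have "\<dots> = \<ominus> shuffle a' (Suc b) ?z"
        unfolding tz using n z Suc by (intro shuffle_minus) auto
      finally have "t m (shuffle a' (Suc b) ?z) = \<ominus> shuffle a' (Suc b) ?z" .
      moreover have "shuffle a' (Suc b) ?z \<in> carrier N"
        using n z Suc by (intro shuffle_closed) auto
      moreover have "shuffle a (Suc b) ?y' = shuffle a b ?y' \<oplus> shuffle a' (Suc b) ?z"
        using Suc by (simp only: shuffle.simps)
      ultimately show ?thesis using that by blast
    qed
    \<comment> \<open>the parts ending in 12 and 21 differ by one generator and the weight \<open>-1/q\<close>\<close>
    have "?y' = s (t m ?u)"
      using m cl(1) by (simp add: m_def t_s_power)
    then have "shuffle a b ?y' = s (shuffle a b (t m ?u))"
      using n u_closed m t_closed[OF m u_closed] by (simp add: shuffle_commute[OF additive_op_s, symmetric] t_s)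
    also have "shuffle a b (t m ?u) = t m (shuffle a b ?u)"
      using m u_closed by (intro t_shuffle_commute[symmetric]) (auto simp: m_def)
    finally have mid: "shuffle a b ?y' = s (t m (shuffle a b ?u))" .
    define w where "w = shuffle a b ?u \<oplus> s (t m (shuffle a b ?u))"
    have cu: "shuffle a b ?u \<in> carrier N" using n u_closed by (intro shuffle_closed) auto
    have w: "w \<in> carrier N" "t m w = \<ominus> w"
      using t_quadratic[OF m cu] m cu by (auto simp: w_def t_closed s_closed)
    have "shuffle (Suc a) (Suc b) y = (U \<oplus> shuffle a b ?u) \<oplus> (s (t m (shuffle a b ?u)) \<oplus> V)"
      by (simp only: shuffle.simps U(3) V(3) mid)
    also have "\<dots> = U \<oplus> w \<oplus> V"
      using U V m cu by (simp add: w_def a_assoc t_closed s_closed)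
    finally have eq: "shuffle (Suc a) (Suc b) y = U \<oplus> w \<oplus> V" .
    show ?thesis
      unfolding eq i using U V w m by (simp add: t_add minus_add)
  qed
qed simp_all

text \<open>Step \<open>k\<close> merges a block of length \<open>e\<close> into the \<open>k\<close> blocks merged so far.\<close>

definition multishuffle :: "nat \<Rightarrow> nat \<Rightarrow> 'a \<Rightarrow> 'a" where
  "multishuffle e d y = fold (\<lambda>k. shuffle (k * e) e) [0..<d] y"

lemma multishuffle_simps [simp]:
  "multishuffle e 0 y = y"
  "multishuffle e (Suc d) y = shuffle (d * e) e (multishuffle e d y)"
  by (simp_all add: multishuffle_def)

lemma additive_op_multishuffle: "d * e \<le> n \<Longrightarrow> additive_op (multishuffle e d)"
proof (induction d)
  case (Suc d)
  then show ?case using additive_op_shuffle[of "d * e" e] by (simp add: additive_op_def add.commute)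
qed (simp add: additive_op_def)

lemma multishuffle_commute:
  assumes u: "additive_op u" "\<And>x. x \<in> carrier N \<Longrightarrow> u (s x) = s (u x)"
    and "\<And>i x. 1 \<le> i \<Longrightarrow> i < d * e \<Longrightarrow> x \<in> carrier N \<Longrightarrow> u (t i x) = t i (u x)"
    and "d * e \<le> n" "y \<in> carrier N"
  shows "u (multishuffle e d y) = multishuffle e d (u y)"
  using assms(3-)
proof (induction d)
  case (Suc d)
  have "multishuffle e d y \<in> carrier N"
    using Suc.prems by (intro additive_opD(1)[OF additive_op_multishuffle]) auto
  then have "u (shuffle (d * e) e (multishuffle e d y)) = shuffle (d * e) e (u (multishuffle e d y))"
    using Suc.prems by (intro shuffle_commute u) (auto simp: add.commute)
  then show ?case using Suc by simp
qed simp

text \<open>After \<open>d\<close> steps the boundaries at \<open>e, 2e, \<dots>, (d-1)e\<close> are no longer exceptional.  The generators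
  further to the right commute with everything that happened.\<close>

lemma multishuffle_sign:
  assumes "\<And>i. 1 \<le> i \<Longrightarrow> i < n \<Longrightarrow> \<not> e dvd i \<Longrightarrow> t i y = \<ominus> y"
    and "y \<in> carrier N" "d * e \<le> n" "1 \<le> i" "i < n" "\<not> e dvd i \<or> i < d * e"
  shows "t i (multishuffle e d y) = \<ominus> multishuffle e d y"
  using assms(3-)
proof (induction d arbitrary: i)
  case (Suc d)
  have y: "multishuffle e d y \<in> carrier N"
    using Suc.prems assms(2) by (intro additive_opD(1)[OF additive_op_multishuffle]) auto
  have IH: "t j (multishuffle e d y) = \<ominus> multishuffle e d y"
    if "1 \<le> j" "j < n" "\<not> e dvd j \<or> j < d * e" for j
    using Suc.IH[of j] Suc.prems(1) that by simp
  show ?case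
  proof (cases "i < d * e + e")
    case True
    have "t j (multishuffle e d y) = \<ominus> multishuffle e d y"
      if "1 \<le> j" "j < d * e + e" "j \<noteq> d * e" for j
    proof (rule IH)
      show "\<not> e dvd j \<or> j < d * e"
      proof (rule disjCI)
        assume "\<not> j < d * e"
        then have "0 < j - d * e" "j - d * e < e" using that by auto
        then have "\<not> e dvd j - d * e" by (auto dest: dvd_imp_le)
        then show "\<not> e dvd j" using \<open>\<not> j < d * e\<close> by (auto simp: dvd_diff_nat)
      qed
    qed (use that Suc.prems in auto)
    then show ?thesis
      using Suc.prems y True by (simp add: shuffle_sign add.commute)
  next
    case False
    then have "i \<noteq> d * e + e" "\<not> e dvd i" using Suc.prems by auto
    then have "t i (shuffle (d * e) e (multishuffle e d y)) = shuffle (d * e) e (t i (multishuffle e d y))"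
      using False Suc.prems y by (intro t_shuffle_commute) auto
    also have "\<dots> = \<ominus> shuffle (d * e) e (multishuffle e d y)"
      using IH[of i] \<open>\<not> e dvd i\<close> Suc.prems y by (simp add: shuffle_minus add.commute)
    finally show ?thesis by simp
  qed
qed (use assms(1,2) in auto)

end

section \<open>Relative projectivity over equal blocks of length e\<close>

lemma simple_refl_in_parabolic_equal_blocks:
  assumes "1 \<le> j" "j < d * e" "\<not> e dvd j"
  shows "simple_refl j \<in> parabolic (d * e) (replicate d e)"
proof -
  have "simple_refl j ` block (replicate d e) k = block (replicate d e) k" if k: "k < d" for k
  proof -
    have b: "block (replicate d e) k = {k * e<..(k + 1) * e}"
      using k by (simp add: block_def sum_list_replicate min_def)
    have "j \<noteq> k * e" "j \<noteq> (k + 1) * e" using assms(3) by auto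
    then have "simple_refl j ` {k * e<..(k + 1) * e} \<subseteq> {k * e<..(k + 1) * e}"
      by (auto simp: simple_refl_def Transposition.transpose_def)
    then show ?thesis
      unfolding b
      using image_mono[of "simple_refl j ` {k * e<..(k + 1) * e}" "{k * e<..(k + 1) * e}" "simple_refl j"]
      by (simp add: image_image)
  qed
  then show ?thesis
    using simple_refl_permutes[OF assms(1,2)] by (simp add: parabolic_def sym_group_carrier)
qed

text \<open>The section sends \<open>m\<close> to the vector obtained from \<open>m \<otimes> 1\<close> by merging the \<open>d\<close> blocks.  On
  \<open>m \<otimes> 1\<close> the generators not at a boundary act by \<open>-1\<close>, because they lie in the parabolic
  subalgebra.  Merging block \<open>k\<close> multiplies \<open>\<epsilon>\<close> by \<open>k + 1\<close>, so the composite is multiplication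
  by \<open>d!\<close>.\<close>

lemma relatively_projective_sign_equal_blocks:
  fixes q :: "'f::field_char_0"
  assumes q0: "q \<noteq> 0" and root: "\<And>k. q ^ k = 1 \<longleftrightarrow> e dvd k" and "0 < e"
  shows "relatively_projective (d * e) q (replicate d e) (sign_module :: ((word \<Rightarrow>\<^sub>0 'f) set, 'f) right_mod)"
proof -
  define n where "n = d * e"
  let ?S = "sign_module :: ((word \<Rightarrow>\<^sub>0 'f) set, 'f) right_mod"
  let ?H = "hecke n q"
  let ?l = "replicate d e"
  let ?T = "hecke_gen n q" and ?C = "hecke_scalar n q"
  interpret H: ring ?H by (rule ring_hecke)
  interpret S: right_module ?H ?S by (rule right_module_sign)
  interpret T: tensor ?H ?S "hecke_parabolic n q ?l" by (rule tensor_sign)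
  \<comment> \<open>the weight of one exchange in the coset sum\<close>
  define c where "c = - inverse q"
  have gc: "?T i \<in> carrier ?H" if "1 \<le> i" "i < n" for i
    using hecke_gen_closed[of i n q] that by simp
  have quad: "?T i \<oplus>\<^bsub>?H\<^esub> ?T i \<otimes>\<^bsub>?H\<^esub> ?C c \<otimes>\<^bsub>?H\<^esub> ?T i = \<ominus>\<^bsub>?H\<^esub> (\<one>\<^bsub>?H\<^esub> \<oplus>\<^bsub>?H\<^esub> ?T i \<otimes>\<^bsub>?H\<^esub> ?C c)"
    if i: "1 \<le> i" "i < n" for i
  proof -
    note T = gc[OF i]
    have comm: "?C a \<otimes>\<^bsub>?H\<^esub> ?T i = ?T i \<otimes>\<^bsub>?H\<^esub> ?C a" for a
      using hecke_scalar_gen_commute[of i n q a] i by simp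
    have "?T i \<otimes>\<^bsub>?H\<^esub> ?C c \<otimes>\<^bsub>?H\<^esub> ?T i = (?T i \<otimes>\<^bsub>?H\<^esub> ?T i) \<otimes>\<^bsub>?H\<^esub> ?C c"
      using T by (simp add: H.m_assoc comm)
    also have "?T i \<otimes>\<^bsub>?H\<^esub> ?T i = ?T i \<otimes>\<^bsub>?H\<^esub> ?C (q - 1) \<oplus>\<^bsub>?H\<^esub> ?C q"
      using hecke_gen_quadratic[of i n q] i by (simp add: comm)
    also have "(?T i \<otimes>\<^bsub>?H\<^esub> ?C (q - 1) \<oplus>\<^bsub>?H\<^esub> ?C q) \<otimes>\<^bsub>?H\<^esub> ?C c
        = ?T i \<otimes>\<^bsub>?H\<^esub> ?C ((q - 1) * c) \<oplus>\<^bsub>?H\<^esub> ?C (q * c)"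
      using T by (simp add: H.l_distr H.m_assoc hecke_scalar_mult)
    finally have TCT: "?T i \<otimes>\<^bsub>?H\<^esub> ?C c \<otimes>\<^bsub>?H\<^esub> ?T i = ?T i \<otimes>\<^bsub>?H\<^esub> ?C ((q - 1) * c) \<oplus>\<^bsub>?H\<^esub> ?C (q * c)" .
    have "?T i \<oplus>\<^bsub>?H\<^esub> ?T i \<otimes>\<^bsub>?H\<^esub> ?C c \<otimes>\<^bsub>?H\<^esub> ?T i \<oplus>\<^bsub>?H\<^esub> (\<one>\<^bsub>?H\<^esub> \<oplus>\<^bsub>?H\<^esub> ?T i \<otimes>\<^bsub>?H\<^esub> ?C c)
      = ?T i \<otimes>\<^bsub>?H\<^esub> (?C 1 \<oplus>\<^bsub>?H\<^esub> ?C ((q - 1) * c) \<oplus>\<^bsub>?H\<^esub> ?C c) \<oplus>\<^bsub>?H\<^esub> (?C (q * c) \<oplus>\<^bsub>?H\<^esub> ?C 1)"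
      unfolding TCT using T by (simp add: H.r_distr hecke_scalar_1 H.a_ac)
    also have "\<dots> = \<zero>\<^bsub>?H\<^esub>"
    proof -
      have "1 + (q - 1) * c + c = 0" "q * c + 1 = 0" using q0 by (simp_all add: c_def algebra_simps)
      then show ?thesis using T by (simp add: hecke_scalar_add hecke_scalar_0)
    qed
    finally show ?thesis using T by (intro H.minus_equality[symmetric]) auto
  qed
  define t where "t i x = x \<triangleleft>\<^bsub>T.N\<^esub> ?T i" for i x
  define s where "s x = x \<triangleleft>\<^bsub>T.N\<^esub> ?C c" for x
  have comm: "?C a \<otimes>\<^bsub>?H\<^esub> ?T i = ?T i \<otimes>\<^bsub>?H\<^esub> ?C a" if "1 \<le> i" "i < n" for a i
    using hecke_scalar_gen_commute[of i n q a] that by simp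
  interpret O: hecke_operators T.N n t s
  proof (unfold_locales, goal_cases)
    case (1 i x) then show ?case by (simp add: t_def T.N.ract_closed gc)
  next
    case (2 i x y) then show ?case by (simp add: t_def T.N.ract_add_left gc)
  next
    case (3 x) then show ?case by (simp add: s_def T.N.ract_closed)
  next
    case (4 x y) then show ?case by (simp add: s_def T.N.ract_add_left)
  next
    case (5 i x) then show ?case by (simp add: s_def t_def gc comm flip: T.N.ract_mult)
  next
    case (6 i j x)
    then have "?T i \<otimes>\<^bsub>?H\<^esub> ?T j = ?T j \<otimes>\<^bsub>?H\<^esub> ?T i"
      by (intro hecke_gen_commute) auto
    then show ?case using 6 gc[of i] gc[of j] by (simp add: t_def flip: T.N.ract_mult)
  next
    case (7 i x)
    then show ?case
      using hecke_gen_braid[of i n q] gc[of i] gc[of "Suc i"]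
      by (simp add: t_def flip: T.N.ract_mult)
  next
    case (8 i x)
    note T = gc[OF 8(1,2)]
    have u: "x \<oplus>\<^bsub>T.N\<^esub> s (t i x) = x \<triangleleft>\<^bsub>T.N\<^esub> (\<one>\<^bsub>?H\<^esub> \<oplus>\<^bsub>?H\<^esub> ?T i \<otimes>\<^bsub>?H\<^esub> ?C c)"
      using 8(3) T by (simp add: t_def s_def T.N.ract_add_right T.N.ract_mult T.N.ract_one)
    have "t i (x \<oplus>\<^bsub>T.N\<^esub> s (t i x)) = x \<triangleleft>\<^bsub>T.N\<^esub> ((\<one>\<^bsub>?H\<^esub> \<oplus>\<^bsub>?H\<^esub> ?T i \<otimes>\<^bsub>?H\<^esub> ?C c) \<otimes>\<^bsub>?H\<^esub> ?T i)"
      unfolding u using 8(3) T by (simp add: t_def T.N.ract_mult)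
    also have "(\<one>\<^bsub>?H\<^esub> \<oplus>\<^bsub>?H\<^esub> ?T i \<otimes>\<^bsub>?H\<^esub> ?C c) \<otimes>\<^bsub>?H\<^esub> ?T i = \<ominus>\<^bsub>?H\<^esub> (\<one>\<^bsub>?H\<^esub> \<oplus>\<^bsub>?H\<^esub> ?T i \<otimes>\<^bsub>?H\<^esub> ?C c)"
      using quad[OF 8(1,2)] T by (simp add: H.l_distr)
    also have "x \<triangleleft>\<^bsub>T.N\<^esub> \<dots> = \<ominus>\<^bsub>T.N\<^esub> (x \<oplus>\<^bsub>T.N\<^esub> s (t i x))"
      unfolding u using 8(3) T by (intro T.N.ract_minus_right) auto
    finally show ?case .
  qed
  obtain \<epsilon> where \<epsilon>_add: "\<And>x y. x \<in> carrier T.N \<Longrightarrow> y \<in> carrier T.N \<Longrightarrow> \<epsilon> (x \<oplus>\<^bsub>T.N\<^esub> y) = \<epsilon> x + \<epsilon> y"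
    and \<epsilon>_pure: "\<And>m h. h \<in> carrier ?H \<Longrightarrow> \<epsilon> (T.pure m h) = m * sign_char h"
  proof -
    obtain F where "\<And>x. x \<in> carrier T.N \<Longrightarrow> F x \<in> carrier ?S"
      "\<And>x y. x \<in> carrier T.N \<Longrightarrow> y \<in> carrier T.N \<Longrightarrow> F (x \<oplus>\<^bsub>T.N\<^esub> y) = F x \<oplus>\<^bsub>?S\<^esub> F y"
      "\<And>m h. m \<in> carrier ?S \<Longrightarrow> h \<in> carrier ?H \<Longrightarrow> F (T.pure m h) = m * sign_char h"
    proof (rule T.N_universal[of ?S "\<lambda>m h. m * sign_char h"])
      show "abelian_group ?S" by (rule S.M.abelian_group_axioms)
      fix m :: 'f and b h assume b: "b \<in> hecke_parabolic n q ?l" and h: "h \<in> carrier ?H"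
      have "b \<in> carrier ?H" using b hecke_parabolic_subset_carrier by blast
      then show "m \<triangleleft>\<^bsub>?S\<^esub> b * sign_char h = m * sign_char (b \<otimes>\<^bsub>?H\<^esub> h)"
        using h by (simp add: sign_char_mult)
    qed (auto simp: sign_char_add algebra_simps)
    then show ?thesis by (intro that[of F]) auto
  qed
  have \<epsilon>_zero: "\<epsilon> \<zero>\<^bsub>T.N\<^esub> = 0"
    using \<epsilon>_add[of "\<zero>\<^bsub>T.N\<^esub>" "\<zero>\<^bsub>T.N\<^esub>"] by simp
  have \<epsilon>_minus: "\<epsilon> (\<ominus>\<^bsub>T.N\<^esub> x) = - \<epsilon> x" if "x \<in> carrier T.N" for x
    using \<epsilon>_add[of "\<ominus>\<^bsub>T.N\<^esub> x" x] that by (simp add: T.N.M.l_neg \<epsilon>_zero eq_neg_iff_add_eq_0)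
  have \<epsilon>_act: "\<epsilon> (x \<triangleleft>\<^bsub>T.N\<^esub> h) = \<epsilon> x * sign_char h" if x: "x \<in> carrier T.N" and h: "h \<in> carrier ?H" for x h
    using x
  proof (induction rule: T.N_induct)
    case (pure m k)
    then show ?case using h by (simp add: T.pure_ract \<epsilon>_pure sign_char_mult)
  next
    case (diff x y)
    then show ?case
      using h by (simp add: a_minus_def T.N.ract_add_left T.N.ract_minus T.N.ract_closed \<epsilon>_add \<epsilon>_minus algebra_simps)
  qed
  have \<epsilon>_t: "\<epsilon> (t i x) = - \<epsilon> x" if "1 \<le> i" "i < n" "x \<in> carrier T.N" for i x
    using that gc[of i] by (simp add: t_def \<epsilon>_act sign_char_gen)
  have \<epsilon>_s: "\<epsilon> (s x) = c * \<epsilon> x" if "x \<in> carrier T.N" for x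
    using that by (simp add: s_def \<epsilon>_act sign_char_scalar)
  have \<epsilon>_chain: "\<epsilon> (O.chain a b y) = (- 1) ^ b * \<epsilon> y"
    if "1 \<le> a" "a + b \<le> n" "y \<in> carrier T.N" for a b y
    using that(2)
  proof (induction b)
    case (Suc b)
    then show ?case
      using that O.chain_closed[of a b y] by (simp add: \<epsilon>_t)
  qed simp
  have \<epsilon>_power: "\<epsilon> ((s ^^ k) y) = c ^ k * \<epsilon> y" if "y \<in> carrier T.N" for k y
  proof (induction k)
    case (Suc k)
    then show ?case
      using O.s_power_closed[OF that, of k] by (simp add: \<epsilon>_s)
  qed simp
  have \<epsilon>_shuffle: "\<epsilon> (O.shuffle a b y) = qbinom (inverse q) a b * \<epsilon> y"
    if "a + b \<le> n" "y \<in> carrier T.N" for a b y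
    using that
  proof (induction a b y rule: O.shuffle.induct)
    case (3 a b y)
    let ?z = "O.chain (Suc a) (Suc b) y"
    have z: "?z \<in> carrier T.N" using 3 by (intro O.chain_closed) auto
    note z' = O.s_power_closed[OF z, of "Suc b"]
    have "\<epsilon> ((s ^^ Suc b) ?z) = c ^ Suc b * ((- 1) ^ Suc b * \<epsilon> y)"
      using z 3 \<epsilon>_chain[of "Suc a" "Suc b" y] \<epsilon>_power[OF z, of "Suc b"] by (simp only:)
    also have "\<dots> = inverse q ^ Suc b * \<epsilon> y"
      by (simp only: c_def mult.assoc[symmetric] power_mult_distrib[symmetric]) simp
    finally have e: "\<epsilon> ((s ^^ Suc b) ?z) = inverse q ^ Suc b * \<epsilon> y" .
    have "\<epsilon> (O.shuffle (Suc a) (Suc b) y) = \<epsilon> (O.shuffle (Suc a) b y) + \<epsilon> (O.shuffle a (Suc b) ((s ^^ Suc b) ?z))"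
      unfolding O.shuffle.simps using 3 z' by (intro \<epsilon>_add O.shuffle_closed) auto
    also have "\<dots> = qbinom (inverse q) (Suc a) b * \<epsilon> y + qbinom (inverse q) a (Suc b) * (inverse q ^ Suc b * \<epsilon> y)"
      using "3.IH"(1) "3.IH"(2) "3.prems" z' by (simp only: e[symmetric])
    finally show ?case by (simp add: algebra_simps)
  qed auto
  have root': "inverse q ^ k = 1 \<longleftrightarrow> e dvd k" for k
    using root[of k] by (simp add: power_inverse inverse_eq_1_iff)
  have \<epsilon>_multi: "\<epsilon> (O.multishuffle e k y) = fact k * \<epsilon> y" if "k \<le> d" "y \<in> carrier T.N" for k y
    using that(1)
  proof (induction k)
    case (Suc k)
    have le: "k * e + e \<le> n" using Suc.prems mult_le_mono1[of "Suc k" d e] by (simp add: n_def add.commute)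
    then have "O.multishuffle e k y \<in> carrier T.N"
      using that by (intro O.additive_opD(1)[OF O.additive_op_multishuffle]) auto
    then have "\<epsilon> (O.multishuffle e (Suc k) y) = of_nat (Suc k) * \<epsilon> (O.multishuffle e k y)"
      using le by (simp only: O.multishuffle_simps \<epsilon>_shuffle qbinom_root_of_unity[OF root' \<open>0 < e\<close>])
    then show ?case using Suc by (simp add: algebra_simps)
  qed simp
  define f where "f m = O.multishuffle e d (T.pure m \<one>\<^bsub>?H\<^esub>)" for m
  have pc: "T.pure m \<one>\<^bsub>?H\<^esub> \<in> carrier T.N" for m by (rule T.pure_closed) auto
  note ms = O.additive_op_multishuffle[of d e, unfolded n_def[symmetric], OF order_refl]
  have f_closed: "f m \<in> carrier T.N" for m
    unfolding f_def by (rule O.additive_opD(1)[OF ms pc])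
  have f_add: "f (m + m') = f m \<oplus>\<^bsub>T.N\<^esub> f m'" for m m'
    using T.pure_add_left[of m m' "\<one>\<^bsub>?H\<^esub>"] O.additive_opD(2)[OF ms pc pc] by (simp add: f_def)
  have f_minus: "f (- m) = \<ominus>\<^bsub>T.N\<^esub> f m" for m
  proof -
    have "f 0 \<oplus>\<^bsub>T.N\<^esub> f 0 = f 0" using f_add[of 0 0] by simp
    then have "f 0 = \<zero>\<^bsub>T.N\<^esub>" using f_closed[of 0] T.N.M.add.l_cancel_one by simp
    then show ?thesis
      using f_add[of "- m" m] f_closed by (intro T.N.M.minus_equality[symmetric]) auto
  qed
  have pure_balanced: "T.pure (m * sign_char b) \<one>\<^bsub>?H\<^esub> = T.pure m \<one>\<^bsub>?H\<^esub> \<triangleleft>\<^bsub>T.N\<^esub> b"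
    if "b \<in> hecke_parabolic n q ?l" for m b
  proof -
    have "b \<in> carrier ?H" using that hecke_parabolic_subset_carrier by blast
    then show ?thesis using T.pure_balanced[of m b "\<one>\<^bsub>?H\<^esub>"] that by (simp add: T.pure_ract)
  qed
  have f_gen: "f (m * sign_char (?T i)) = f m \<triangleleft>\<^bsub>T.N\<^esub> ?T i" if i: "i \<in> {1..<n}" for m i
  proof -
    have base: "t j (T.pure m \<one>\<^bsub>?H\<^esub>) = \<ominus>\<^bsub>T.N\<^esub> T.pure m \<one>\<^bsub>?H\<^esub>"
      if j: "1 \<le> j" "j < n" "\<not> e dvd j" for j
    proof -
      have "simple_refl j \<in> parabolic n ?l"
        unfolding n_def by (rule simple_refl_in_parabolic_equal_blocks) (use j in \<open>auto simp: n_def\<close>)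
      then have "?T j \<in> hecke_parabolic n q ?l" using j by (intro hecke_gen_in_parabolic) auto
      then have "t j (T.pure m \<one>\<^bsub>?H\<^esub>) = T.pure (- m) \<one>\<^bsub>?H\<^esub>"
        using pure_balanced[of "?T j" m] by (simp add: t_def sign_char_gen)
      moreover have "T.pure (- m) \<one>\<^bsub>?H\<^esub> \<oplus>\<^bsub>T.N\<^esub> T.pure m \<one>\<^bsub>?H\<^esub> = \<zero>\<^bsub>T.N\<^esub>"
      proof -
        have "T.pure 0 \<one>\<^bsub>?H\<^esub> \<oplus>\<^bsub>T.N\<^esub> T.pure 0 \<one>\<^bsub>?H\<^esub> = T.pure 0 \<one>\<^bsub>?H\<^esub>"
          using T.pure_add_left[of 0 0 "\<one>\<^bsub>?H\<^esub>"] by simp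
        then have "T.pure 0 \<one>\<^bsub>?H\<^esub> = \<zero>\<^bsub>T.N\<^esub>" using pc[of 0] T.N.M.add.l_cancel_one by simp
        then show ?thesis using T.pure_add_left[of "- m" m "\<one>\<^bsub>?H\<^esub>"] by simp
      qed
      ultimately show ?thesis using T.N.M.minus_equality[of "T.pure (- m) \<one>\<^bsub>?H\<^esub>" "T.pure m \<one>\<^bsub>?H\<^esub>"] pc by simp
    qed
    have "t i (f m) = \<ominus>\<^bsub>T.N\<^esub> f m"
      unfolding f_def by (rule O.multishuffle_sign[OF base pc]) (use i in \<open>auto simp: n_def\<close>)
    then show ?thesis by (simp add: t_def sign_char_gen f_minus)
  qed
  have f_scalar: "f (m * sign_char (?C a)) = f m \<triangleleft>\<^bsub>T.N\<^esub> ?C a" for m a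
  proof -
    have "O.multishuffle e d (T.pure m \<one>\<^bsub>?H\<^esub>) \<triangleleft>\<^bsub>T.N\<^esub> ?C a
        = O.multishuffle e d (T.pure m \<one>\<^bsub>?H\<^esub> \<triangleleft>\<^bsub>T.N\<^esub> ?C a)"
    proof (rule O.multishuffle_commute[where u = "\<lambda>x. x \<triangleleft>\<^bsub>T.N\<^esub> ?C a"])
      show "O.additive_op (\<lambda>x. x \<triangleleft>\<^bsub>T.N\<^esub> ?C a)"
        by (simp add: O.additive_op_def T.N.ract_closed T.N.ract_add_left)
      show "s x \<triangleleft>\<^bsub>T.N\<^esub> ?C a = s (x \<triangleleft>\<^bsub>T.N\<^esub> ?C a)" if "x \<in> carrier T.N" for x
        using that by (simp add: s_def hecke_scalar_mult mult.commute flip: T.N.ract_mult)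
      show "t i x \<triangleleft>\<^bsub>T.N\<^esub> ?C a = t i (x \<triangleleft>\<^bsub>T.N\<^esub> ?C a)"
        if "1 \<le> i" "i < d * e" "x \<in> carrier T.N" for i x
        using that(1,3) that(2)[folded n_def] gc[of i] comm[of i a]
        by (simp add: t_def flip: T.N.ract_mult)
    qed (use pc in \<open>auto simp: n_def\<close>)
    then show ?thesis
      using pure_balanced[OF hecke_scalar_in_parabolic, of m a] by (simp add: f_def)
  qed
  have f_act: "f (m * sign_char h) = f m \<triangleleft>\<^bsub>T.N\<^esub> h" if "h \<in> carrier ?H" for m h
    using that
  proof (induction arbitrary: m rule: hecke_induct)
    case (add h k)
    then show ?case
      using f_closed by (simp add: sign_char_add distrib_left f_add T.N.ract_add_right)
  next
    case (mult h k)
    have "f (m * sign_char (h \<otimes>\<^bsub>?H\<^esub> k)) = f (m * sign_char h * sign_char k)"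
      using mult by (simp add: sign_char_mult mult.assoc)
    then show ?case using mult f_closed by (simp add: T.N.ract_mult)
  qed (fact f_scalar, fact f_gen)
  have \<epsilon>f: "\<epsilon> (f m) = fact d * m" for m
    using \<epsilon>_multi[of d "T.pure m \<one>\<^bsub>?H\<^esub>"] pc by (simp add: f_def \<epsilon>_pure sign_char_one)
  have "iso_to_direct_summand ?H ?S T.N"
  proof (rule iso_to_direct_summandI[OF right_module_sign T.right_module_N])
    show "(\<lambda>m. f (inverse (fact d) * m)) \<in> right_mod_hom ?H ?S T.N"
      by (auto simp: right_mod_hom_def f_closed distrib_left f_add mult.assoc[symmetric] f_act)
    show "\<epsilon> \<in> right_mod_hom ?H T.N ?S"
      by (auto simp: right_mod_hom_def \<epsilon>_add \<epsilon>_act)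
    show "\<epsilon> (f (inverse (fact d) * m)) = m" for m by (simp add: \<epsilon>f)
  qed
  then show ?thesis
    unfolding relatively_projective_def n_def[symmetric] using right_module_sign by blast
qed

section \<open>The vertex\<close>

theorem theorem6p4:
  fixes q :: "'f::{alg_closed_field, field_char_0}" and e d :: nat
  assumes "q \<noteq> 0"
    and "quantum_char q e"
    and "e > 1"
    and "d \<ge> 1"
  shows "has_vertex (d * e) q (sign_module :: ((word \<Rightarrow>\<^sub>0 'f) set, 'f) right_mod) (replicate d e)"
  unfolding has_vertex_def
proof (intro conjI allI impI)
  note root = quantum_char_power_eq_1_iff[OF assms(2)]
  have e: "0 < e" using assms(3) by simp
  show "composition (d * e) (replicate d e)"
    using e by (simp add: composition_def sum_list_replicate)
  show "relatively_projective (d * e) q (replicate d e) (sign_module :: ((word \<Rightarrow>\<^sub>0 'f) set, 'f) right_mod)"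
    by (rule relatively_projective_sign_equal_blocks[OF assms(1) root e])
  fix \<mu> assume \<mu>: "composition (d * e) \<mu> \<and>
    relatively_projective (d * e) q \<mu> (sign_module :: ((word \<Rightarrow>\<^sub>0 'f) set, 'f) right_mod)"
  let ?G = "sym_group (d * e)"
  have "q ^ (d * e) = 1" by (simp add: root)
  then have "e dvd sum_list (take k \<mu>)" if "k \<le> length \<mu>" for k
    using relatively_projective_sign_imp_root_of_unity[of q "d * e" \<mu> k] \<mu> that by (simp add: root)
  then have "parabolic (d * e) (replicate d e) \<subseteq> parabolic (d * e) \<mu>"
    using \<mu> e by (intro parabolic_equal_blocks_subset) auto
  moreover have "inv\<^bsub>?G\<^esub> id = id"
    using monoid.inv_one[OF group.is_monoid[OF sym_group_is_group[of "d * e"]]] by (simp add: sym_group_one)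
  moreover have "id <#\<^bsub>?G\<^esub> P #>\<^bsub>?G\<^esub> id = P" for P
    by (auto simp: l_coset_def r_coset_def sym_group_mult)
  ultimately have "id <#\<^bsub>?G\<^esub> parabolic (d * e) (replicate d e) #>\<^bsub>?G\<^esub> inv\<^bsub>?G\<^esub> id \<subseteq> parabolic (d * e) \<mu>"
    by simp
  then show "\<exists>g\<in>carrier ?G. g <#\<^bsub>?G\<^esub> parabolic (d * e) (replicate d e) #>\<^bsub>?G\<^esub> inv\<^bsub>?G\<^esub> g \<subseteq> parabolic (d * e) \<mu>"
    by (intro bexI[of _ id]) (auto simp: sym_group_carrier permutes_id)
qed

end
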